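(* Let $\{Z_n\}_{n\ge 0}$ be a branching random walk on $\mathbb{R}$ with offspring law $\{p_k\}_{k\ge0}$ and step size $X$, satisfying: $p_0=0$, $1<m<\infty$, $\mathbb{E}[X]=0$, $\mathbb{P}(X=0)<1$, and $\mathbb{E}[e^{\kappa X}]<\infty$ for some $\kappa>0$. Assume $\mathbb{E}[e^{\theta |Z_1|}]<\infty$ for some $\theta>0$, $x\in(0,L)$ and $a\in((\log m-I(x))^+,\log m)$. If $L=\infty$, then $$\lim_{n\rightarrow\infty}\frac{1}{n}\log\mathbb{P}\left(Z_n([xn,\infty))\geq e^{an}\right)=-I(a,x)\in(-\infty,0),$$ where $$I(a,x):=\inf\left\{sI\left(\frac{y}{s}\right)-s\log m \;:\; s\in\left(0,1-\frac{a}{\log m}\right],\ y\in(0,x],\ \log m-I\left(\frac{x-y}{1-s}\right)=\frac{a}{1-s}\right\}.$$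
   Context: Branching random walk: at time $0$ there is one particle at the origin ($Z_0=\delta_0$). At each time step every particle dies and produces a random number of offspring according to $\{p_k\}_{k\ge0}$, after which each offspring moves from its parent's position by an independent displacement distributed as $X$; the branching and the motion are independent, and different particles behave independently. $Z_n$ is the point process (counting measure) of positions of the particles at generation $n$; $Z_n(A)$ is the number of generation-$n$ particles located in $A\subset\mathbb{R}$; $|Z_n|:=Z_n(\mathbb{R})$; $m:=\mathbb{E}[|Z_1|]=\sum_k kp_k$. Notation: $I(x):=\sup_{t\ge0}\{tx-\log\mathbb{E}[e^{tX}]\}\in[0,\infty]$; $L:=\sup\{x\in\mathbb{R}:\mathbb{P}(X>x)>0\}\in(-\infty,\infty]$ is the essential supremum of $X$; $r^+:=\max\{r,0\}$. *)

theory Defs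
  imports "HOL-Probability.Probability"
begin

section \<open>Branching random walk\<close>

text \<open>
  Particles carry Ulam--Harris labels: the ancestor is \<open>[]\<close>, and \<open>u @ [i]\<close> (with \<open>i\<close> counted
  from 0) is the \<open>i\<close>-th child of \<open>u\<close>. \<open>N u\<close> is the number of children of \<open>u\<close>, and \<open>D (u, i)\<close> is
  the displacement of the \<open>i\<close>-th child of \<open>u\<close> from the position of \<open>u\<close>. Both families are indexed by
  all labels, but only the labels in \<open>generation N n \<omega>\<close> belong to particles that are actually born.
  All \<open>N u\<close> and \<open>D e\<close> together form one independent family. Since a family of random variables has
  a common value type, the \<open>N u\<close> enter it as real random variables; this loses nothing, because
  \<open>N u\<close> and \<open>real (N u)\<close> generate the same \<open>\<sigma>\<close>-algebra.
\<close>

locale branching_random_walk = prob_space M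
  for M :: "'a measure"
    and p :: "nat pmf"
    and \<mu> :: "real measure"
    and N :: "nat list \<Rightarrow> 'a \<Rightarrow> nat"
    and D :: "nat list \<times> nat \<Rightarrow> 'a \<Rightarrow> real" +
  assumes indep: "indep_vars (\<lambda>_. borel) (case_sum (\<lambda>u \<omega>. real (N u \<omega>)) D) UNIV"
    and offspring_law: "\<And>u. distr M (count_space UNIV) (N u) = measure_pmf p"
    and displacement_law: "\<And>e. distr M borel (D e) = \<mu>"

primrec generation :: "(nat list \<Rightarrow> 'a \<Rightarrow> nat) \<Rightarrow> nat \<Rightarrow> 'a \<Rightarrow> nat list set" where
  "generation N 0 \<omega> = {[]}"
| "generation N (Suc n) \<omega> = {u @ [i] | u i. u \<in> generation N n \<omega> \<and> i < N u \<omega>}"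

definition position :: "(nat list \<times> nat \<Rightarrow> 'a \<Rightarrow> real) \<Rightarrow> nat list \<Rightarrow> 'a \<Rightarrow> real" where
  "position D u \<omega> = (\<Sum>k<length u. D (take k u, u ! k) \<omega>)"

text \<open>
  \<open>particles N D n A \<omega>\<close> is \<open>Z\<^sub>n(A)\<close>. Every generation is a finite set, so the cardinality is the
  true number of particles.
\<close>

definition particles ::
  "(nat list \<Rightarrow> 'a \<Rightarrow> nat) \<Rightarrow> (nat list \<times> nat \<Rightarrow> 'a \<Rightarrow> real) \<Rightarrow> nat \<Rightarrow> real set \<Rightarrow> 'a \<Rightarrow> nat" where
  "particles N D n A \<omega> = card {u \<in> generation N n \<omega>. position D u \<omega> \<in> A}"

definition mean_offspring ::
  "'a measure \<Rightarrow> (nat list \<Rightarrow> 'a \<Rightarrow> nat) \<Rightarrow> (nat list \<times> nat \<Rightarrow> 'a \<Rightarrow> real) \<Rightarrow> real" where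
  "mean_offspring M N D = (\<integral>\<omega>. real (particles N D 1 UNIV \<omega>) \<partial>M)"

lemma finite_generation: "finite (generation N n \<omega>)"
proof (induction n)
  case (Suc n)
  have "generation N (Suc n) \<omega> = (\<Union>u\<in>generation N n \<omega>. (\<lambda>i. u @ [i]) ` {..<N u \<omega>})"
    by auto
  with Suc show ?case by simp
qed simp

lemma particles_0: "particles N D 0 A \<omega> = (if 0 \<in> A then 1 else 0)"
proof -
  have "{u \<in> generation N 0 \<omega>. position D u \<omega> \<in> A} = (if 0 \<in> A then {[]} else {})"
    by (auto simp: position_def)
  then show ?thesis by (simp add: particles_def)
qed

lemma particles_1: "particles N D 1 UNIV \<omega> = N [] \<omega>"
proof -
  have "{u \<in> generation N 1 \<omega>. position D u \<omega> \<in> UNIV} = (\<lambda>i. [i]) ` {..<N [] \<omega>}"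
    by auto
  then show ?thesis by (simp add: particles_def card_image inj_on_def)
qed

section \<open>Rate functions\<close>

text \<open>
  The logarithm with \<open>log 0 = -\<infinity>\<close> and \<open>log \<infinity> = \<infinity>\<close>; the real function \<^const>\<open>ln\<close> maps 0 to 0.
\<close>

definition elog :: "ennreal \<Rightarrow> ereal" where
  "elog z = (if z = 0 then -\<infinity> else if z = \<infinity> then \<infinity> else ereal (ln (enn2real z)))"

text \<open>
  The step size \<open>X\<close> enters only through its law \<open>\<mu>\<close>. Where the exponential moment is infinite, the
  corresponding term of the supremum is \<open>-\<infinity>\<close>.
\<close>

definition step_rate :: "real measure \<Rightarrow> real \<Rightarrow> ereal" where
  "step_rate \<mu> x = (SUP t\<in>{0..}. ereal (t * x) - elog (\<integral>\<^sup>+ z. ennreal (exp (t * z)) \<partial>\<mu>))"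

definition step_esssup :: "real measure \<Rightarrow> ereal" where
  "step_esssup \<mu> = Sup {ereal x | x. measure \<mu> {x<..} > 0}"

definition level_rate :: "real measure \<Rightarrow> real \<Rightarrow> real \<Rightarrow> real \<Rightarrow> ereal" where
  "level_rate \<mu> m a x =
     Inf {ereal s * step_rate \<mu> (y / s) - ereal (s * ln m) | s y.
            s \<in> {0<..1 - a / ln m} \<and> y \<in> {0<..x} \<and>
            ereal (ln m) - step_rate \<mu> ((x - y) / (1 - s)) = ereal (a / (1 - s))}"

end

theory Submission
  imports Defs "HOL-Real_Asymp.Real_Asymp"
begin

text \<open>
  The expected number of generation-\<open>k\<close> particles above \<open>y n\<close> is about \<open>exp (- n * cost)\<close>, where
  \<open>cost s y = s I(y / s) - s log m\<close> and \<open>s = k / n\<close>; a particle at \<open>y n\<close> at time \<open>s n\<close> has about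
  \<open>exp (n * growth)\<close> descendants above \<open>x n\<close> at time \<open>n\<close>, where
  \<open>growth s y = (1 - s) (log m - I((x - y) / (1 - s)))\<close>. The level rate is the least cost of a point
  with growth \<open>a\<close>. As \<open>cost\<close> is convex and \<open>growth\<close> is concave, the least cost depends continuously
  on the growth that is asked for, so that small losses in the growth do no harm.

  Lower bound: one particle travels to \<open>y n\<close> by time \<open>s n\<close>, and then its offspring grows normally. Both
  phases are instances of one statement on functions \<open>u\<close> with
  \<open>u (k + 1) z \<le> f (E (u k (z + X)))\<close>, where \<open>f\<close> is the generating function of the offspring law:
  \<open>1 - u\<close> obeys the linear first moment recursion as long as it is small, hence it grows at the first
  moment rate until it is of order one.

  Upper bound: stop the particles that reach a place of growth at least \<open>a - \<delta>\<close>. A first moment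
  (Chernoff) bound shows that with the required probability there are none. Without them, the expected
  number of descendants of every particle is exponentially smaller than \<open>exp (a n)\<close>, and the
  exponential moment of the number of particles above \<open>x n\<close> stays bounded by induction on the generation;
  this makes it doubly exponentially unlikely that the number reaches \<open>exp (a n)\<close>.
\<close>

section \<open>The law of the labelled tree\<close>

text \<open>All estimates are backward recursions in the starting point \<open>z\<close>: the tree
  is cut only at its root, by \<open>branching\<close>, and no conditioning on a later generation is
  needed. The price is that a bound must hold for all \<open>z\<close> and reproduce itself under
  one step. For this reason the Chernoff bounds are carried as one inequality for each
  \<open>t\<close> \<ge> 0, which a step merely multiplies by \<open>mgf \<mu> t\<close>; the rate
  function enters only by optimising over \<open>t\<close>. In the lower bound the two phases meet
  through the choice of \<open>u\<close>: the later phase uses the Laplace transform of the count at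
  a scale just below exp (- a n), and the resulting probability, a constant, is the initial value of
  the earlier phase. The upper bound uses an exponential moment at a scale just above exp (- a n).
  Unbounded support makes the rate function finite and hence continuous on the whole line, so that
  slightly larger speeds and intermediate values are available everywhere. Exponential moments of
  the step may still be infinite for large \<open>t\<close>: hence the \<open>ennreal\<close> values
  and the truncation in Cramer's bound.\<close>

type_synonym config = "nat list + nat list \<times> nat \<Rightarrow> real"

text \<open>All coordinates share the value type \<open>real\<close>: offspring numbers are embedded
  by \<open>real\<close>, as in the independent family of
  \<open>branching_random_walk\<close>.\<close>

definition coord_law :: "nat pmf \<Rightarrow> real measure \<Rightarrow> nat list + nat list \<times> nat \<Rightarrow> real measure" where
  "coord_law p \<mu> = case_sum (\<lambda>_. distr (measure_pmf p) borel real) (\<lambda>_. \<mu>)"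

definition tree_law :: "nat pmf \<Rightarrow> real measure \<Rightarrow> config measure" where
  "tree_law p \<mu> = PiM UNIV (coord_law p \<mu>)"

text \<open>Prefixing by \<open>i\<close> never yields the root label or an edge leaving the root.
  Hence the offspring number of the root, the first steps and the subtrees read pairwise disjoint
  coordinates.\<close>

definition shift_label :: "nat \<Rightarrow> nat list + nat list \<times> nat \<Rightarrow> nat list + nat list \<times> nat" where
  "shift_label i = case_sum (\<lambda>u. Inl (i # u)) (\<lambda>(u, j). Inr (i # u, j))"

definition subtree :: "nat \<Rightarrow> config \<Rightarrow> config" where
  "subtree i S = (\<lambda>v. S (shift_label i v))"

text \<open>The floor gives a measurable natural number on every real configuration; on
  \<open>tree_of N D \<omega>\<close> it returns \<open>N [] \<omega>\<close>.\<close>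

definition kids :: "config \<Rightarrow> nat" where
  "kids S = nat \<lfloor>S (Inl [])\<rfloor>"

definition first_step :: "config \<Rightarrow> nat \<Rightarrow> real" where
  "first_step S i = S (Inr ([], i))"

text \<open>Valued in \<open>ennreal\<close> because the upper bound evaluates it above 1, where it
  may be infinite; \<open>pgf\<close> is the real version on [0, 1].\<close>

definition gen_fun :: "nat pmf \<Rightarrow> ennreal \<Rightarrow> ennreal" where
  "gen_fun p s = (\<integral>\<^sup>+ k. s ^ k \<partial>measure_pmf p)"

lemma inj_shift_label: "inj (shift_label i)"
  by (auto simp: inj_def shift_label_def split: sum.splits)

locale step_law = prob_space \<mu> for \<mu> :: "real measure" +
  assumes sets_step_law [measurable_cong, simp]: "sets \<mu> = sets borel"
begin

lemma space_step_law [simp]: "space \<mu> = UNIV"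
  using sets_step_law sets_eq_imp_space_eq by fastforce

end

locale offspring_and_step_law = step_law \<mu> for \<mu> +
  fixes p :: "nat pmf"
begin

lemma prob_space_coord_law: "prob_space (coord_law p \<mu> v)"
  by (cases v) (auto simp: coord_law_def prob_space_axioms intro!: measure_pmf.prob_space_distr)

lemma sets_coord_law [simp, measurable_cong]: "sets (coord_law p \<mu> v) = sets borel"
  by (cases v) (auto simp: coord_law_def)

lemma space_coord_law [simp]: "space (coord_law p \<mu> v) = UNIV"
  using sets_coord_law sets_eq_imp_space_eq by fastforce

lemma sets_tree_law [simp, measurable_cong]: "sets (tree_law p \<mu>) = sets (PiM UNIV (\<lambda>_. borel))"
  unfolding tree_law_def by (intro sets_PiM_cong) auto

lemma space_tree_law [simp]: "space (tree_law p \<mu>) = UNIV"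
  by (auto simp: tree_law_def space_PiM)

lemma prob_space_tree_law: "prob_space (tree_law p \<mu>)"
  unfolding tree_law_def by (intro prob_space_PiM prob_space_coord_law)

sublocale tree: prob_space "tree_law p \<mu>" by (rule prob_space_tree_law)

lemma coordinate_measurable: "(\<lambda>S. S v) \<in> borel_measurable (tree_law p \<mu>)"
  by measurable

lemma kids_measurable [measurable]: "kids \<in> measurable (tree_law p \<mu>) (count_space UNIV)"
  unfolding kids_def[abs_def] using coordinate_measurable[measurable] by measurable

lemma first_step_measurable [measurable]: "(\<lambda>S. first_step S i) \<in> borel_measurable (tree_law p \<mu>)"
  unfolding first_step_def by (rule coordinate_measurable)

lemma subtree_measurable [measurable]: "subtree i \<in> measurable (tree_law p \<mu>) (tree_law p \<mu>)"
proof -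
  have "(\<lambda>S. \<lambda>v\<in>UNIV. S (shift_label i v)) \<in> measurable (tree_law p \<mu>) (PiM UNIV (\<lambda>_. borel))"
    by (intro measurable_restrict) measurable
  then show ?thesis
    by (simp add: subtree_def[abs_def] restrict_UNIV cong: measurable_cong_sets)
qed

lemma distr_coordinate: "distr (tree_law p \<mu>) borel (\<lambda>S. S v) = coord_law p \<mu> v"
proof -
  have "distr (tree_law p \<mu>) borel (\<lambda>S. S v) = distr (tree_law p \<mu>) (coord_law p \<mu> v) (\<lambda>S. S v)"
    by (intro distr_cong) auto
  also have "\<dots> = coord_law p \<mu> v"
    unfolding tree_law_def by (intro distr_PiM_component prob_space_coord_law) auto
  finally show ?thesis .
qed

text \<open>Reindexing a product measure along an injection gives a product measure, and
  \<open>shift_label\<close> sends offspring coordinates to offspring coordinates and steps to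
  steps.\<close>

lemma distr_subtree: "distr (tree_law p \<mu>) (tree_law p \<mu>) (subtree i) = tree_law p \<mu>"
proof -
  have eq: "coord_law p \<mu> (shift_label i v) = coord_law p \<mu> v" for v
    by (auto simp: coord_law_def shift_label_def split: sum.splits)
  have "distr (PiM UNIV (coord_law p \<mu>)) (\<Pi>\<^sub>M v\<in>UNIV. coord_law p \<mu> (shift_label i v))
          (\<lambda>S. \<lambda>v\<in>UNIV. S (shift_label i v)) = (\<Pi>\<^sub>M v\<in>UNIV. coord_law p \<mu> (shift_label i v))"
    by (intro distr_PiM_reindex prob_space_coord_law inj_shift_label) auto
  then show ?thesis
    by (simp add: eq tree_law_def subtree_def[abs_def] restrict_UNIV)
qed

lemma indep_coordinates: "tree.indep_vars (\<lambda>_. borel) (\<lambda>v S. S v) UNIV"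
proof -
  have "distr (tree_law p \<mu>) (\<Pi>\<^sub>M v\<in>UNIV. borel) (\<lambda>S. \<lambda>v\<in>UNIV. S v) = distr (tree_law p \<mu>) (tree_law p \<mu>) (\<lambda>S. S)"
    by (intro distr_cong) (auto simp: restrict_UNIV)
  also have "\<dots> = tree_law p \<mu>"
    by (simp add: distr_id2)
  also have "\<dots> = (\<Pi>\<^sub>M v\<in>UNIV. distr (tree_law p \<mu>) borel (\<lambda>S. S v))"
    unfolding distr_coordinate by (simp add: tree_law_def)
  finally show ?thesis
    by (subst tree.indep_vars_iff_distr_eq_PiM) auto
qed

lemma nn_integral_step_subtree:
  assumes G: "(\<lambda>(y, S). G y S) \<in> borel_measurable (borel \<Otimes>\<^sub>M tree_law p \<mu>)"
  shows "(\<integral>\<^sup>+S. G (first_step S i) (subtree i S) \<partial>tree_law p \<mu>) = (\<integral>\<^sup>+y. \<integral>\<^sup>+S. G y S \<partial>tree_law p \<mu> \<partial>\<mu>)"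
proof -
  let ?T = "tree_law p \<mu>" and ?b = "\<lambda>_. borel :: real measure"
  let ?A = "{Inr ([], i)} :: (nat list + nat list \<times> nat) set" and ?B = "range (shift_label i)"
  \<comment> \<open>The first step is encoded as a constant configuration, because the two members
    of an independent pair must have the same value type.\<close>
  let ?step = "\<lambda>S v :: nat list + nat list \<times> nat. first_step S i"
  have [measurable]: "?step \<in> measurable ?T ?T"
  proof -
    have "(\<lambda>S. \<lambda>v\<in>UNIV. first_step S i) \<in> measurable ?T (PiM UNIV ?b)"
      by (intro measurable_restrict) measurable
    then show ?thesis
      by (simp add: restrict_UNIV cong: measurable_cong_sets)
  qed
  have [measurable]: "(\<lambda>z. G (fst z (Inl [])) (snd z)) \<in> borel_measurable (?T \<Otimes>\<^sub>M ?T)"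
  proof -
    have "(\<lambda>z. case_prod G (fst z (Inl []), snd z)) \<in> borel_measurable (?T \<Otimes>\<^sub>M ?T)"
      by (rule measurable_compose[OF _ G]) measurable
    then show ?thesis by simp
  qed
  have [measurable]: "(\<lambda>y. \<integral>\<^sup>+S. G y S \<partial>?T) \<in> borel_measurable borel"
    using tree.borel_measurable_nn_integral_fst[OF G] by simp
  have "tree.indep_var (PiM ?A ?b) (\<lambda>S. restrict (\<lambda>v. S v) ?A) (PiM ?B ?b) (\<lambda>S. restrict (\<lambda>v. S v) ?B)"
    by (rule tree.indep_var_restrict[OF indep_coordinates])
       (auto simp: shift_label_def split: sum.splits)
  then have "tree.indep_var ?T ((\<lambda>w v. w (Inr ([], i))) \<circ> (\<lambda>S. restrict (\<lambda>v. S v) ?A))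
      ?T ((\<lambda>w v. w (shift_label i v)) \<circ> (\<lambda>S. restrict (\<lambda>v. S v) ?B))"
  proof (rule tree.indep_var_compose)
    have "(\<lambda>w. \<lambda>v\<in>UNIV. w (shift_label i v)) \<in> measurable (Pi\<^sub>M ?B ?b) (PiM UNIV ?b)"
      by (intro measurable_restrict) measurable
    then show "(\<lambda>w v. w (shift_label i v)) \<in> measurable (Pi\<^sub>M ?B ?b) ?T"
      by (simp add: restrict_UNIV cong: measurable_cong_sets)
    have "(\<lambda>w. \<lambda>v\<in>UNIV. w (Inr ([], i))) \<in> measurable (Pi\<^sub>M ?A ?b) (PiM UNIV ?b)"
      by (intro measurable_restrict) measurable
    then show "(\<lambda>w v. w (Inr ([], i))) \<in> measurable (Pi\<^sub>M ?A ?b) ?T"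
      by (simp add: restrict_UNIV cong: measurable_cong_sets)
  qed
  also have "((\<lambda>w v. w (Inr ([], i))) \<circ> (\<lambda>S. restrict (\<lambda>v. S v) ?A)) = ?step"
    by (auto simp: first_step_def fun_eq_iff)
  also have "((\<lambda>w v. w (shift_label i v)) \<circ> (\<lambda>S. restrict (\<lambda>v. S v) ?B)) = subtree i"
    by (auto simp: subtree_def fun_eq_iff)
  finally have law: "distr ?T ?T ?step \<Otimes>\<^sub>M ?T = distr ?T (?T \<Otimes>\<^sub>M ?T) (\<lambda>S. (?step S, subtree i S))"
    unfolding tree.indep_var_distribution_eq distr_subtree by simp
  have "(\<integral>\<^sup>+S. G (first_step S i) (subtree i S) \<partial>?T) =
     (\<integral>\<^sup>+z. G (fst z (Inl [])) (snd z) \<partial>distr ?T (?T \<Otimes>\<^sub>M ?T) (\<lambda>S. (?step S, subtree i S)))"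
    by (subst nn_integral_distr) auto
  also have "\<dots> = (\<integral>\<^sup>+w. \<integral>\<^sup>+S. G (w (Inl [])) S \<partial>?T \<partial>distr ?T ?T ?step)"
    unfolding law[symmetric]
    by (subst tree.nn_integral_fst[symmetric]) (auto cong: measurable_cong_sets)
  also have "\<dots> = (\<integral>\<^sup>+S. (\<integral>\<^sup>+S'. G (first_step S i) S' \<partial>?T) \<partial>?T)"
    by (subst nn_integral_distr) auto
  also have "\<dots> = (\<integral>\<^sup>+y. \<integral>\<^sup>+S. G y S \<partial>?T \<partial>distr ?T borel (\<lambda>S. first_step S i))"
    by (subst nn_integral_distr) auto
  also have "distr ?T borel (\<lambda>S. first_step S i) = \<mu>"
    using distr_coordinate[of "Inr ([], i)"] by (simp add: first_step_def coord_law_def)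
  finally show ?thesis .
qed

lemma distr_kids: "distr (tree_law p \<mu>) (count_space UNIV) kids = measure_pmf p"
proof -
  have "distr (tree_law p \<mu>) (count_space UNIV) kids =
     distr (distr (tree_law p \<mu>) borel (\<lambda>S. S (Inl []))) (count_space UNIV) (\<lambda>r. nat \<lfloor>r\<rfloor>)"
    by (subst distr_distr) (auto simp: kids_def[abs_def] comp_def)
  also have "\<dots> = distr (measure_pmf p) (count_space UNIV) id"
    unfolding distr_coordinate by (auto simp: coord_law_def distr_distr comp_def id_def)
  also have "\<dots> = measure_pmf p"
    by (simp add: id_def distr_id2)
  finally show ?thesis .
qed

text \<open>Given \<open>k\<close> children, the pairs of first step and subtree are independent
  with a common law, so the product has the \<open>k\<close>-th power as its mean; averaging over
  \<open>k\<close> gives the generating function.\<close>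

lemma branching:
  assumes [measurable]: "(\<lambda>(y, S). G y S) \<in> borel_measurable (borel \<Otimes>\<^sub>M tree_law p \<mu>)"
  shows "(\<integral>\<^sup>+S. (\<Prod>i<kids S. G (first_step S i) (subtree i S)) \<partial>tree_law p \<mu>) =
         gen_fun p (\<integral>\<^sup>+y. \<integral>\<^sup>+S. G y S \<partial>tree_law p \<mu> \<partial>\<mu>)"
proof -
  let ?T = "tree_law p \<mu>" and ?E = "\<integral>\<^sup>+y. \<integral>\<^sup>+S. G y S \<partial>tree_law p \<mu> \<partial>\<mu>"
  have V [measurable]: "(\<lambda>S. G (first_step S i) (subtree i S)) \<in> borel_measurable ?T" for i
  proof -
    have "(\<lambda>S. case_prod G (first_step S i, subtree i S)) \<in> borel_measurable ?T"
      by (rule measurable_compose[OF _ assms]) measurable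
    then show ?thesis by simp
  qed
  have fixed: "(\<integral>\<^sup>+S. indicator {k} (kids S) * (\<Prod>i<k. G (first_step S i) (subtree i S)) \<partial>?T) = pmf p k * ?E ^ k" for k
  proof -
    \<comment> \<open>\<open>None\<close> stands for the offspring number of the root,
      \<open>Some i\<close> for the edge to child \<open>i\<close> together with the subtree of that
      child.\<close>
    define K :: "nat option \<Rightarrow> (nat list + nat list \<times> nat) set" where
      "K = case_option {Inl []} (\<lambda>i. insert (Inr ([], i)) (range (shift_label i)))"
    define W :: "nat option \<Rightarrow> config \<Rightarrow> ennreal" where
      "W = case_option (\<lambda>S. indicator {k} (kids S)) (\<lambda>i S. G (first_step S i) (subtree i S))"
    define J where "J = insert None (Some ` {..<k})"
    have indep: "tree.indep_vars (\<lambda>j. PiM (K j) (\<lambda>_. borel)) (\<lambda>j S. restrict (\<lambda>v. S v) (K j)) J"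
      by (rule tree.indep_vars_restrict[OF indep_coordinates])
         (auto simp: disjoint_family_on_def K_def shift_label_def split: sum.splits option.splits)
    define Y :: "nat option \<Rightarrow> config \<Rightarrow> ennreal" where
      "Y = case_option (\<lambda>w. indicator {k} (nat \<lfloor>w (Inl [])\<rfloor>)) (\<lambda>i w. G (w (Inr ([], i))) (\<lambda>v. w (shift_label i v)))"
    have "tree.indep_vars (\<lambda>_. borel) (\<lambda>j S. Y j (restrict (\<lambda>v. S v) (K j))) J"
    proof (rule tree.indep_vars_compose2[OF indep])
      fix j assume "j \<in> J"
      show "Y j \<in> borel_measurable (PiM (K j) (\<lambda>_. borel))"
      proof (cases j)
        case None
        have "(\<lambda>w :: config. w (Inl [])) \<in> borel_measurable (PiM (K None) (\<lambda>_. borel))"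
          by (intro measurable_component_singleton) (auto simp: K_def)
        then show ?thesis unfolding None Y_def by simp
      next
        case (Some i)
        have [measurable]: "(\<lambda>w :: config. w (Inr ([], i))) \<in> borel_measurable (PiM (K j) (\<lambda>_. borel))"
          by (intro measurable_component_singleton) (auto simp: K_def Some)
        have "(\<lambda>w. \<lambda>v\<in>UNIV. w (shift_label i v)) \<in> measurable (Pi\<^sub>M (K j) (\<lambda>_. borel)) (PiM UNIV (\<lambda>_. borel))"
          by (intro measurable_restrict measurable_component_singleton) (auto simp: K_def Some)
        then have [measurable]: "(\<lambda>w v. w (shift_label i v)) \<in> measurable (Pi\<^sub>M (K j) (\<lambda>_. borel)) ?T"
          by (simp add: restrict_UNIV cong: measurable_cong_sets)
        have "(\<lambda>w. case_prod G (w (Inr ([], i)), (\<lambda>v. w (shift_label i v)))) \<in> borel_measurable (PiM (K j) (\<lambda>_. borel))"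
          by (rule measurable_compose[OF _ assms]) measurable
        then show ?thesis by (simp add: Y_def Some)
      qed
    qed
    also have "(\<lambda>j S. Y j (restrict (\<lambda>v. S v) (K j))) = W"
      by (auto simp: fun_eq_iff Y_def W_def K_def kids_def first_step_def subtree_def[abs_def] split: option.splits)
    finally have "(\<integral>\<^sup>+S. (\<Prod>j\<in>J. W j S) \<partial>?T) = (\<Prod>j\<in>J. \<integral>\<^sup>+S. W j S \<partial>?T)"
      by (intro tree.indep_vars_nn_integral) (auto simp: J_def)
    moreover have "(\<Prod>j\<in>J. h j) = h None * (\<Prod>i<k. h (Some i))" for h :: "nat option \<Rightarrow> ennreal"
      by (auto simp: J_def prod.reindex)
    moreover have "(\<integral>\<^sup>+S. W None S \<partial>?T) = pmf p k"
    proof -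
      have "(\<integral>\<^sup>+S. W None S \<partial>?T) = (\<integral>\<^sup>+j. indicator {k} j \<partial>distr ?T (count_space UNIV) kids)"
        by (subst nn_integral_distr) (auto simp: W_def)
      then show ?thesis by (simp add: distr_kids emeasure_pmf_single)
    qed
    moreover have "(\<integral>\<^sup>+S. W (Some i) S \<partial>?T) = ?E" for i
      unfolding W_def by (simp add: nn_integral_step_subtree)
    ultimately show ?thesis by (simp add: W_def)
  qed
  \<comment> \<open>Only the summand \<open>k = kids S\<close> is nonzero, which turns a product of
    random length into a series of products of fixed length.\<close>
  have "(\<integral>\<^sup>+S. (\<Prod>i<kids S. G (first_step S i) (subtree i S)) \<partial>?T) =
      (\<integral>\<^sup>+S. (\<Sum>k. indicator {k} (kids S) * (\<Prod>i<k. G (first_step S i) (subtree i S))) \<partial>?T)"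
  proof (intro nn_integral_cong)
    fix S
    have "(\<Sum>k. indicator {k} (kids S) * (\<Prod>i<k. G (first_step S i) (subtree i S))) =
      (\<Sum>k\<in>{kids S}. indicator {k} (kids S) * (\<Prod>i<k. G (first_step S i) (subtree i S)))"
      by (rule suminf_finite) (auto simp: indicator_def)
    then show "(\<Prod>i<kids S. G (first_step S i) (subtree i S)) = (\<Sum>k. indicator {k} (kids S) * (\<Prod>i<k. G (first_step S i) (subtree i S)))"
      by simp
  qed
  also have "\<dots> = (\<Sum>k. \<integral>\<^sup>+S. indicator {k} (kids S) * (\<Prod>i<k. G (first_step S i) (subtree i S)) \<partial>?T)"
  proof (rule nn_integral_suminf)
    have "(\<lambda>S. indicator {k} (kids S) :: ennreal) \<in> borel_measurable ?T" for k
      by (rule measurable_compose[OF kids_measurable]) simp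
    then show "(\<lambda>S. indicator {k} (kids S) * (\<Prod>i<k. G (first_step S i) (subtree i S))) \<in> borel_measurable ?T" for k
      by (intro borel_measurable_times_ennreal borel_measurable_prod_ennreal V)
  qed
  also have "\<dots> = (\<Sum>k. pmf p k * ?E ^ k)"
    by (simp add: fixed)
  also have "\<dots> = gen_fun p ?E"
    unfolding gen_fun_def nn_integral_measure_pmf by (simp add: nn_integral_count_space_nat)
  finally show ?thesis .
qed

end

section \<open>The rate function\<close>

text \<open>For \<open>z\<close> = \<infinity> both sides hold, so the exponential form covers
  infinite moments as well.\<close>

lemma ereal_minus_elog_le_iff:
  assumes "z > 0"
  shows "ereal s - elog z \<le> ereal b \<longleftrightarrow> ennreal (exp (s - b)) \<le> z"
proof (cases z)
  case (real r)
  with assms have "r > 0" by simp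
  then have "s - ln r \<le> b \<longleftrightarrow> exp (s - b) \<le> r"
    by (metis diff_le_eq exp_le_cancel_iff exp_ln add.commute)
  with real \<open>r > 0\<close> show ?thesis
    by (simp add: elog_def)
qed (simp add: elog_def)

definition mgf :: "real measure \<Rightarrow> real \<Rightarrow> ennreal" where
  "mgf \<mu> t = (\<integral>\<^sup>+ z. ennreal (exp (t * z)) \<partial>\<mu>)"

definition rate :: "real measure \<Rightarrow> real \<Rightarrow> real" where
  "rate \<mu> c = real_of_ereal (step_rate \<mu> c)"

context step_law
begin

lemma borel_measurable_step [measurable_dest]: "f \<in> borel_measurable borel \<Longrightarrow> f \<in> borel_measurable \<mu>"
  by (simp cong: measurable_cong_sets)

lemma mgf_0 [simp]: "mgf \<mu> 0 = 1"
  by (simp add: mgf_def emeasure_space_1[simplified])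

lemma mgf_pos: "mgf \<mu> t > 0"
proof -
  have "(\<integral>\<^sup>+ z. ennreal (exp (t * z)) \<partial>\<mu>) \<noteq> 0"
  proof
    assume "(\<integral>\<^sup>+ z. ennreal (exp (t * z)) \<partial>\<mu>) = 0"
    then have "AE z in \<mu>. ennreal (exp (t * z)) = 0"
      by (subst (asm) nn_integral_0_iff_AE) auto
    then have "AE z in \<mu>. False" by simp
    then show False by simp
  qed
  then show ?thesis by (simp add: mgf_def zero_less_iff_neq_zero)
qed

text \<open>The working form of the rate function: from here on it is handled through moment
  inequalities instead of suprema and extended logarithms.\<close>

lemma step_rate_le_iff:
  "step_rate \<mu> c \<le> ereal b \<longleftrightarrow> (\<forall>t\<ge>0. ennreal (exp (t * c - b)) \<le> mgf \<mu> t)"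
  unfolding step_rate_def mgf_def[symmetric] SUP_le_iff
  by (auto simp: ereal_minus_elog_le_iff mgf_pos)

end

text \<open>\<open>unbounded_above\<close> expresses L = \<infinity>; it is what makes the rate
  function finite at every point.\<close>

locale unbounded_step_law = step_law +
  assumes integrable_step: "integrable \<mu> (\<lambda>z. z)"
    and centered: "(\<integral>z. z \<partial>\<mu>) = 0"
    and unbounded_above: "\<And>y. measure \<mu> {y<..} > 0"
begin

text \<open>Jensen's inequality by way of exp (t z) \<ge> 1 + t z, which also works when the
  exponential is not integrable.\<close>

lemma mgf_ge_1: "1 \<le> mgf \<mu> t"
proof -
  have i: "integrable \<mu> (\<lambda>z. 1 + t * z)" using integrable_step by simp
  have "(\<integral>z. 1 + t * z \<partial>\<mu>) = 1"
    using integrable_step centered by (simp add: prob_space[simplified])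
  then have "1 = ennreal (\<integral>z. 1 + t * z \<partial>\<mu>)" by simp
  also have "\<dots> \<le> (\<integral>\<^sup>+ z. ennreal (1 + t * z) \<partial>\<mu>)"
  proof -
    have "ennreal (\<integral>z. 1 + t * z \<partial>\<mu>) \<le> ennreal (\<integral>z. max 0 (1 + t * z) \<partial>\<mu>)"
      using i by (intro ennreal_leI integral_mono) auto
    also have "\<dots> = (\<integral>\<^sup>+ z. ennreal (max 0 (1 + t * z)) \<partial>\<mu>)"
      using i by (intro nn_integral_eq_integral[symmetric]) auto
    also have "\<dots> = (\<integral>\<^sup>+ z. ennreal (1 + t * z) \<partial>\<mu>)"
      by (intro nn_integral_cong) (auto simp: max_def ennreal_neg)
    finally show ?thesis .
  qed
  also have "\<dots> \<le> mgf \<mu> t"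
    unfolding mgf_def by (intro nn_integral_mono ennreal_leI exp_ge_add_one_self)
  finally show ?thesis .
qed

lemma step_rate_nonneg: "0 \<le> step_rate \<mu> c"
proof -
  have "ereal (0 * c) - elog (mgf \<mu> 0) \<le> step_rate \<mu> c"
    unfolding step_rate_def mgf_def by (rule SUP_upper) simp
  then show ?thesis by (simp add: elog_def one_ereal_def zero_ereal_def)
qed

text \<open>The event X > c alone gives E exp (t X) \<ge> exp (t c) P(X > c), hence I(c) \<le> - log
  P(X > c).\<close>

lemma step_rate_finite: "step_rate \<mu> c < \<infinity>"
proof -
  let ?q = "measure \<mu> {c<..}"
  have q: "?q > 0" by (rule unbounded_above)
  have "step_rate \<mu> c \<le> ereal (- ln ?q)"
    unfolding step_rate_le_iff
  proof safe
    fix t :: real assume "t \<ge> 0"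
    have "ennreal (exp (t * c - - ln ?q)) = ennreal (exp (t * c)) * emeasure \<mu> {c<..}"
      using q by (simp add: exp_add ennreal_mult emeasure_eq_measure)
    also have "\<dots> = (\<integral>\<^sup>+ z. ennreal (exp (t * c)) * indicator {c<..} z \<partial>\<mu>)"
      by (subst nn_integral_cmult_indicator) auto
    also have "\<dots> \<le> mgf \<mu> t"
      unfolding mgf_def using \<open>t \<ge> 0\<close>
      by (intro nn_integral_mono) (auto simp: indicator_def mult_left_mono intro!: ennreal_leI)
    finally show "ennreal (exp (t * c - - ln ?q)) \<le> mgf \<mu> t" .
  qed
  then show ?thesis
    using less_ereal.simps(4) order.strict_trans1 by blast
qed

lemma step_rate_eq: "step_rate \<mu> c = ereal (rate \<mu> c)"
  using step_rate_nonneg[of c] step_rate_finite[of c]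
  unfolding rate_def by (cases "step_rate \<mu> c") auto

lemma rate_nonneg: "0 \<le> rate \<mu> c"
  using step_rate_nonneg[of c] by (simp add: step_rate_eq)

lemma rate_le_iff: "rate \<mu> c \<le> b \<longleftrightarrow> (\<forall>t\<ge>0. ennreal (exp (t * c - b)) \<le> mgf \<mu> t)"
  using step_rate_le_iff[of c b] by (simp add: step_rate_eq)

lemma mgf_ge: "t \<ge> 0 \<Longrightarrow> ennreal (exp (t * c - rate \<mu> c)) \<le> mgf \<mu> t"
  using rate_le_iff[of c "rate \<mu> c"] by simp

lemma rate_nonpos_eq_0: "c \<le> 0 \<Longrightarrow> rate \<mu> c = 0"
proof (rule antisym[OF _ rate_nonneg])
  assume c: "c \<le> 0"
  have "ennreal (exp (t * c - 0)) \<le> mgf \<mu> t" if "t \<ge> 0" for t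
  proof -
    have "ennreal (exp (t * c - 0)) \<le> 1"
      using c that by (simp add: mult_nonneg_nonpos)
    with mgf_ge_1[of t] show ?thesis by (rule order.trans[rotated])
  qed
  then show "rate \<mu> c \<le> 0"
    unfolding rate_le_iff by auto
qed

lemma rate_mono: "c \<le> d \<Longrightarrow> rate \<mu> c \<le> rate \<mu> d"
  unfolding rate_le_iff
proof safe
  fix t :: real assume "c \<le> d" "t \<ge> 0"
  then have "ennreal (exp (t * c - rate \<mu> d)) \<le> ennreal (exp (t * d - rate \<mu> d))"
    by (intro ennreal_leI) (simp add: mult_left_mono)
  with mgf_ge[OF \<open>t \<ge> 0\<close>, of d] show "ennreal (exp (t * c - rate \<mu> d)) \<le> mgf \<mu> t"
    by (rule order.trans[rotated])
qed

lemma convex_on_rate: "convex_on UNIV (rate \<mu>)"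
proof (rule convex_onI)
  fix u c d :: real assume u: "0 < u" "u < 1"
  let ?b = "(1 - u) * rate \<mu> c + u * rate \<mu> d"
  have "ennreal (exp (t * ((1 - u) * c + u * d) - ?b)) \<le> mgf \<mu> t" if "t \<ge> 0" for t
  proof -
    have "t * ((1 - u) * c + u * d) - ?b = (1 - u) * (t * c - rate \<mu> c) + u * (t * d - rate \<mu> d)"
      by (simp add: algebra_simps)
    also have "\<dots> \<le> max (t * c - rate \<mu> c) (t * d - rate \<mu> d)"
      using u by (intro convex_bound_le) auto
    finally have "ennreal (exp (t * ((1 - u) * c + u * d) - ?b)) \<le>
        max (ennreal (exp (t * c - rate \<mu> c))) (ennreal (exp (t * d - rate \<mu> d)))"
      by (auto simp: max_def intro!: ennreal_leI split: if_splits)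
    also have "\<dots> \<le> mgf \<mu> t" using that by (simp add: mgf_ge)
    finally show ?thesis .
  qed
  then show "rate \<mu> ((1 - u) *\<^sub>R c + u *\<^sub>R d) \<le> (1 - u) * rate \<mu> c + u * rate \<mu> d"
    unfolding rate_le_iff by simp
qed simp

lemma continuous_on_rate: "continuous_on S (rate \<mu>)"
  using convex_on_continuous[OF open_UNIV convex_on_rate] continuous_on_subset by blast

lemma isCont_rate: "isCont (rate \<mu>) c"
  using continuous_on_rate[of UNIV] by (simp add: continuous_on_eq_continuous_at)

text \<open>A slightly larger speed at almost the same rate: the gain in position is linear in time
  and absorbs constants and roundings.\<close>

lemma rate_right:
  assumes "rate \<mu> c < v"
  obtains d where "c < d" "rate \<mu> d < v"
proof -
  have "(rate \<mu> \<longlongrightarrow> rate \<mu> c) (at_right c)"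
    using isCont_rate[of c] by (auto simp: isCont_def intro: tendsto_within_subset)
  then have "\<forall>\<^sub>F d in at_right c. rate \<mu> d < v"
    using assms by (rule order_tendstoD(2))
  moreover have "\<forall>\<^sub>F d in at_right c. d > c" by (simp add: eventually_at_right_less)
  ultimately have "\<forall>\<^sub>F d in at_right c. c < d \<and> rate \<mu> d < v"
    by eventually_elim simp
  then show thesis
    using that eventually_happens'[OF trivial_limit_at_right_real] by blast
qed

text \<open>Optimisation over \<open>t\<close> of a bound known for every \<open>t\<close>. The
  number \<open>v\<close> is arbitrary, so that it can be a hitting probability or the excess of an
  exponential moment over 1.\<close>

lemma chernoff:
  assumes r: "r > 0" and C: "C > 0"
    and v: "\<And>t. t \<ge> 0 \<Longrightarrow> ennreal v \<le> ennreal (C * exp (- t * d)) * mgf \<mu> t ^ r"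
  shows "v \<le> C * exp (- real r * rate \<mu> (d / r))"
proof (cases "v > 0")
  case False
  with C show ?thesis by (meson exp_gt_zero less_le_trans linorder_not_less mult_pos_pos nle_le)
next
  case True
  \<comment> \<open>\<open>b\<close> solves \<open>C * exp (- r * b) = v\<close>, so the claim
    amounts to \<open>rate \<mu> (d / r) \<le> b\<close>.\<close>
  define b where "b = ln (C / v) / r"
  have "ennreal (exp (t * (d / r) - b)) \<le> mgf \<mu> t" if "t \<ge> 0" for t
  proof (cases "mgf \<mu> t")
    case (real M)
    have "real r * (t * (d / r) - b) = t * d - ln (C / v)"
      using r by (simp add: b_def right_diff_distrib)
    then have "(exp (t * (d / r) - b)) ^ r = exp (t * d) * exp (- ln (C / v))"
      by (simp add: exp_of_nat_mult[symmetric] exp_add[symmetric])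
    also have "\<dots> = v / (C * exp (- t * d))"
      using True C by (simp add: exp_minus field_simps)
    also have "\<dots> \<le> M ^ r"
    proof -
      have "ennreal v \<le> ennreal (C * exp (- t * d) * M ^ r)"
        using v[OF that] real C by (simp add: ennreal_power ennreal_mult)
      then have "v \<le> C * exp (- t * d) * M ^ r"
        using real C by (subst (asm) ennreal_le_iff) auto
      then show ?thesis using C by (simp add: field_simps)
    qed
    finally have "exp (t * (d / r) - b) \<le> M"
      using real r by (simp add: power_mono_iff)
    then show ?thesis using real by (simp add: ennreal_leI)
  qed simp
  then have "rate \<mu> (d / r) \<le> b" unfolding rate_le_iff by auto
  then have "real r * rate \<mu> (d / r) \<le> ln (C / v)"
    using r by (simp add: b_def field_simps)
  then have "exp (real r * rate \<mu> (d / r)) \<le> C / v"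
    using C True by (metis divide_pos_pos exp_le_cancel_iff exp_ln)
  then show ?thesis
    using True by (simp add: exp_minus field_simps)
qed

end

section \<open>Cramer's lower bound\<close>

text \<open>The probability that a random walk is at \<open>y\<close> or above after
  \<open>i\<close> steps, given by its first step decomposition because the branching recursion
  advances in the same way.\<close>

primrec walk_tail :: "real measure \<Rightarrow> nat \<Rightarrow> real \<Rightarrow> real" where
  "walk_tail \<mu> 0 y = (if y \<le> 0 then 1 else 0)"
| "walk_tail \<mu> (Suc i) y = (\<integral>z. walk_tail \<mu> i (y - z) \<partial>\<mu>)"

context step_law
begin

lemma walk_tail_bounds_measurable:
  "walk_tail \<mu> i \<in> borel_measurable borel \<and> (\<forall>y. 0 \<le> walk_tail \<mu> i y \<and> walk_tail \<mu> i y \<le> 1)"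
proof (induction i)
  case 0
  show ?case by simp
next
  case (Suc i)
  then have [measurable]: "walk_tail \<mu> i \<in> borel_measurable borel" by blast
  have "(\<lambda>y. \<integral>z. walk_tail \<mu> i (y - z) \<partial>\<mu>) \<in> borel_measurable borel"
    by measurable
  moreover have "integrable \<mu> (\<lambda>z. walk_tail \<mu> i (y - z))" for y
    using Suc by (intro integrable_const_bound[where B = 1]) auto
  ultimately show ?case
    using Suc by (auto intro!: integral_nonneg integral_le_const)
qed

lemma walk_tail_measurable [measurable]: "walk_tail \<mu> i \<in> borel_measurable borel"
  and walk_tail_nonneg: "0 \<le> walk_tail \<mu> i y"
  and walk_tail_le_1: "walk_tail \<mu> i y \<le> 1"
  using walk_tail_bounds_measurable[of i] by blast+

lemma integrable_walk_tail: "integrable \<mu> (\<lambda>z. walk_tail \<mu> i (y - z))"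
  by (intro integrable_const_bound[where B = 1]) (auto simp: walk_tail_nonneg walk_tail_le_1)

lemma walk_tail_antimono: "y \<le> y' \<Longrightarrow> walk_tail \<mu> i y' \<le> walk_tail \<mu> i y"
  by (induction i arbitrary: y y') (auto intro!: integral_mono integrable_walk_tail)

lemma integrable_truncated:
  assumes "continuous_on UNIV f"
  shows "integrable \<mu> (\<lambda>x. indicator {- K..K} x * f x :: real)"
proof -
  have "bounded (f ` {- K..K})"
    using assms by (intro compact_imp_bounded compact_continuous_image) (auto intro: continuous_on_subset)
  then obtain B where B: "\<And>x. x \<in> {- K..K} \<Longrightarrow> \<bar>f x\<bar> \<le> B"
    unfolding bounded_iff real_norm_def by (metis imageI)
  have [measurable]: "f \<in> borel_measurable borel"
    using assms by (rule borel_measurable_continuous_onI)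
  show ?thesis
  proof (rule integrable_const_bound[where B = "\<bar>B\<bar>"])
    have "norm (indicator {- K..K} x * f x) \<le> \<bar>B\<bar>" for x
      using B[of x] by (cases "x \<in> {- K..K}") auto
    then show "AE x in \<mu>. norm (indicator {- K..K} x * f x) \<le> \<bar>B\<bar>" by simp
  qed measurable
qed

text \<open>
  The exponential tilt \<open>exp (t * (x - c))\<close> of the truncated law has mean \<open>c\<close>; Chebyshev's inequality
  for the tilted walk appears as the quadratic factor of an explicit subsolution of the recursion for
  \<^const>\<open>walk_tail\<close>.
\<close>

lemma walk_tail_ge_tilted:
  fixes K t c R :: real
  defines "G \<equiv> (\<integral>x. indicator {- K..K} x * exp (t * (x - c)) \<partial>\<mu>)"
  defines "V \<equiv> (\<integral>x. indicator {- K..K} x * ((x - c)\<^sup>2 * exp (t * (x - c))) \<partial>\<mu>)"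
  assumes mean: "(\<integral>x. indicator {- K..K} x * ((x - c) * exp (t * (x - c))) \<partial>\<mu>) = 0"
    and G: "G > 0" and t: "t \<ge> 0" and R: "R > 0"
  shows "exp (- (2 * t * R)) * G ^ j * exp (t * (real j * c - y)) *
           (1 - ((real j * c - y - R)\<^sup>2 + real j * (V / G)) / R\<^sup>2) \<le> walk_tail \<mu> j y"
proof (induction j arbitrary: y)
  case 0
  show ?case
  \<comment> \<open>The quadratic factor is positive only if \<open>- y\<close> is within
    \<open>R\<close> of \<open>R\<close>; there \<open>exp (- (2 * t * R))\<close> brings the tilt
    below 1. Elsewhere the left side is nonpositive.\<close>
  proof (cases "0 \<le> - y \<and> - y \<le> 2 * R")
    case True
    have "exp (- (2 * t * R)) * exp (- (t * y)) = exp (t * (- y - 2 * R))"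
      by (simp add: exp_add[symmetric] algebra_simps)
    also have "\<dots> \<le> 1"
      using True t by (simp add: mult_nonneg_nonpos)
    finally have "exp (- (2 * t * R)) * exp (- (t * y)) \<le> 1" .
    moreover have "1 - (- y - R)\<^sup>2 / R\<^sup>2 \<le> 1" by simp
    ultimately have "exp (- (2 * t * R)) * exp (- (t * y)) * (1 - (- y - R)\<^sup>2 / R\<^sup>2) \<le> 1 * 1"
      by (smt (verit) exp_gt_zero mult_le_one mult_less_0_iff mult_pos_pos zero_le_mult_iff)
    then show ?thesis using True by simp
  next
    case False
    then have "R \<le> \<bar>- y - R\<bar>" by linarith
    then have "R\<^sup>2 \<le> (- y - R)\<^sup>2" using R by (simp add: abs_le_square_iff[symmetric])
    then have "1 - (- y - R)\<^sup>2 / R\<^sup>2 \<le> 0" using R by simp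
    then have "exp (- (2 * t * R)) * exp (- (t * y)) * (1 - (- y - R)\<^sup>2 / R\<^sup>2) \<le> 0"
      by (intro mult_nonneg_nonpos) auto
    then show ?thesis by simp
  qed
next
  case (Suc j)
  define w where "w = real (Suc j) * c - y"
  define A where "A = exp (- (2 * t * R)) * G ^ j * exp (t * w)"
  define a0 where "a0 = 1 - ((w - R)\<^sup>2 + real j * (V / G)) / R\<^sup>2"
  let ?H = "\<lambda>y. exp (- (2 * t * R)) * G ^ j * exp (t * (real j * c - y)) *
           (1 - ((real j * c - y - R)\<^sup>2 + real j * (V / G)) / R\<^sup>2)"
  let ?i = "\<lambda>x. indicator {- K..K} x :: real"
  have H: "?H (y - x) = A * (a0 * exp (t * (x - c)) - 2 * (w - R) / R\<^sup>2 * ((x - c) * exp (t * (x - c)))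
      - 1 / R\<^sup>2 * ((x - c)\<^sup>2 * exp (t * (x - c))))" for x
  proof -
    have split: "real j * c - (y - x) = w + (x - c)" by (simp add: w_def algebra_simps)
    have expand: "?H (y - x) = exp (- (2 * t * R)) * G ^ j * (exp (t * w) * exp (t * (x - c))) *
           (1 - ((w + (x - c) - R)\<^sup>2 + real j * (V / G)) / R\<^sup>2)"
      unfolding split by (simp only: exp_add distrib_left)
    have "1 - ((w + (x - c) - R)\<^sup>2 + real j * (V / G)) / R\<^sup>2 =
        a0 - 2 * (w - R) / R\<^sup>2 * (x - c) - 1 / R\<^sup>2 * (x - c)\<^sup>2"
      using R by (simp add: a0_def field_simps power2_eq_square)
    then have "?H (y - x) = (A * exp (t * (x - c))) * (a0 - 2 * (w - R) / R\<^sup>2 * (x - c) - 1 / R\<^sup>2 * (x - c)\<^sup>2)"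
      unfolding expand A_def by (simp only: mult.assoc)
    also have "\<dots> = A * (a0 * exp (t * (x - c)) - 2 * (w - R) / R\<^sup>2 * ((x - c) * exp (t * (x - c)))
      - 1 / R\<^sup>2 * ((x - c)\<^sup>2 * exp (t * (x - c))))"
      by (simp only: right_diff_distrib mult_ac)
    finally show ?thesis .
  qed
  have ints: "integrable \<mu> (\<lambda>x. ?i x * exp (t * (x - c)))"
     "integrable \<mu> (\<lambda>x. ?i x * ((x - c) * exp (t * (x - c))))"
     "integrable \<mu> (\<lambda>x. ?i x * ((x - c)\<^sup>2 * exp (t * (x - c))))"
     "integrable \<mu> (\<lambda>x. ?i x * ?H (y - x))"
    by (intro integrable_truncated continuous_intros; use R in simp)+
  have linear: "(\<integral>x. k * (k1 * f x - k2 * g x - k3 * h x) \<partial>\<mu>) =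
      k * (k1 * (\<integral>x. f x \<partial>\<mu>) - k2 * (\<integral>x. g x \<partial>\<mu>) - k3 * (\<integral>x. h x \<partial>\<mu>))"
    if "integrable \<mu> f" "integrable \<mu> g" "integrable \<mu> h" for k k1 k2 k3 :: real and f g h :: "real \<Rightarrow> real"
    using that by simp
  have "(\<integral>x. ?i x * ?H (y - x) \<partial>\<mu>) = (\<integral>x. A * (a0 * (?i x * exp (t * (x - c)))
      - 2 * (w - R) / R\<^sup>2 * (?i x * ((x - c) * exp (t * (x - c))))
      - 1 / R\<^sup>2 * (?i x * ((x - c)\<^sup>2 * exp (t * (x - c))))) \<partial>\<mu>)"
    unfolding H by (intro Bochner_Integration.integral_cong refl) (simp add: algebra_simps)
  \<comment> \<open>The term linear in \<open>x - c\<close> vanishes because the tilted mean is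
    \<open>c\<close>; the quadratic term contributes one more summand \<open>V / G\<close> of the
    variance.\<close>
  also have "\<dots> = A * (a0 * G - 2 * (w - R) / R\<^sup>2 * 0 - 1 / R\<^sup>2 * V)"
    unfolding G_def V_def mean[symmetric] by (rule linear[OF ints(1-3)])
  also have "\<dots> = A * G * (1 - ((w - R)\<^sup>2 + real (Suc j) * (V / G)) / R\<^sup>2)"
    using G R by (simp add: a0_def field_simps)
  finally have eq: "(\<integral>x. ?i x * ?H (y - x) \<partial>\<mu>) = A * G * (1 - ((w - R)\<^sup>2 + real (Suc j) * (V / G)) / R\<^sup>2)" .
  have "(\<integral>x. ?i x * ?H (y - x) \<partial>\<mu>) \<le> (\<integral>x. walk_tail \<mu> j (y - x) \<partial>\<mu>)"
    using Suc by (intro integral_mono ints integrable_walk_tail) (auto simp: indicator_def walk_tail_nonneg)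
  then show ?case
    unfolding eq by (simp add: A_def w_def mult_ac)
qed

end

context unbounded_step_law
begin

text \<open>The truncated moment function has a minimiser on the half line, and its derivative
  vanishes there. For large \<open>K\<close> the minimum is at least exp (- \<gamma>): otherwise
  minimisers would accumulate at some \<open>t\<close> with E exp (t (X - c)) \<le> exp (-
  \<gamma>), against \<open>mgf_ge\<close>.\<close>

lemma truncated_optimum:
  assumes c: "c > 0" and \<gamma>: "\<gamma> > rate \<mu> c"
  obtains K t where "t \<ge> 0"
    "(\<integral>x. indicator {- K..K} x * ((x - c) * exp (t * (x - c))) \<partial>\<mu>) = 0"
    "exp (- \<gamma>) \<le> (\<integral>x. indicator {- K..K} x * exp (t * (x - c)) \<partial>\<mu>)"
proof -
  define G where "G K t = (\<integral>x. indicator {- K..K} x * exp (t * (x - c)) \<partial>\<mu>)" for K t :: real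
  define D where "D K t = (\<integral>x. indicator {- K..K} x * ((x - c) * exp (t * (x - c))) \<partial>\<mu>)" for K t :: real
  have int_G: "integrable \<mu> (\<lambda>x. indicator {- K..K} x * exp (t * (x - c)))" for K t
    by (intro integrable_truncated continuous_intros)
  have int_D: "integrable \<mu> (\<lambda>x. indicator {- K..K} x * ((x - c) * exp (t * (x - c))))" for K t
    by (intro integrable_truncated continuous_intros)
  have G_mono: "G K t \<le> G K' t" if "K \<le> K'" for K K' t
    unfolding G_def using that by (intro integral_mono int_G) (auto simp: indicator_def)
  have G_0: "G K 0 \<le> 1" for K
    unfolding G_def using int_G[of K 0] by (intro integral_le_const) (auto simp: indicator_def)
  have "convex_on UNIV (G K)" for K
  proof (rule convex_onI)
    fix u s t :: real assume u: "0 < u" "u < 1"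
    have ex: "exp (((1 - u) * s + u * t) * (x - c)) \<le> (1 - u) * exp (s * (x - c)) + u * exp (t * (x - c))" for x
      using convex_onD[OF exp_convex, of u "s * (x - c)" "t * (x - c)"] u by (simp add: algebra_simps)
    have "G K ((1 - u) *\<^sub>R s + u *\<^sub>R t) \<le>
       (\<integral>x. (1 - u) * (indicator {- K..K} x * exp (s * (x - c))) + u * (indicator {- K..K} x * exp (t * (x - c))) \<partial>\<mu>)"
      unfolding G_def using ex
      by (intro integral_mono int_G Bochner_Integration.integrable_add integrable_mult_right) (auto simp: indicator_def)
    also have "\<dots> = (1 - u) * G K s + u * G K t"
      unfolding G_def by (simp add: int_G)
    finally show "G K ((1 - u) *\<^sub>R s + u *\<^sub>R t) \<le> (1 - u) * G K s + u * G K t" .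
  qed simp
  then have cont_G: "continuous_on S (G K)" for S K
    using convex_on_continuous[OF open_UNIV] continuous_on_subset by blast
  \<comment> \<open>Mass above \<open>c + 1\<close> within the window forces \<open>G K t\<close>
    \<ge> \<open>q * exp t\<close> for all larger windows at once, so minimisers stay
    bounded.\<close>
  obtain K0 where K0: "measure \<mu> {c + 1<..real K0} > 0"
  proof -
    have "(\<lambda>n. measure \<mu> {c + 1<..real n}) \<longlonglongrightarrow> measure \<mu> (\<Union>n. {c + 1<..real n})"
      by (intro finite_Lim_measure_incseq) (auto simp: incseq_def)
    also have "(\<Union>n. {c + 1<..real n}) = {c + 1<..}"
      using real_arch_simple by auto
    finally have "eventually (\<lambda>n. measure \<mu> {c + 1<..real n} > 0) sequentially"
      using unbounded_above by (rule order_tendstoD)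
    with that show thesis by (auto simp: eventually_sequentially)
  qed
  define q where "q = measure \<mu> {c + 1<..real K0}"
  \<comment> \<open>\<open>q * exp T\<close> is e and exceeds \<open>G K 0\<close> \<le> 1, so a
    minimum over [0, T] is one over all \<open>t\<close> \<ge> 0.\<close>
  define T where "T = 1 - ln q"
  have q: "0 < q" "q \<le> 1" using K0 by (auto simp: q_def)
  then have T: "T > 0" by (simp add: T_def) (smt (verit) ln_le_zero_iff)
  have G_ge: "q * exp t \<le> G (real K) t" if "K \<ge> K0" "t \<ge> 0" for K t
  proof -
    have "q * exp t = (\<integral>x. indicator {c + 1<..real K0} x * exp t \<partial>\<mu>)"
      by (simp add: q_def)
    also have "\<dots> \<le> G (real K) t"
      unfolding G_def
    proof (intro integral_mono int_G)
      show "integrable \<mu> (\<lambda>x. indicator {c + 1<..real K0} x * exp t)"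
        by (intro integrable_const_bound[where B = "exp t"]) (auto simp: indicator_def)
      fix x
      have "t * 1 \<le> t * (x - c)" if "c + 1 < x"
        using that \<open>t \<ge> 0\<close> by (intro mult_left_mono) auto
      then show "indicator {c + 1<..real K0} x * exp t \<le> indicator {- real K..real K} x * exp (t * (x - c))"
        using \<open>K \<ge> K0\<close> c by (auto simp: indicator_def)
    qed
    finally show ?thesis .
  qed
  have "\<exists>t\<in>{0..T}. \<forall>s\<in>{0..T}. G (real K) t \<le> G (real K) s" for K
    using T by (intro continuous_attains_inf cont_G) auto
  then obtain \<tau> where \<tau>: "\<And>K. \<tau> K \<in> {0..T}" "\<And>K s. s \<in> {0..T} \<Longrightarrow> G (real K) (\<tau> K) \<le> G (real K) s"
    by metis
  have \<tau>_min: "G (real K) (\<tau> K) \<le> G (real K) s" if "K \<ge> K0" "s \<ge> 0" for K s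
  proof (cases "s \<le> T")
    case False
    have "G (real K) (\<tau> K) \<le> G (real K) 0" using T by (intro \<tau>) auto
    also have "\<dots> \<le> 1" by (rule G_0)
    also have "1 \<le> q * exp s"
    proof -
      have "1 = q * exp (- ln q)" using q by (simp add: exp_minus)
      also have "\<dots> \<le> q * exp s" using False q by (intro mult_left_mono) (auto simp: T_def)
      finally show ?thesis .
    qed
    also have "\<dots> \<le> G (real K) s" using that by (rule G_ge)
    finally show ?thesis .
  qed (use that \<tau> in auto)
  \<comment> \<open>The derivative at 0 tends to E X - c < 0, so that 0 is not a minimiser for large
    \<open>K\<close>.\<close>
  have "(\<lambda>K. D (real K) 0) \<longlonglongrightarrow> (\<integral>x. x - c \<partial>\<mu>)"
  proof -
    have "(\<lambda>K. indicator {- real K..real K} x * (x - c)) \<longlonglongrightarrow> x - c" for x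
    proof (rule tendsto_eventually)
      obtain N where "\<bar>x\<bar> \<le> real N" using real_arch_simple by blast
      then show "\<forall>\<^sub>F K in sequentially. indicator {- real K..real K} x * (x - c) = x - c"
        by (intro eventually_sequentiallyI[of N]) (auto simp: indicator_def)
    qed
    note lim = this
    have D_0: "D (real K) 0 = (\<integral>x. indicator {- real K..real K} x * (x - c) \<partial>\<mu>)" for K
      by (simp add: D_def)
    show ?thesis
      unfolding D_0
    proof (rule integral_dominated_convergence[where w = "\<lambda>x. \<bar>x - c\<bar>"])
      show "integrable \<mu> (\<lambda>x. \<bar>x - c\<bar>)" using integrable_step by simp
      show "AE x in \<mu>. norm (indicator {- real K..real K} x * (x - c)) \<le> \<bar>x - c\<bar>" for K
        by (simp add: indicator_def)
      show "AE x in \<mu>. (\<lambda>K. indicator {- real K..real K} x * (x - c)) \<longlonglongrightarrow> x - c"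
        using lim by simp
    qed measurable
  qed
  moreover have "(\<integral>x. x - c \<partial>\<mu>) < 0"
    using integrable_step centered c by (simp add: prob_space[simplified])
  ultimately have "eventually (\<lambda>K. D (real K) 0 < 0) sequentially"
    by (rule order_tendstoD)
  then obtain K1 where K1: "\<And>K. K \<ge> K1 \<Longrightarrow> D (real K) 0 < 0"
    by (auto simp: eventually_sequentially)
  have "\<exists>K\<ge>max K0 K1. exp (- \<gamma>) \<le> G (real K) (\<tau> K)"
  proof (rule ccontr)
    assume "\<not> ?thesis"
    then have less: "G (real K) (\<tau> K) < exp (- \<gamma>)" if "K \<ge> max K0 K1" for K
      using that by force
    obtain t r where t: "t \<in> {0..T}" and r: "strict_mono r" "(\<tau> \<circ> r) \<longlonglongrightarrow> t"
      using compact_Icc[of 0 T] \<tau>(1) unfolding compact_def by meson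
    have G_t: "G (real K) t \<le> exp (- \<gamma>)" for K
    proof (rule tendsto_upperbound)
      have "isCont (G (real K)) t"
        using cont_G[of UNIV] by (simp add: continuous_on_eq_continuous_at)
      then show "(\<lambda>n. G (real K) ((\<tau> \<circ> r) n)) \<longlonglongrightarrow> G (real K) t"
        using r(2) by (rule isCont_tendsto_compose)
      show "\<forall>\<^sub>F n in sequentially. G (real K) ((\<tau> \<circ> r) n) \<le> exp (- \<gamma>)"
      proof (rule eventually_sequentiallyI[of "max K (max K0 K1)"])
        fix n assume n: "max K (max K0 K1) \<le> n"
        then have "max K (max K0 K1) \<le> r n"
          using seq_suble[OF r(1), of n] by linarith
        then show "G (real K) ((\<tau> \<circ> r) n) \<le> exp (- \<gamma>)"
          using less[of "r n"] G_mono[of "real K" "real (r n)" "\<tau> (r n)"] by simp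
      qed
    qed simp
    have "(\<integral>\<^sup>+x. ennreal (exp (t * (x - c))) \<partial>\<mu>) \<le> ennreal (exp (- \<gamma>))"
    proof -
      have "(\<integral>\<^sup>+x. ennreal (exp (t * (x - c))) \<partial>\<mu>) =
          (\<integral>\<^sup>+x. (SUP K. ennreal (indicator {- real K..real K} x * exp (t * (x - c)))) \<partial>\<mu>)"
      proof (intro nn_integral_cong antisym SUP_least)
        fix x
        obtain N where "\<bar>x\<bar> \<le> real N" using real_arch_simple by blast
        then show "ennreal (exp (t * (x - c))) \<le> (SUP K. ennreal (indicator {- real K..real K} x * exp (t * (x - c))))"
          by (intro SUP_upper2[of N]) (auto simp: indicator_def)
      qed (auto simp: indicator_def)
      also have "\<dots> = (SUP K. \<integral>\<^sup>+x. ennreal (indicator {- real K..real K} x * exp (t * (x - c))) \<partial>\<mu>)"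
        by (intro nn_integral_monotone_convergence_SUP)
           (auto simp: incseq_def le_fun_def indicator_def)
      also have "\<dots> = (SUP K. ennreal (G (real K) t))"
        unfolding G_def by (subst nn_integral_eq_integral) (auto simp: int_G)
      also have "\<dots> \<le> ennreal (exp (- \<gamma>))"
        using G_t by (intro SUP_least ennreal_leI)
      finally show ?thesis .
    qed
    moreover have "mgf \<mu> t = ennreal (exp (t * c)) * (\<integral>\<^sup>+x. ennreal (exp (t * (x - c))) \<partial>\<mu>)"
      unfolding mgf_def
      by (subst nn_integral_cmult[symmetric])
         (auto simp: ennreal_mult[symmetric] exp_add[symmetric] algebra_simps)
    ultimately have "mgf \<mu> t \<le> ennreal (exp (t * c)) * ennreal (exp (- \<gamma>))"
      by (simp add: mult_left_mono)
    also have "\<dots> = ennreal (exp (t * c - \<gamma>))"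
      by (simp add: ennreal_mult[symmetric] exp_add[symmetric])
    finally have le: "mgf \<mu> t \<le> ennreal (exp (t * c - \<gamma>))" .
    have "ennreal (exp (t * c - rate \<mu> c)) \<le> ennreal (exp (t * c - \<gamma>))"
      using t by (intro order.trans[OF mgf_ge le]) simp
    then have "exp (t * c - rate \<mu> c) \<le> exp (t * c - \<gamma>)"
      by (subst (asm) ennreal_le_iff) auto
    then show False using \<gamma> by simp
  qed
  then obtain K where K: "K \<ge> K0" "K \<ge> K1" "exp (- \<gamma>) \<le> G (real K) (\<tau> K)" by auto
  let ?t = "\<tau> K" and ?K = "real K"
  \<comment> \<open>Convexity of the exponential in difference form; together with the continuity of
    \<open>D\<close> it replaces differentiation under the integral.\<close>
  have slope: "G ?K (s + h) - G ?K s \<le> h * D ?K (s + h)" for s h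
  proof -
    have "exp ((s + h) * y) * (1 - h * y) \<le> exp (s * y)" for y
    proof -
      have "exp ((s + h) * y) * (1 - h * y) \<le> exp ((s + h) * y) * exp (- (h * y))"
        using exp_ge_add_one_self[of "- (h * y)"] by (intro mult_left_mono) auto
      then show ?thesis by (simp add: exp_add[symmetric] algebra_simps)
    qed
    moreover have "E * (1 - h * y) = E - h * (y * E)" for E y by (simp add: right_diff_distrib)
    ultimately have "exp ((s + h) * y) - h * (y * exp ((s + h) * y)) \<le> exp (s * y)" for y by metis
    then have "(\<integral>x. indicator {- ?K..?K} x * exp ((s + h) * (x - c)) - h * (indicator {- ?K..?K} x * ((x - c) * exp ((s + h) * (x - c)))) \<partial>\<mu>) \<le> G ?K s"
      unfolding G_def by (intro integral_mono int_G Bochner_Integration.integrable_diff integrable_mult_right int_D) (auto simp: indicator_def)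
    also have "(\<integral>x. indicator {- ?K..?K} x * exp ((s + h) * (x - c)) - h * (indicator {- ?K..?K} x * ((x - c) * exp ((s + h) * (x - c)))) \<partial>\<mu>) =
        G ?K (s + h) - h * D ?K (s + h)"
      unfolding G_def D_def by (simp add: int_G int_D)
    finally show ?thesis by simp
  qed
  have D_tendsto: "(\<lambda>n. D ?K (h n)) \<longlonglongrightarrow> D ?K s" if h: "h \<longlonglongrightarrow> s" for h s
  proof -
    obtain B where B: "\<And>n. \<bar>h n\<bar> \<le> B"
      using convergent_imp_Bseq[OF convergentI[OF h]] by (auto simp: Bseq_def)
    have le: "indicator {- ?K..?K} x * (\<bar>x - c\<bar> * exp (h n * (x - c))) \<le> indicator {- ?K..?K} x * (\<bar>x - c\<bar> * exp (B * \<bar>x - c\<bar>))" for n x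
    proof -
      have "h n * (x - c) \<le> \<bar>h n\<bar> * \<bar>x - c\<bar>" by (simp add: abs_mult[symmetric])
      also have "\<dots> \<le> B * \<bar>x - c\<bar>" using B by (intro mult_right_mono) auto
      finally show ?thesis by (intro mult_left_mono) auto
    qed
    have "integrable \<mu> (\<lambda>x. indicator {- ?K..?K} x * (\<bar>x - c\<bar> * exp (B * \<bar>x - c\<bar>)))"
      by (intro integrable_truncated continuous_intros)
    then show ?thesis
      unfolding D_def using le
      by (intro integral_dominated_convergence[where w = "\<lambda>x. indicator {- ?K..?K} x * (\<bar>x - c\<bar> * exp (B * \<bar>x - c\<bar>))"])
         (auto simp: abs_mult intro!: tendsto_intros h)
  qed
  have tau0: "?t \<ge> 0" using \<tau>(1) by auto
  have inv: "(\<lambda>n. inverse (real (Suc n))) \<longlonglongrightarrow> 0" by (rule LIMSEQ_inverse_real_of_nat)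
  have ge: "D ?K ?t \<ge> 0"
  proof (rule tendsto_lowerbound)
    show "(\<lambda>n. D ?K (?t + inverse (real (Suc n)))) \<longlonglongrightarrow> D ?K ?t"
      using tendsto_add[OF tendsto_const inv, of ?t] by (intro D_tendsto) simp
    have "D ?K (?t + h) \<ge> 0" if "h > 0" for h
      using slope[of ?t h] \<tau>_min[OF K(1), of "?t + h"] tau0 that
      by (smt (verit) mult_pos_neg)
    then show "\<forall>\<^sub>F n in sequentially. 0 \<le> D ?K (?t + inverse (real (Suc n)))" by simp
  qed simp
  \<comment> \<open>Only a positive minimiser can be approached from the left, which gives the other
    sign of the derivative.\<close>
  have pos: "?t > 0"
    using ge K1[OF K(2)] tau0 by (cases "?t = 0") auto
  have le: "D ?K ?t \<le> 0"
  proof (rule tendsto_upperbound)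
    have lim: "(\<lambda>n. ?t - inverse (real (Suc n))) \<longlonglongrightarrow> ?t"
      using tendsto_diff[OF tendsto_const inv, of ?t] by simp
    then show "(\<lambda>n. D ?K (?t - inverse (real (Suc n)))) \<longlonglongrightarrow> D ?K ?t"
      by (rule D_tendsto)
    have "D ?K (?t - h) \<le> 0" if "h > 0" "h < ?t" for h
      using slope[of ?t "- h"] \<tau>_min[OF K(1), of "?t - h"] that
      by (smt (verit) mult_pos_pos mult_minus_left)
    moreover have "\<forall>\<^sub>F n in sequentially. 0 < ?t - inverse (real (Suc n))"
      using order_tendstoD(1)[OF lim pos] .
    ultimately show "\<forall>\<^sub>F n in sequentially. D ?K (?t - inverse (real (Suc n))) \<le> 0"
      by (elim eventually_mono) auto
  qed simp
  show thesis
    by (rule that[of ?t ?K]) (use ge le tau0 K(3) in \<open>auto simp: D_def G_def\<close>)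
qed

text \<open>The tilted bound is applied at a speed \<open>d\<close> above \<open>c\<close>, so that
  the whole Chebyshev window lies above \<open>c * l\<close>. A single length \<open>l\<close>
  suffices, as blocks of this length are concatenated later.\<close>

lemma cramer_lower:
  assumes c: "c > 0" and e: "e > 0"
  obtains l where "l > 0" "exp (- (rate \<mu> c + e) * real l) \<le> walk_tail \<mu> l (c * real l)"
proof -
  obtain d where d: "d > c" "rate \<mu> d < rate \<mu> c + e / 4"
    using rate_right[of c "rate \<mu> c + e / 4"] e by auto
  have "d > 0" using d c by simp
  obtain K t where t: "t \<ge> 0"
    and mean: "(\<integral>x. indicator {- K..K} x * ((x - d) * exp (t * (x - d))) \<partial>\<mu>) = 0"
    and G: "exp (- (rate \<mu> c + e / 4)) \<le> (\<integral>x. indicator {- K..K} x * exp (t * (x - d)) \<partial>\<mu>)"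
    using truncated_optimum[OF \<open>d > 0\<close> d(2)] by blast
  define G where "G = (\<integral>x. indicator {- K..K} x * exp (t * (x - d)) \<partial>\<mu>)"
  define V where "V = (\<integral>x. indicator {- K..K} x * ((x - d)\<^sup>2 * exp (t * (x - d))) \<partial>\<mu>)"
  have G_pos: "G > 0" using G exp_gt_zero unfolding G_def by (rule order.strict_trans2[rotated])
  \<comment> \<open>The half-width of the window per step: at most \<open>d - c\<close>, and so
    small that the tilt costs at most \<open>e / 4\<close> per step. The summand 1 covers
    \<open>t = 0\<close>.\<close>
  define \<delta> where "\<delta> = min (d - c) (e / (4 * (t + 1)))"
  have \<delta>: "\<delta> > 0" "\<delta> \<le> d - c" using d e t by (auto simp: \<delta>_def)
  have t\<delta>: "t * \<delta> \<le> e / 4"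
  proof -
    have "t * \<delta> \<le> (t + 1) * (e / (4 * (t + 1)))"
      using t \<delta> by (intro mult_mono) (auto simp: \<delta>_def)
    also have "(t + 1) * (e / (4 * (t + 1))) = e / 4" using t by (simp add: field_simps)
    finally show ?thesis .
  qed
  \<comment> \<open>The first bound makes the Chebyshev loss at most 1 / 2, the second lets exp (e l
    / 2) pay for this factor.\<close>
  obtain l :: nat where l: "real l > 2 * (V / G) / \<delta>\<^sup>2" "real l > 4 / e" "l > 0"
  proof -
    obtain l :: nat where "real l > max (2 * (V / G) / \<delta>\<^sup>2) (max (4 / e) 0)"
      using reals_Archimedean2 by blast
    with that show thesis by force
  qed
  let ?R = "\<delta> * real l"
  have R: "?R > 0" using \<delta> l by simp
  have half: "1 - (real l * (V / G)) / ?R\<^sup>2 \<ge> 1 / 2"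
  proof -
    have "(real l * (V / G)) / ?R\<^sup>2 = (V / G) / \<delta>\<^sup>2 / real l"
      using l by (simp add: power2_eq_square field_simps)
    also have "\<dots> \<le> 1 / 2"
    proof -
      define X where "X = V / G / \<delta>\<^sup>2"
      have "2 * X \<le> real l" using l(1) by (simp add: X_def)
      then show ?thesis unfolding X_def[symmetric] using l(3) by (simp add: field_simps)
    qed
    finally show ?thesis by simp
  qed
  have "exp (- (rate \<mu> c + e) * real l) \<le> exp (- (rate \<mu> c + e / 2) * real l) * (1 / 2)"
  proof -
    have "2 \<le> exp (e / 2 * real l)"
      using l(2) e exp_ge_add_one_self[of "e / 2 * real l"] by (simp add: field_simps)
    then have "exp (- (rate \<mu> c + e) * real l) * 2 \<le> exp (- (rate \<mu> c + e) * real l) * exp (e / 2 * real l)"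
      by (intro mult_left_mono) auto
    also have "\<dots> = exp (- (rate \<mu> c + e / 2) * real l)"
      by (simp add: exp_add[symmetric] algebra_simps)
    finally show ?thesis by simp
  qed
  also have "\<dots> \<le> (G ^ l * exp (- (t * ?R))) * (1 - (real l * (V / G)) / ?R\<^sup>2)"
  proof (intro mult_mono)
    have "exp (- (rate \<mu> c + e / 2) * real l) \<le> exp (- (rate \<mu> c + e / 4) * real l) * exp (- (t * ?R))"
    proof -
      have "t * \<delta> * real l \<le> e / 4 * real l" using t\<delta> by (rule mult_right_mono) simp
      then show ?thesis by (simp add: exp_add[symmetric] algebra_simps)
    qed
    also have "exp (- (rate \<mu> c + e / 4) * real l) = exp (- (rate \<mu> c + e / 4)) ^ l"
      by (simp add: exp_of_nat_mult[symmetric] mult.commute)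
    also have "\<dots> \<le> G ^ l"
      using G by (intro power_mono) (auto simp: G_def)
    finally show "exp (- (rate \<mu> c + e / 2) * real l) \<le> G ^ l * exp (- (t * ?R))" by simp
  qed (use half G_pos in auto)
  \<comment> \<open>At height \<open>l * d - R\<close> the square vanishes and only the variance
    term is left.\<close>
  also have "\<dots> = exp (- (2 * t * ?R)) * G ^ l * exp (t * (real l * d - (real l * d - ?R))) *
           (1 - ((real l * d - (real l * d - ?R) - ?R)\<^sup>2 + real l * (V / G)) / ?R\<^sup>2)"
    by (simp add: exp_add[symmetric] exp_minus field_simps flip: exp_double)
  also have "\<dots> \<le> walk_tail \<mu> l (real l * d - ?R)"
    using walk_tail_ge_tilted[where K = K and t = t and c = d and R = ?R and j = l and y = "real l * d - ?R", folded G_def V_def] mean G_pos t R by blast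
  also have "\<dots> \<le> walk_tail \<mu> l (c * real l)"
  proof (rule walk_tail_antimono)
    have "\<delta> * real l \<le> (d - c) * real l" using \<delta> by (intro mult_right_mono) auto
    then show "c * real l \<le> real l * d - ?R" by (simp add: algebra_simps)
  qed
  finally show thesis using that l by blast
qed

end

section \<open>Offspring generating functions\<close>

definition pgf :: "nat pmf \<Rightarrow> real \<Rightarrow> real" where
  "pgf p s = (\<integral>k. s ^ k \<partial>measure_pmf p)"

text \<open>The difference quotient of the generating function between \<open>s\<close> and 1,
  written without division so that its value at 1 is the mean.\<close>

definition pgf_slope :: "nat pmf \<Rightarrow> real \<Rightarrow> real" where
  "pgf_slope p s = (\<integral>k. (\<Sum>i<k. s ^ i) \<partial>measure_pmf p)"

lemma integrable_pgf:
  fixes s :: real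
  assumes "0 \<le> s" "s \<le> 1"
  shows "integrable (measure_pmf p) (\<lambda>k. s ^ k)"
  using assms by (intro measure_pmf.integrable_const_bound[where B = 1]) (auto simp: power_le_one)

lemma gen_fun_eq_pgf:
  assumes "0 \<le> s" "s \<le> 1"
  shows "gen_fun p (ennreal s) = ennreal (pgf p s)"
proof -
  have "gen_fun p (ennreal s) = (\<integral>\<^sup>+k. ennreal (s ^ k) \<partial>measure_pmf p)"
    unfolding gen_fun_def by (intro nn_integral_cong) (simp add: ennreal_power assms)
  also have "\<dots> = ennreal (pgf p s)"
    unfolding pgf_def by (intro nn_integral_eq_integral integrable_pgf) (use assms in auto)
  finally show ?thesis .
qed

lemma pgf_mono: "0 \<le> s \<Longrightarrow> s \<le> t \<Longrightarrow> t \<le> 1 \<Longrightarrow> pgf p s \<le> pgf p t"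
  unfolding pgf_def by (intro integral_mono integrable_pgf power_mono) auto

lemma pgf_nonneg: "0 \<le> s \<Longrightarrow> 0 \<le> pgf p s"
  unfolding pgf_def by (intro Bochner_Integration.integral_nonneg) auto

lemma pgf_le_self:
  assumes "pmf p 0 = 0" "0 \<le> s" "s \<le> 1"
  shows "pgf p s \<le> s"
proof -
  have "pgf p s \<le> (\<integral>k. s \<partial>measure_pmf p)"
    unfolding pgf_def
  proof (intro integral_mono_AE integrable_pgf assms)
    show "AE k in measure_pmf p. s ^ k \<le> s"
    proof (rule AE_pmfI)
      fix k assume "k \<in> set_pmf p"
      then have "k \<noteq> 0" using assms(1) by (metis set_pmf_iff)
      then show "s ^ k \<le> s" using power_decreasing[of 1 k s] assms by simp
    qed
  qed simp
  then show ?thesis by simp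
qed

context
  fixes p :: "nat pmf" and m :: real
  assumes integrable_offspring: "integrable (measure_pmf p) real"
    and mean: "(\<integral>k. real k \<partial>measure_pmf p) = m"
begin

lemma integrable_slope:
  fixes s :: real
  assumes s: "0 \<le> s" "s \<le> 1"
  shows "integrable (measure_pmf p) (\<lambda>k. \<Sum>i<k. s ^ i)"
proof (rule Bochner_Integration.integrable_bound[OF integrable_offspring])
  have "(\<Sum>i<k. s ^ i) \<le> real k" for k
    using sum_mono[of "{..<k}" "\<lambda>i. s ^ i" "\<lambda>_. 1"] s by (auto simp: power_le_one)
  then show "AE k in measure_pmf p. norm (\<Sum>i<k. s ^ i) \<le> norm (real k)"
    using s by (auto simp: sum_nonneg)
qed simp

lemma one_minus_pgf:
  assumes "0 \<le> w" "w \<le> 1"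
  shows "1 - pgf p (1 - w) = w * pgf_slope p (1 - w)"
proof -
  have "1 - pgf p (1 - w) = (\<integral>k. 1 - (1 - w) ^ k \<partial>measure_pmf p)"
    unfolding pgf_def using assms by (subst Bochner_Integration.integral_diff) (auto simp: integrable_pgf)
  also have "\<dots> = (\<integral>k. w * (\<Sum>i<k. (1 - w) ^ i) \<partial>measure_pmf p)"
    by (intro Bochner_Integration.integral_cong refl) (simp add: one_diff_power_eq)
  finally show ?thesis by (simp add: pgf_slope_def)
qed

lemma pgf_slope_mono: "0 \<le> s \<Longrightarrow> s \<le> t \<Longrightarrow> t \<le> 1 \<Longrightarrow> pgf_slope p s \<le> pgf_slope p t"
  unfolding pgf_slope_def by (intro integral_mono integrable_slope sum_mono power_mono) auto

lemma pgf_slope_1: "pgf_slope p 1 = m"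
  by (simp add: pgf_slope_def mean)

lemma one_minus_pgf_le:
  assumes "0 \<le> w" "w \<le> 1"
  shows "1 - pgf p (1 - w) \<le> m * w"
proof -
  have "w * pgf_slope p (1 - w) \<le> w * m"
    using assms pgf_slope_mono[of "1 - w" 1] by (intro mult_left_mono) (auto simp: pgf_slope_1)
  then show ?thesis using one_minus_pgf[OF assms] by (simp add: mult.commute)
qed

text \<open>Dominated convergence, with the offspring number as majorant, makes the slope continuous
  at 1 from the left; its monotonicity extends the bound from one point \<open>h n\<close> to an
  interval.\<close>

lemma one_minus_pgf_ge:
  assumes "\<epsilon> > 0"
  obtains \<eta> where "0 < \<eta>" "\<eta> \<le> 1" "\<And>w. 0 \<le> w \<Longrightarrow> w \<le> \<eta> \<Longrightarrow> (m - \<epsilon>) * w \<le> 1 - pgf p (1 - w)"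
proof -
  define h where "h n = inverse (real (Suc n))" for n
  have h: "0 < h n" "h n \<le> 1" for n by (auto simp: h_def inverse_le_1_iff)
  have "(\<lambda>n. pgf_slope p (1 - h n)) \<longlonglongrightarrow> pgf_slope p 1"
    unfolding pgf_slope_def
  proof (rule integral_dominated_convergence[where w = real])
    have "(\<Sum>i<k. (1 - h n) ^ i) \<le> real k" for k n
      using sum_mono[of "{..<k}" "\<lambda>i. (1 - h n) ^ i" "\<lambda>_. 1"] h[of n] by (auto simp: power_le_one)
    then show "AE k in measure_pmf p. norm (\<Sum>i<k. (1 - h n) ^ i) \<le> real k" for n
      using h[of n] by (auto simp: sum_nonneg)
    have "(\<lambda>n. 1 - h n) \<longlonglongrightarrow> 1 - 0"
      unfolding h_def by (intro tendsto_intros LIMSEQ_inverse_real_of_nat)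
    then show "AE k in measure_pmf p. (\<lambda>n. \<Sum>i<k. (1 - h n) ^ i) \<longlonglongrightarrow> (\<Sum>i<k. 1 ^ i)"
      by (intro AE_I2 tendsto_intros) simp
  qed (auto simp: integrable_offspring)
  then have "\<forall>\<^sub>F n in sequentially. m - \<epsilon> < pgf_slope p (1 - h n)"
    using assms by (intro order_tendstoD(1)[where y = m]) (auto simp: pgf_slope_1)
  then obtain n where n: "m - \<epsilon> < pgf_slope p (1 - h n)"
    by (auto simp: eventually_sequentially)
  show thesis
  proof (rule that[OF h[of n]])
    fix w assume w: "0 \<le> w" "w \<le> h n"
    then have "m - \<epsilon> \<le> pgf_slope p (1 - w)"
      using n pgf_slope_mono[of "1 - h n" "1 - w"] h[of n] by simp
    then have "w * (m - \<epsilon>) \<le> w * pgf_slope p (1 - w)" using w by (intro mult_left_mono)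
    then show "(m - \<epsilon>) * w \<le> 1 - pgf p (1 - w)"
      using one_minus_pgf[of w] w h[of n] by (simp add: mult.commute)
  qed
qed

text \<open>The counterpart to the right of 1, where the exponential moment of the offspring number
  supplies the majorant.\<close>

lemma gen_fun_le:
  assumes "\<epsilon> > 0" and \<theta>: "\<theta> > 0" "integrable (measure_pmf p) (\<lambda>k. exp (\<theta> * real k))"
  obtains \<eta> where "0 < \<eta>" "\<And>w. 0 \<le> w \<Longrightarrow> w \<le> \<eta> \<Longrightarrow> gen_fun p (ennreal (1 + w)) \<le> ennreal (1 + (m + \<epsilon>) * w)"
proof -
  define h where "h n = (exp (\<theta> / 2) - 1) * inverse (real (Suc n))" for n
  have h: "0 < h n" "1 + h n \<le> exp (\<theta> / 2)" for n
  proof -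
    have "(exp (\<theta> / 2) - 1) * inverse (real (Suc n)) \<le> (exp (\<theta> / 2) - 1) * 1"
      using \<theta>(1) by (intro mult_left_mono) (auto simp: inverse_le_1_iff)
    then show "1 + h n \<le> exp (\<theta> / 2)" by (simp add: h_def)
    show "0 < h n" using \<theta>(1) by (simp add: h_def)
  qed
  \<comment> \<open>Half of \<theta> bounds the powers, the other half absorbs the number
    \<open>k\<close> of summands.\<close>
  have slope_le: "(\<Sum>i<k. s ^ i) \<le> 2 / \<theta> * exp (\<theta> * real k)" if "0 \<le> s" "s \<le> exp (\<theta> / 2)" for s k
  proof -
    have "(\<Sum>i<k. s ^ i) \<le> (\<Sum>i<k. exp (\<theta> / 2 * real k))"
    proof (rule sum_mono)
      fix i assume "i \<in> {..<k}"
      have "s ^ i \<le> exp (\<theta> / 2) ^ i" using that by (intro power_mono)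
      also have "\<dots> = exp (\<theta> / 2 * real i)" by (simp add: exp_of_nat_mult[symmetric] mult.commute)
      also have "\<dots> \<le> exp (\<theta> / 2 * real k)" using \<open>i \<in> {..<k}\<close> \<theta> by simp
      finally show "s ^ i \<le> exp (\<theta> / 2 * real k)" .
    qed
    also have "\<dots> = 2 / \<theta> * ((\<theta> / 2 * real k) * exp (\<theta> / 2 * real k))"
      using \<theta> by simp
    also have "\<dots> \<le> 2 / \<theta> * (exp (\<theta> / 2 * real k) * exp (\<theta> / 2 * real k))"
    proof (intro mult_left_mono mult_right_mono)
      show "\<theta> / 2 * real k \<le> exp (\<theta> / 2 * real k)"
        using exp_ge_add_one_self[of "\<theta> / 2 * real k"] by linarith
    qed (use \<theta> in auto)
    also have "\<dots> = 2 / \<theta> * exp (\<theta> * real k)" by (simp add: exp_add[symmetric] field_simps)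
    finally show ?thesis .
  qed
  have int: "integrable (measure_pmf p) (\<lambda>k. \<Sum>i<k. s ^ i)" if "0 \<le> s" "s \<le> exp (\<theta> / 2)" for s
  proof (rule Bochner_Integration.integrable_bound)
    show "integrable (measure_pmf p) (\<lambda>k. 2 / \<theta> * exp (\<theta> * real k))" using \<theta> by simp
    show "AE k in measure_pmf p. norm (\<Sum>i<k. s ^ i) \<le> norm (2 / \<theta> * exp (\<theta> * real k))"
      using slope_le[OF that] \<theta> that(1) by (auto simp: sum_nonneg)
  qed simp
  have "(\<lambda>n. pgf_slope p (1 + h n)) \<longlonglongrightarrow> pgf_slope p 1"
    unfolding pgf_slope_def
  proof (rule integral_dominated_convergence[where w = "\<lambda>k. 2 / \<theta> * exp (\<theta> * real k)"])
    show "AE k in measure_pmf p. norm (\<Sum>i<k. (1 + h n) ^ i) \<le> 2 / \<theta> * exp (\<theta> * real k)" for n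
      using slope_le[of "1 + h n"] h[of n] by (auto simp: sum_nonneg)
    have "(\<lambda>n. 1 + h n) \<longlonglongrightarrow> 1 + (exp (\<theta> / 2) - 1) * 0"
      unfolding h_def by (intro tendsto_intros LIMSEQ_inverse_real_of_nat)
    then show "AE k in measure_pmf p. (\<lambda>n. \<Sum>i<k. (1 + h n) ^ i) \<longlonglongrightarrow> (\<Sum>i<k. 1 ^ i)"
      by (intro AE_I2 tendsto_intros) simp
  qed (use \<theta> in auto)
  then have "\<forall>\<^sub>F n in sequentially. pgf_slope p (1 + h n) < m + \<epsilon>"
    using assms by (intro order_tendstoD(2)[where y = m]) (auto simp: pgf_slope_1)
  then obtain n where n: "pgf_slope p (1 + h n) < m + \<epsilon>"
    by (auto simp: eventually_sequentially)
  show thesis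
  proof (rule that[OF h(1)[of n]])
    fix w assume w: "0 \<le> w" "w \<le> h n"
    have i: "integrable (measure_pmf p) (\<lambda>k. \<Sum>i<k. (1 + w) ^ i)"
      using w h[of n] by (intro int) auto
    have eq: "(1 + w) ^ k = 1 + w * (\<Sum>i<k. (1 + w) ^ i)" for k
      using one_diff_power_eq[of "1 + w" k] by simp
    have "gen_fun p (ennreal (1 + w)) = (\<integral>\<^sup>+k. ennreal (1 + w * (\<Sum>i<k. (1 + w) ^ i)) \<partial>measure_pmf p)"
      unfolding gen_fun_def eq[symmetric] using w by (intro nn_integral_cong) (simp add: ennreal_power del: ennreal_plus)
    also have "\<dots> = ennreal (\<integral>k. 1 + w * (\<Sum>i<k. (1 + w) ^ i) \<partial>measure_pmf p)"
      using w i by (intro nn_integral_eq_integral) (auto intro!: add_nonneg_nonneg mult_nonneg_nonneg sum_nonneg)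
    also have "(\<integral>k. 1 + w * (\<Sum>i<k. (1 + w) ^ i) \<partial>measure_pmf p) = 1 + w * pgf_slope p (1 + w)"
      using i by (simp add: pgf_slope_def)
    also have "pgf_slope p (1 + w) \<le> pgf_slope p (1 + h n)"
      unfolding pgf_slope_def using w h[of n]
      by (intro integral_mono int sum_mono power_mono) auto
    then have "1 + w * pgf_slope p (1 + w) \<le> 1 + (m + \<epsilon>) * w"
      using w n mult_left_mono[of "pgf_slope p (1 + w)" "m + \<epsilon>" w] by (simp add: mult.commute)
    finally show "gen_fun p (ennreal (1 + w)) \<le> ennreal (1 + (m + \<epsilon>) * w)"
      by (simp add: ennreal_leI)
  qed
qed

end

section \<open>Counting particles on the labelled tree\<close>

text \<open>Counts the particles of generation \<open>n\<close> whose ancestral line, started at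
  \<open>z\<close>, stays in \<open>B 0\<close>, ..., \<open>B n\<close>. As the tree is cut at the
  root, the subtrees see the barrier shifted by one.\<close>

primrec count_paths :: "nat \<Rightarrow> (nat \<Rightarrow> real set) \<Rightarrow> real \<Rightarrow> config \<Rightarrow> nat" where
  "count_paths 0 B z S = of_bool (z \<in> B 0)"
| "count_paths (Suc n) B z S =
    (if z \<in> B 0 then \<Sum>i<kids S. count_paths n (\<lambda>j. B (Suc j)) (z + first_step S i) (subtree i S) else 0)"

definition count_at :: "nat \<Rightarrow> real set \<Rightarrow> real \<Rightarrow> config \<Rightarrow> nat" where
  "count_at n C = count_paths n (\<lambda>j. if j < n then UNIV else C)"

lemma count_at_0 [simp]: "count_at 0 C z S = of_bool (z \<in> C)"
  by (simp add: count_at_def)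

lemma count_at_Suc [simp]:
  "count_at (Suc n) C z S = (\<Sum>i<kids S. count_at n C (z + first_step S i) (subtree i S))"
  by (simp add: count_at_def)

text \<open>If no particle is outside \<open>B k\<close> at any time \<open>k < n\<close>, then no
  ancestral line has been killed.\<close>

lemma count_at_le_count_paths:
  assumes "\<And>k. k < n \<Longrightarrow> count_at k (- B k) z S = 0"
  shows "count_at n (B n) z S \<le> count_paths n B z S"
  using assms
proof (induction n arbitrary: B z S)
  case (Suc n)
  have "z \<in> B 0" using Suc.prems[of 0] by auto
  moreover have "count_at n (B (Suc n)) (z + first_step S i) (subtree i S) \<le>
      count_paths n (\<lambda>j. B (Suc j)) (z + first_step S i) (subtree i S)" if "i < kids S" for i
    using Suc.prems[of "Suc k" for k] that by (intro Suc.IH) auto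
  ultimately show ?case by (auto intro!: sum_mono)
qed simp

section \<open>Identification of the given branching random walk with the canonical tree\<close>

definition tree_of :: "(nat list \<Rightarrow> 'a \<Rightarrow> nat) \<Rightarrow> (nat list \<times> nat \<Rightarrow> 'a \<Rightarrow> real) \<Rightarrow> 'a \<Rightarrow> config" where
  "tree_of N D \<omega> = case_sum (\<lambda>u. real (N u \<omega>)) (\<lambda>e. D e \<omega>)"

text \<open>\<open>generation\<close> grows at the leaves, whereas \<open>count_paths\<close> cuts
  at the root.\<close>

lemma generation_Suc_first:
  "generation N (Suc n) \<omega> = (\<Union>i<N [] \<omega>. (#) i ` generation (\<lambda>u. N (i # u)) n \<omega>)"
proof (induction n)
  case 0
  then show ?case by auto
next
  case (Suc n)
  have "generation N (Suc (Suc n)) \<omega> = {u @ [j] | u j. u \<in> generation N (Suc n) \<omega> \<and> j < N u \<omega>}"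
    by simp
  also have "\<dots> = (\<Union>i<N [] \<omega>. (#) i ` {u @ [j] | u j. u \<in> generation (\<lambda>u. N (i # u)) n \<omega> \<and> j < N (i # u) \<omega>})"
    unfolding Suc by (auto simp: image_iff)
  finally show ?case by simp
qed

lemma position_Cons:
  "position D (i # u) \<omega> = D ([], i) \<omega> + position (\<lambda>(v, j). D (i # v, j)) u \<omega>"
  by (simp add: position_def sum.lessThan_Suc_shift del: sum.lessThan_Suc)

text \<open>The starting point and both families are arbitrary, because the induction passes to the
  subtree of a child started at the position of that child.\<close>

lemma card_generation:
  "card {u \<in> generation N n \<omega>. z + position D u \<omega> \<in> C} = count_at n C z (tree_of N D \<omega>)"
proof (induction n arbitrary: N D z)
  case 0
  have "{u \<in> generation N 0 \<omega>. z + position D u \<omega> \<in> C} = (if z \<in> C then {[]} else {})"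
    by (auto simp: position_def)
  then show ?case by simp
next
  case (Suc n)
  let ?N = "\<lambda>i u. N (i # u)" and ?D = "\<lambda>i (v, j). D (i # v, j)"
  have "{u \<in> generation N (Suc n) \<omega>. z + position D u \<omega> \<in> C} =
     (\<Union>i<N [] \<omega>. (#) i ` {u \<in> generation (?N i) n \<omega>. (z + D ([], i) \<omega>) + position (?D i) u \<omega> \<in> C})"
    unfolding generation_Suc_first by (auto simp: position_Cons add.assoc)
  also have "card \<dots> = (\<Sum>i<N [] \<omega>. card {u \<in> generation (?N i) n \<omega>. (z + D ([], i) \<omega>) + position (?D i) u \<omega> \<in> C})"
    by (subst card_UN_disjoint) (auto simp: finite_generation card_image)
  also have "\<dots> = (\<Sum>i<N [] \<omega>. count_at n C (z + D ([], i) \<omega>) (tree_of (?N i) (?D i) \<omega>))"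
    by (simp add: Suc)
  also have "\<dots> = count_at (Suc n) C z (tree_of N D \<omega>)"
  proof -
    have "tree_of (?N i) (?D i) \<omega> = subtree i (tree_of N D \<omega>)" for i
      by (auto simp: tree_of_def subtree_def shift_label_def fun_eq_iff split: sum.splits)
    then show ?thesis by (simp add: kids_def first_step_def tree_of_def)
  qed
  finally show ?case .
qed

lemma particles_eq_count_at: "particles N D n C \<omega> = count_at n C 0 (tree_of N D \<omega>)"
  using card_generation[of N n \<omega> 0 D C] by (simp add: particles_def)

lemma (in branching_random_walk) sets_step_law_eq: "sets \<mu> = sets borel"
  using displacement_law[of undefined] by (metis sets_distr)

lemma (in branching_random_walk) D_measurable: "D e \<in> borel_measurable M"
proof -
  have "case_sum (\<lambda>u \<omega>. real (N u \<omega>)) D (Inr e) \<in> borel_measurable M"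
    using indep unfolding indep_vars_def by blast
  then show ?thesis by simp
qed

lemma (in branching_random_walk) N_measurable: "N u \<in> measurable M (count_space UNIV)"
proof -
  have "case_sum (\<lambda>u \<omega>. real (N u \<omega>)) D (Inl u) \<in> borel_measurable M"
    using indep unfolding indep_vars_def by blast
  then have [measurable]: "(\<lambda>\<omega>. real (N u \<omega>)) \<in> borel_measurable M" by simp
  have "(\<lambda>\<omega>. nat \<lfloor>real (N u \<omega>)\<rfloor>) \<in> measurable M (count_space UNIV)"
    by measurable
  then show ?thesis by simp
qed

lemma (in branching_random_walk) prob_space_step: "prob_space \<mu>"
  using displacement_law[of undefined] prob_space_distr[OF D_measurable] by metis

lemma (in branching_random_walk) tree_of_measurable:
  "tree_of N D \<in> measurable M (PiM UNIV (\<lambda>_. borel))"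
proof -
  note [measurable] = N_measurable D_measurable
  have "(\<lambda>\<omega>. \<lambda>v\<in>UNIV. case_sum (\<lambda>u. real (N u \<omega>)) (\<lambda>e. D e \<omega>) v) \<in> measurable M (PiM UNIV (\<lambda>_. borel))"
  proof (rule measurable_restrict)
    show "(\<lambda>\<omega>. case_sum (\<lambda>u. real (N u \<omega>)) (\<lambda>e. D e \<omega>) v) \<in> borel_measurable M" for v
      by (cases v) auto
  qed
  then show ?thesis by (simp add: tree_of_def[abs_def] restrict_UNIV)
qed

text \<open>Joint independence determines the law of the whole labelled tree, so that all
  probabilities can be computed on the product space.\<close>

lemma (in branching_random_walk) distr_tree_of:
  "distr M (PiM UNIV (\<lambda>_. borel)) (tree_of N D) = tree_law p \<mu>"
proof -
  let ?X = "case_sum (\<lambda>u \<omega>. real (N u \<omega>)) D"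
  note [measurable] = N_measurable D_measurable
  have X: "?X v \<in> borel_measurable M" for v by (cases v) auto
  have eq: "(\<lambda>v. ?X v \<omega>) = tree_of N D \<omega>" for \<omega>
    by (auto simp: tree_of_def fun_eq_iff split: sum.splits)
  have "distr M (\<Pi>\<^sub>M v\<in>UNIV. borel) (\<lambda>\<omega>. \<lambda>v\<in>UNIV. ?X v \<omega>) = (\<Pi>\<^sub>M v\<in>UNIV. distr M borel (?X v))"
    using indep by (subst (asm) indep_vars_iff_distr_eq_PiM) (auto simp: X)
  moreover have "distr M borel (?X v) = coord_law p \<mu> v" for v
  proof (cases v)
    case (Inl u)
    have "distr M borel (?X v) = distr (distr M (count_space UNIV) (N u)) borel real"
      unfolding Inl by (subst distr_distr) (auto simp: comp_def)
    then show ?thesis by (simp add: Inl coord_law_def offspring_law)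
  qed (simp add: coord_law_def displacement_law)
  ultimately show ?thesis by (simp add: restrict_UNIV eq tree_law_def)
qed

context offspring_and_step_law
begin

lemma count_paths_measurable [measurable]:
  assumes "\<And>j. B j \<in> sets borel"
  shows "(\<lambda>(z, S). real (count_paths n B z S)) \<in> borel_measurable (borel \<Otimes>\<^sub>M tree_law p \<mu>)"
  using assms
proof (induction n arbitrary: B)
  case 0
  then have [measurable]: "B 0 \<in> sets borel" by blast
  show ?case unfolding count_paths.simps by measurable
next
  case (Suc n)
  let ?P = "borel \<Otimes>\<^sub>M tree_law p \<mu>"
  let ?f = "\<lambda>z S. real (count_paths n (\<lambda>j. B (Suc j)) z S)"
  have [measurable]: "B 0 \<in> sets borel" using Suc.prems by blast
  have f: "case_prod ?f \<in> borel_measurable ?P" by (rule Suc.IH) (rule Suc.prems)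
  have "(\<lambda>w. ?f (fst w + first_step (snd w) i) (subtree i (snd w))) \<in> borel_measurable ?P" for i
  proof -
    have "(\<lambda>w. case_prod ?f (fst w + first_step (snd w) i, subtree i (snd w))) \<in> borel_measurable ?P"
      by (rule measurable_compose[OF _ f]) measurable
    then show ?thesis by simp
  qed
  then have "(\<lambda>w. \<Sum>i<k. ?f (fst w + first_step (snd w) i) (subtree i (snd w))) \<in> borel_measurable ?P" for k
    by (rule borel_measurable_sum)
  then have "(\<lambda>w. \<Sum>i<kids (snd w). ?f (fst w + first_step (snd w) i) (subtree i (snd w))) \<in> borel_measurable ?P"
    by (rule measurable_compose_countable) measurable
  then have "(\<lambda>w. if fst w \<in> B 0 then (\<Sum>i<kids (snd w). ?f (fst w + first_step (snd w) i) (subtree i (snd w))) else 0) \<in> borel_measurable ?P"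
    by measurable
  also have "(\<lambda>w. if fst w \<in> B 0 then (\<Sum>i<kids (snd w). ?f (fst w + first_step (snd w) i) (subtree i (snd w))) else 0) =
     (\<lambda>(z, S). real (count_paths (Suc n) B z S))"
    by (auto simp: fun_eq_iff)
  finally show ?case .
qed

lemma count_paths_measurable_tree:
  assumes "\<And>j. B j \<in> sets borel"
  shows "(\<lambda>S. real (count_paths n B z S)) \<in> borel_measurable (tree_law p \<mu>)"
proof -
  have "(\<lambda>S. (\<lambda>(z, S). real (count_paths n B z S)) (z, S)) \<in> borel_measurable (tree_law p \<mu>)"
    by (rule measurable_compose[OF _ count_paths_measurable[OF assms]]) measurable
  then show ?thesis by simp
qed

lemma count_at_measurable [measurable]:
  assumes "C \<in> sets borel"
  shows "(\<lambda>(z, S). real (count_at n C z S)) \<in> borel_measurable (borel \<Otimes>\<^sub>M tree_law p \<mu>)"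
  unfolding count_at_def by (rule count_paths_measurable) (use assms in auto)

lemma count_at_measurable_tree [measurable]:
  assumes "C \<in> sets borel"
  shows "(\<lambda>S. real (count_at n C z S)) \<in> borel_measurable (tree_law p \<mu>)"
  unfolding count_at_def by (rule count_paths_measurable_tree) (use assms in auto)

text \<open>\<open>U\<close> is any function with values in [0, 1], in order to cover both Laplace
  transforms of counts and indicators of small counts.\<close>

lemma branching_real:
  assumes U: "(\<lambda>(z, S). U z S) \<in> borel_measurable (borel \<Otimes>\<^sub>M tree_law p \<mu>)"
    and U_bounds: "\<And>z S. 0 \<le> U z S" "\<And>z S. U z S \<le> (1 :: real)"
  shows "(\<integral>S. (\<Prod>i<kids S. U (z + first_step S i) (subtree i S)) \<partial>tree_law p \<mu>) =
     pgf p (\<integral>y. (\<integral>S. U (z + y) S \<partial>tree_law p \<mu>) \<partial>\<mu>)"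
    and "(\<lambda>z. \<integral>S. U z S \<partial>tree_law p \<mu>) \<in> borel_measurable borel"
    and "0 \<le> (\<integral>S. U z S \<partial>tree_law p \<mu>)" "(\<integral>S. U z S \<partial>tree_law p \<mu>) \<le> 1"
proof -
  let ?T = "tree_law p \<mu>"
  have U_T: "(\<lambda>S. U z S) \<in> borel_measurable ?T" for z
  proof -
    have "(\<lambda>S. case_prod U (z, S)) \<in> borel_measurable ?T"
      by (rule measurable_Pair2[OF U]) simp
    then show ?thesis by simp
  qed
  have int_U: "integrable ?T (\<lambda>S. U z S)" for z
    by (rule tree.integrable_const_bound[where B = 1]) (auto simp: U_T U_bounds)
  show meas: "(\<lambda>z. \<integral>S. U z S \<partial>?T) \<in> borel_measurable borel"
    by (rule tree.borel_measurable_lebesgue_integral) (rule U)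
  have shift_meas: "(\<lambda>y. \<integral>S. U (z + y) S \<partial>?T) \<in> borel_measurable \<mu>" for z
    by (rule borel_measurable_step, rule measurable_compose[where f = "\<lambda>y. z + y" and g = "\<lambda>z. \<integral>S. U z S \<partial>?T", OF _ meas]) simp
  show b1: "0 \<le> (\<integral>S. U z S \<partial>?T)" for z
    by (intro Bochner_Integration.integral_nonneg) (simp add: U_bounds)
  show b2: "(\<integral>S. U z S \<partial>?T) \<le> 1" for z
    by (intro tree.integral_le_const int_U) (simp add: U_bounds)
  have shift: "(\<lambda>(y, S). ennreal (U (z + y) S)) \<in> borel_measurable (borel \<Otimes>\<^sub>M ?T)"
  proof -
    have "(\<lambda>w. case_prod U (z + fst w, snd w)) \<in> borel_measurable (borel \<Otimes>\<^sub>M ?T)"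
      by (rule measurable_compose[where f = "\<lambda>w. (z + fst w, snd w)", OF _ U]) measurable
    then show ?thesis by (simp add: case_prod_unfold)
  qed
  have prod_meas: "(\<lambda>S. \<Prod>i<kids S. U (z + first_step S i) (subtree i S)) \<in> borel_measurable ?T"
  proof -
    have "(\<lambda>S. case_prod U (z + first_step S i, subtree i S)) \<in> borel_measurable ?T" for i
      by (rule measurable_compose[OF _ U]) measurable
    then have "(\<lambda>S. U (z + first_step S i) (subtree i S)) \<in> borel_measurable ?T" for i by simp
    then have "(\<lambda>S. \<Prod>i<k. U (z + first_step S i) (subtree i S)) \<in> borel_measurable ?T" for k
      by (rule borel_measurable_prod)
    then show ?thesis by (rule measurable_compose_countable) measurable
  qed
  have int_prod: "integrable ?T (\<lambda>S. \<Prod>i<kids S. U (z + first_step S i) (subtree i S))"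
    using prod_meas by (intro tree.integrable_const_bound[where B = 1])
      (auto simp: U_bounds prod_nonneg intro!: prod_le_1)
  have "ennreal (\<integral>S. (\<Prod>i<kids S. U (z + first_step S i) (subtree i S)) \<partial>?T) =
      (\<integral>\<^sup>+S. ennreal (\<Prod>i<kids S. U (z + first_step S i) (subtree i S)) \<partial>?T)"
    by (intro nn_integral_eq_integral[symmetric] int_prod) (auto simp: U_bounds prod_nonneg)
  also have "\<dots> = (\<integral>\<^sup>+S. (\<Prod>i<kids S. ennreal (U (z + first_step S i) (subtree i S))) \<partial>?T)"
    by (intro nn_integral_cong) (simp add: prod_ennreal U_bounds)
  also have "\<dots> = gen_fun p (\<integral>\<^sup>+y. \<integral>\<^sup>+S. ennreal (U (z + y) S) \<partial>?T \<partial>\<mu>)"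
    by (rule branching[OF shift])
  also have "(\<integral>\<^sup>+y. \<integral>\<^sup>+S. ennreal (U (z + y) S) \<partial>?T \<partial>\<mu>) = (\<integral>\<^sup>+y. ennreal (\<integral>S. U (z + y) S \<partial>?T) \<partial>\<mu>)"
    by (intro nn_integral_cong nn_integral_eq_integral int_U) (simp add: U_bounds)
  also have "\<dots> = ennreal (\<integral>y. (\<integral>S. U (z + y) S \<partial>?T) \<partial>\<mu>)"
  proof (intro nn_integral_eq_integral)
    show "integrable \<mu> (\<lambda>y. \<integral>S. U (z + y) S \<partial>?T)"
      by (rule integrable_const_bound[where B = 1]) (auto simp: b1 b2 shift_meas)
  qed (simp add: b1)
  also have "gen_fun p \<dots> = ennreal (pgf p (\<integral>y. (\<integral>S. U (z + y) S \<partial>?T) \<partial>\<mu>))"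
  proof (rule gen_fun_eq_pgf)
    show "0 \<le> (\<integral>y. (\<integral>S. U (z + y) S \<partial>?T) \<partial>\<mu>)"
      by (rule Bochner_Integration.integral_nonneg) (simp add: b1)
    show "(\<integral>y. (\<integral>S. U (z + y) S \<partial>?T) \<partial>\<mu>) \<le> 1"
      by (intro integral_le_const integrable_const_bound[where B = 1]) (auto simp: b1 b2 shift_meas)
  qed
  finally show "(\<integral>S. (\<Prod>i<kids S. U (z + first_step S i) (subtree i S)) \<partial>?T) =
     pgf p (\<integral>y. (\<integral>S. U (z + y) S \<partial>?T) \<partial>\<mu>)"
    by (subst (asm) ennreal_inj)
       (use U_bounds b1 in \<open>auto intro!: pgf_nonneg Bochner_Integration.integral_nonneg prod_nonneg\<close>)
qed

end

section \<open>Survival lower bound\<close>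

locale supercritical_brw = unbounded_step_law \<mu> for \<mu> +
  fixes p :: "nat pmf" and m :: real
  assumes no_death: "pmf p 0 = 0"
    and integrable_offspring: "integrable (measure_pmf p) real"
    and mean_offspring_eq: "(\<integral>k. real k \<partial>measure_pmf p) = m"
    and mean_gt_1: "1 < m"
begin

sublocale offspring_and_step_law \<mu> p by unfold_locales

text \<open>As 0^0 = 1, the value \<open>s = 0\<close> gives the probability that no particle of
  generation \<open>k\<close> is in \<open>C\<close>; \<open>s = exp (- l)\<close> gives the Laplace
  transform of the count.\<close>

definition count_pgf :: "real \<Rightarrow> nat \<Rightarrow> real set \<Rightarrow> real \<Rightarrow> real" where
  "count_pgf s k C z = (\<integral>S. s ^ count_at k C z S \<partial>tree_law p \<mu>)"

definition prob_below :: "real \<Rightarrow> nat \<Rightarrow> real set \<Rightarrow> real \<Rightarrow> real" where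
  "prob_below K k C z = (\<integral>S. of_bool (real (count_at k C z S) < K) \<partial>tree_law p \<mu>)"

lemma count_at_function_measurable:
  fixes f :: "nat \<Rightarrow> real"
  assumes "C \<in> sets borel"
  shows "(\<lambda>(z, S). f (count_at k C z S)) \<in> borel_measurable (borel \<Otimes>\<^sub>M tree_law p \<mu>)"
proof -
  have "(\<lambda>w. f (nat \<lfloor>(\<lambda>(z, S). real (count_at k C z S)) w\<rfloor>)) \<in> borel_measurable (borel \<Otimes>\<^sub>M tree_law p \<mu>)"
    by (rule measurable_compose[OF count_at_measurable[OF assms, of k], where g = "\<lambda>r. f (nat \<lfloor>r\<rfloor>)"]) measurable
  then show ?thesis by (simp add: case_prod_unfold)
qed

lemma count_at_function_measurable_tree:
  fixes f :: "nat \<Rightarrow> real"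
  assumes "C \<in> sets borel"
  shows "(\<lambda>S. f (count_at k C z S)) \<in> borel_measurable (tree_law p \<mu>)"
proof -
  have "(\<lambda>S. f (nat \<lfloor>real (count_at k C z S)\<rfloor>)) \<in> borel_measurable (tree_law p \<mu>)"
    by (rule measurable_compose[OF count_at_measurable_tree[OF assms, of k z], where g = "\<lambda>r. f (nat \<lfloor>r\<rfloor>)"]) measurable
  then show ?thesis by simp
qed

text \<open>\<open>u k z\<close> plays the role of a failure probability after \<open>k\<close>
  generations from \<open>z\<close>. Only an inequality is demanded, since \<open>prob_below\<close>
  need not satisfy the equation.\<close>

definition pgf_subsolution :: "(nat \<Rightarrow> real \<Rightarrow> real) \<Rightarrow> bool" where
  "pgf_subsolution u \<longleftrightarrow> (\<forall>k. u k \<in> borel_measurable borel) \<and> (\<forall>k z. 0 \<le> u k z \<and> u k z \<le> 1) \<and>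
     (\<forall>k z. u (Suc k) z \<le> pgf p (\<integral>y. u k (z + y) \<partial>\<mu>))"

lemma count_pgf_Suc:
  assumes "0 \<le> s" "s \<le> 1" "C \<in> sets borel"
  shows "count_pgf s (Suc k) C z = pgf p (\<integral>y. count_pgf s k C (z + y) \<partial>\<mu>)"
  unfolding count_pgf_def count_at_Suc power_sum
  by (rule branching_real(1)[OF count_at_function_measurable[OF assms(3)]])
     (use assms in \<open>auto simp: power_le_one\<close>)

lemma pgf_subsolution_count_pgf:
  assumes "0 \<le> s" "s \<le> 1" "C \<in> sets borel"
  shows "pgf_subsolution (\<lambda>k. count_pgf s k C)"
proof -
  note * = branching_real(2-4)[where U = "\<lambda>z S. s ^ count_at _ C z S", OF count_at_function_measurable[OF assms(3)]]
  show ?thesis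
    unfolding pgf_subsolution_def
    using assms * by (auto simp: count_pgf_Suc power_le_one) (auto simp: count_pgf_def[abs_def] power_le_one)
qed

text \<open>If the total is below \<open>K\<close>, so is the contribution of every child. The
  offset \<open>k\<close> lets the later phase provide the initial value of the earlier one.\<close>

lemma pgf_subsolution_prob_below:
  assumes "C \<in> sets borel"
  shows "pgf_subsolution (\<lambda>i. prob_below K (k + i) C)"
proof -
  note * = branching_real[where U = "\<lambda>z S. of_bool (real (count_at _ C z S) < K)", OF count_at_function_measurable[OF assms]]
  have "prob_below K (Suc j) C z \<le> pgf p (\<integral>y. prob_below K j C (z + y) \<partial>\<mu>)" for j z
  proof -
    have meas: "(\<lambda>S. \<Prod>i<kids S. of_bool (real (count_at j C (z + first_step S i) (subtree i S)) < K) :: real) \<in> borel_measurable (tree_law p \<mu>)"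
    proof -
      have "(\<lambda>S. case_prod (\<lambda>z S. of_bool (real (count_at j C z S) < K) :: real) (z + first_step S i, subtree i S)) \<in> borel_measurable (tree_law p \<mu>)" for i
        by (rule measurable_compose[where f = "\<lambda>S. (z + first_step S i, subtree i S)", OF _ count_at_function_measurable[OF assms]]) measurable
      then have "(\<lambda>S. of_bool (real (count_at j C (z + first_step S i) (subtree i S)) < K) :: real) \<in> borel_measurable (tree_law p \<mu>)" for i
        by simp
      then have "(\<lambda>S. \<Prod>i<n. of_bool (real (count_at j C (z + first_step S i) (subtree i S)) < K) :: real) \<in> borel_measurable (tree_law p \<mu>)" for n
        by (rule borel_measurable_prod)
      then show ?thesis by (rule measurable_compose_countable) measurable
    qed
    have le: "of_bool (real (count_at (Suc j) C z S) < K) \<le> (\<Prod>i<kids S. of_bool (real (count_at j C (z + first_step S i) (subtree i S)) < K) :: real)" for S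
    proof (cases "real (count_at (Suc j) C z S) < K")
      case True
      have "real (count_at j C (z + first_step S i) (subtree i S)) < K" if "i < kids S" for i
      proof -
        have "count_at j C (z + first_step S i) (subtree i S) \<le> count_at (Suc j) C z S"
          unfolding count_at_Suc using that by (intro member_le_sum) auto
        then show ?thesis using True by (meson of_nat_le_iff order.strict_trans1)
      qed
      then show ?thesis by simp
    qed (simp add: prod_nonneg)
    have "prob_below K (Suc j) C z \<le> (\<integral>S. (\<Prod>i<kids S. of_bool (real (count_at j C (z + first_step S i) (subtree i S)) < K)) \<partial>tree_law p \<mu>)"
      unfolding prob_below_def
    proof (rule integral_mono)
      show "integrable (tree_law p \<mu>) (\<lambda>S. of_bool (real (count_at (Suc j) C z S) < K) :: real)"
        using count_at_function_measurable_tree[OF assms, of "\<lambda>n. of_bool (real n < K)"]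
        by (intro tree.integrable_const_bound[where B = 1]) (simp_all del: count_at_Suc)
      show "integrable (tree_law p \<mu>) (\<lambda>S. \<Prod>i<kids S. of_bool (real (count_at j C (z + first_step S i) (subtree i S)) < K) :: real)"
        using meas by (intro tree.integrable_const_bound[where B = 1]) (auto simp: prod_nonneg intro!: prod_le_1)
    qed (rule le)
    also have "\<dots> = pgf p (\<integral>y. prob_below K j C (z + y) \<partial>\<mu>)"
      unfolding prob_below_def by (rule *(1)) auto
    finally show ?thesis .
  qed
  then show ?thesis
    unfolding pgf_subsolution_def using * by (auto simp: prob_below_def[abs_def])
qed

context
  fixes u :: "nat \<Rightarrow> real \<Rightarrow> real"
  assumes u: "pgf_subsolution u"
begin

lemma integrable_sub: "integrable \<mu> (\<lambda>y. u k (z + y))"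
proof (rule integrable_const_bound[where B = 1])
  have [measurable]: "u k \<in> borel_measurable borel" using u by (simp add: pgf_subsolution_def)
  show "(\<lambda>y. u k (z + y)) \<in> borel_measurable \<mu>" by measurable
qed (use u in \<open>auto simp: pgf_subsolution_def\<close>)

text \<open>Monotonicity of the generating function: a lower bound \<open>T\<close> for the mean of
  \<open>1 - u\<close> after one step passes to the next generation.\<close>

lemma one_minus_sub_Suc:
  assumes T: "0 \<le> T" "T \<le> (\<integral>y. 1 - u k (z + y) \<partial>\<mu>)"
  shows "1 - pgf p (1 - T) \<le> 1 - u (Suc k) z" "T \<le> 1"
proof -
  have "0 \<le> (\<integral>y. u k (z + y) \<partial>\<mu>)"
    using u by (intro Bochner_Integration.integral_nonneg) (auto simp: pgf_subsolution_def)
  moreover have "(\<integral>y. 1 - u k (z + y) \<partial>\<mu>) = 1 - (\<integral>y. u k (z + y) \<partial>\<mu>)"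
    using integrable_sub[of k z] by (simp add: prob_space[simplified])
  ultimately have "pgf p (\<integral>y. u k (z + y) \<partial>\<mu>) \<le> pgf p (1 - T)" "T \<le> 1"
    using T by (auto intro!: pgf_mono)
  moreover have "u (Suc k) z \<le> pgf p (\<integral>y. u k (z + y) \<partial>\<mu>)"
    using u by (simp add: pgf_subsolution_def)
  ultimately show "1 - pgf p (1 - T) \<le> 1 - u (Suc k) z" "T \<le> 1"
    by linarith+
qed

text \<open>Follow one child per generation, which exists because \<open>p\<close> does not charge
  0, and never let it step down: each generation costs a factor P(X \<ge> 0).\<close>

lemma sub_wait:
  assumes v: "0 \<le> v" "\<And>z. z \<ge> b \<Longrightarrow> v \<le> 1 - u k z" and z: "z \<ge> b"
  shows "v * measure \<mu> {0..} ^ r \<le> 1 - u (k + r) z"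
  using z
proof (induction r arbitrary: z)
  case 0
  then show ?case using v by simp
next
  case (Suc r)
  let ?T = "v * measure \<mu> {0..} ^ r * measure \<mu> {0..}"
  have "?T = (\<integral>y. v * measure \<mu> {0..} ^ r * indicator {0..} y \<partial>\<mu>)" by simp
  also have "\<dots> \<le> (\<integral>y. 1 - u (k + r) (z + y) \<partial>\<mu>)"
  proof (rule integral_mono)
    show "integrable \<mu> (\<lambda>y. 1 - u (k + r) (z + y))" using integrable_sub by simp
    show "v * measure \<mu> {0..} ^ r * indicator {0..} y \<le> 1 - u (k + r) (z + y)" for y
      using Suc u by (auto simp: indicator_def pgf_subsolution_def)
    show "integrable \<mu> (\<lambda>y. v * measure \<mu> {0..} ^ r * indicator {0..} y)"
      by (intro integrable_mult_right integrable_real_indicator) (auto simp: emeasure_eq_measure)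
  qed
  finally have T: "?T \<le> (\<integral>y. 1 - u (k + r) (z + y) \<partial>\<mu>)" .
  have T0: "0 \<le> ?T" using v by simp
  have "?T \<le> 1 - pgf p (1 - ?T)"
    using pgf_le_self[OF no_death, of "1 - ?T"] T0 one_minus_sub_Suc(2)[OF T0 T] by simp
  also have "\<dots> \<le> 1 - u (Suc (k + r)) z" by (rule one_minus_sub_Suc[OF T0 T])
  finally show ?case by (simp add: mult_ac)
qed

text \<open>While the lower bound is at most \<eta>, a generation multiplies it by \<open>q\<close>
  and convolves it with the step law; \<open>i\<close> generations produce \<open>q ^ i\<close>
  times a tail of the random walk.\<close>

lemma sub_block:
  assumes q: "0 \<le> q" "q \<le> m"
    and \<eta>: "\<eta> \<le> 1" "\<And>w. 0 \<le> w \<Longrightarrow> w \<le> \<eta> \<Longrightarrow> q * w \<le> 1 - pgf p (1 - w)"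
    and v: "0 \<le> v" "v * m ^ l \<le> \<eta>" "\<And>z. z \<ge> b \<Longrightarrow> v \<le> 1 - u k z" and i: "i \<le> l"
  shows "v * q ^ i * walk_tail \<mu> i (b - z) \<le> 1 - u (k + i) z"
  using i
proof (induction i arbitrary: z)
  case 0
  show ?case using v(3) u by (auto simp: pgf_subsolution_def)
next
  case (Suc i)
  let ?T = "v * q ^ i * walk_tail \<mu> (Suc i) (b - z)"
  have T0: "0 \<le> ?T" using v q by (intro mult_nonneg_nonneg walk_tail_nonneg) auto
  have "?T = (\<integral>y. v * q ^ i * walk_tail \<mu> i (b - z - y) \<partial>\<mu>)"
    using integrable_walk_tail[of i "b - z"] by simp
  also have "\<dots> \<le> (\<integral>y. 1 - u (k + i) (z + y) \<partial>\<mu>)"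
  proof (rule integral_mono)
    show "integrable \<mu> (\<lambda>y. 1 - u (k + i) (z + y))" using integrable_sub by simp
    show "integrable \<mu> (\<lambda>y. v * q ^ i * walk_tail \<mu> i (b - z - y))" using integrable_walk_tail by simp
    show "v * q ^ i * walk_tail \<mu> i (b - z - y) \<le> 1 - u (k + i) (z + y)" for y
      using Suc.IH[of "z + y"] Suc.prems by (simp add: diff_diff_eq)
  qed
  finally have T: "?T \<le> (\<integral>y. 1 - u (k + i) (z + y) \<partial>\<mu>)" .
  \<comment> \<open>Inside the block the bound never exceeds \<open>v * m ^ l\<close> \<le> \<eta>,
    so the linearisation applies at each step.\<close>
  have "q ^ i \<le> m ^ i" using q by (intro power_mono) auto
  also have "\<dots> \<le> m ^ l" using Suc.prems mean_gt_1 by (intro power_increasing) auto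
  finally have "v * q ^ i \<le> v * m ^ l" using v by (intro mult_left_mono) auto
  then have "v * q ^ i \<le> \<eta>" using v by simp
  moreover have "?T \<le> v * q ^ i * 1"
    using v q by (intro mult_left_mono walk_tail_le_1) auto
  ultimately have "q * ?T \<le> 1 - pgf p (1 - ?T)" by (intro \<eta> T0) simp
  also have "\<dots> \<le> 1 - u (Suc (k + i)) z" by (rule one_minus_sub_Suc[OF T0 T])
  finally show ?case by (simp add: mult_ac)
qed

end

text \<open>Blocks of one fixed length are concatenated, and before each of them the lower bound is
  cut down to a cap; this is the origin of the minimum with 1. \<open>\<kappa>\<close> and
  \<open>R\<close> do not depend on \<open>u\<close>, \<open>v\<close>, \<open>b\<close> and
  \<open>k\<close>, which will vary with \<open>n\<close>.\<close>

lemma survival_lower_bound: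
  assumes c: "c > 0" and \<gamma>: "\<gamma> > rate \<mu> c - ln m"
  obtains \<kappa> R where "\<kappa> > 0"
    "\<And>u v b k z. pgf_subsolution u \<Longrightarrow> 0 \<le> v \<Longrightarrow> v \<le> 1 \<Longrightarrow> (\<And>z. z \<ge> b \<Longrightarrow> v \<le> 1 - u 0 z) \<Longrightarrow>
       z \<ge> b - c * real k + R \<Longrightarrow> \<kappa> * min (v * exp (- \<gamma> * real k)) 1 \<le> 1 - u k z"
proof -
  \<comment> \<open>One half of this slack goes into Cramer's bound, the other into replacing
    \<open>m\<close> by the smaller \<open>q\<close>.\<close>
  define e where "e = \<gamma> - (rate \<mu> c - ln m)"
  have e: "e > 0" using \<gamma> by (simp add: e_def)
  obtain l where l: "l > 0" "exp (- (rate \<mu> c + e / 2) * real l) \<le> walk_tail \<mu> l (c * real l)"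
    using cramer_lower[OF c, of "e / 2"] e by auto
  define q where "q = m * exp (- (e / 2))"
  have m0: "m > 0" using mean_gt_1 by simp
  have q: "0 < q" "q < m" using m0 e by (auto simp: q_def)
  obtain \<eta> where \<eta>: "0 < \<eta>" "\<eta> \<le> 1" "\<And>w. 0 \<le> w \<Longrightarrow> w \<le> \<eta> \<Longrightarrow> q * w \<le> 1 - pgf p (1 - w)"
    using one_minus_pgf_ge[OF integrable_offspring mean_offspring_eq, of "m - q"] q by auto
  \<comment> \<open>A bound of at most \<open>\<eta>'\<close> at the start of a block is at most
    \<eta> at its end, even with the full growth \<open>m\<close> per generation.\<close>
  define \<eta>' where "\<eta>' = \<eta> / m ^ l"
  have \<eta>': "0 < \<eta>'" using \<eta> m0 by (simp add: \<eta>'_def)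
  \<comment> \<open>The factor guaranteed by a whole block; it may lie on either side of 1.\<close>
  define \<rho> where "\<rho> = exp (- \<gamma> * real l)"
  have \<rho>: "\<rho> \<le> q ^ l * walk_tail \<mu> l (c * real l)"
  proof -
    have "\<rho> = exp (real l * (ln m - e / 2)) * exp (- (rate \<mu> c + e / 2) * real l)"
      by (simp add: \<rho>_def e_def exp_add[symmetric] algebra_simps)
    also have "exp (real l * (ln m - e / 2)) = q ^ l"
      using m0 by (simp only: exp_of_nat_mult q_def exp_diff exp_ln exp_minus divide_inverse)
    also have "q ^ l * exp (- (rate \<mu> c + e / 2) * real l) \<le> q ^ l * walk_tail \<mu> l (c * real l)"
      using q by (intro mult_left_mono l(2)) auto
    finally show ?thesis .
  qed
  let ?s = "measure \<mu> {0..}"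
  have s: "0 < ?s" "?s \<le> 1"
  proof -
    have "0 < measure \<mu> {0<..}" by (rule unbounded_above)
    also have "\<dots> \<le> ?s" by (intro finite_measure_mono) auto
    finally show "0 < ?s" .
  qed simp
  have blocks: "\<eta>' * min (\<rho> ^ j * v) 1 \<le> 1 - u (r + j * l) z"
    if u: "pgf_subsolution u" and v: "0 \<le> v" "v \<le> 1" "\<And>z. z \<ge> b \<Longrightarrow> v \<le> 1 - u r z"
      and z: "z \<ge> b - c * real l * real j" for u v b r j z
    using z
  proof (induction j arbitrary: z)
    case 0
    have "\<eta>' \<le> 1" using \<eta> mean_gt_1 by (simp add: \<eta>'_def field_simps) (meson less_eq_real_def one_le_power order_trans)
    then have "\<eta>' * v \<le> 1 * v" using v by (intro mult_right_mono)
    then show ?case using v(2) v(3)[of z] 0 by (simp add: min_def)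
  next
    case (Suc j)
    let ?v = "\<eta>' * min (\<rho> ^ j * v) 1" and ?b = "b - c * real l * real j"
    have v0: "0 \<le> min (\<rho> ^ j * v) 1" using v by (simp add: \<rho>_def)
    \<comment> \<open>For \<rho> \<le> 1 the cap is inactive; for \<rho> > 1 a value cut down to 1
      exceeds 1 again after the block.\<close>
    have "min (\<rho> ^ Suc j * v) 1 \<le> \<rho> * min (\<rho> ^ j * v) 1"
    proof (cases "\<rho> \<le> 1")
      case True
      have "\<rho> ^ i * v \<le> 1" for i
        using True v by (intro mult_le_one power_le_one) (auto simp: \<rho>_def)
      then show ?thesis by (simp add: min_absorb1 mult_ac)
    next
      case False
      then show ?thesis
        by (cases "\<rho> ^ j * v \<le> 1") (auto simp: min_absorb1 min_absorb2 min.coboundedI1 min.coboundedI2 mult_ac)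
    qed
    then have "\<eta>' * min (\<rho> ^ Suc j * v) 1 \<le> \<eta>' * (\<rho> * min (\<rho> ^ j * v) 1)"
      using \<eta>' by (intro mult_left_mono) auto
    also have "\<dots> = ?v * \<rho>" by (simp add: mult_ac)
    also have "\<dots> \<le> ?v * (q ^ l * walk_tail \<mu> l (c * real l))"
      using \<rho> \<eta>' v0 by (intro mult_left_mono) auto
    also have "\<dots> \<le> ?v * (q ^ l * walk_tail \<mu> l (?b - z))"
    proof (intro mult_left_mono walk_tail_antimono)
      show "?b - z \<le> c * real l" using Suc.prems by (simp add: algebra_simps)
    qed (use q \<eta>' v0 in auto)
    also have "\<dots> = ?v * q ^ l * walk_tail \<mu> l (?b - z)" by (simp add: mult_ac)
    also have "\<dots> \<le> 1 - u (r + j * l + l) z"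
    proof (rule sub_block[OF u])
      show "?v * m ^ l \<le> \<eta>"
      proof -
        have "?v \<le> \<eta>' * 1" using \<eta>' by (intro mult_left_mono) auto
        then have "?v * m ^ l \<le> \<eta>' * m ^ l" using m0 by (intro mult_right_mono) auto
        then show ?thesis using m0 by (simp add: \<eta>'_def)
      qed
      show "0 \<le> ?v" using \<eta>' v0 by simp
    qed (use q \<eta> Suc.IH in auto)
    finally show ?case by (simp add: add_ac)
  qed
  \<comment> \<open>Pays for fewer than \<open>l\<close> waiting steps and for their share of
    \<open>exp (- \<gamma> * k)\<close>, whatever the sign of \<gamma>.\<close>
  define \<kappa> where "\<kappa> = \<eta>' * ?s ^ l * exp (- \<bar>\<gamma>\<bar> * real l)"
  have "\<kappa> > 0" using \<eta>' s by (simp add: \<kappa>_def)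
  moreover have "\<kappa> * min (v * exp (- \<gamma> * real k)) 1 \<le> 1 - u k z"
    if u: "pgf_subsolution u" and v: "0 \<le> v" "v \<le> 1" "\<And>z. z \<ge> b \<Longrightarrow> v \<le> 1 - u 0 z"
      and z: "z \<ge> b - c * real k + c * real l" for u v b k z
  proof -
    \<comment> \<open>The first \<open>r\<close> steps of the recursion are spent waiting, the rest
      are \<open>j\<close> full blocks. Waiting gains no height, which the summand
      \<open>c * l\<close> in the condition on \<open>z\<close> makes up for.\<close>
    define r j where "r = k mod l" and "j = k div l"
    have k: "k = r + j * l" and r: "r < l" using l(1) by (auto simp: r_def j_def)
    have start: "v * ?s ^ r \<le> 1 - u r z" if "z \<ge> b" for z
      using sub_wait[OF u v(1) v(3) that, of r] by simp
    have sr: "?s ^ l \<le> ?s ^ r" "?s ^ r \<le> 1" "0 \<le> ?s ^ l"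
      using s r by (auto intro: power_decreasing power_le_one)
    have "c * real r \<le> c * real l" using c r by (intro mult_left_mono) auto
    then have z': "z \<ge> b - c * real l * real j"
      using z unfolding k by (simp add: algebra_simps)
    have exp_le: "exp (- \<gamma> * real k) * exp (- \<bar>\<gamma>\<bar> * real l) \<le> \<rho> ^ j"
    proof -
      have "- \<gamma> * real r \<le> \<bar>\<gamma>\<bar> * real r" by (intro mult_right_mono) auto
      also have "\<dots> \<le> \<bar>\<gamma>\<bar> * real l" using r by (intro mult_left_mono) auto
      finally show ?thesis
        unfolding \<rho>_def k by (simp add: exp_of_nat_mult[symmetric] exp_add[symmetric] algebra_simps)
    qed
    let ?f = "?s ^ l * exp (- \<bar>\<gamma>\<bar> * real l)"
    have f: "0 \<le> ?f" "?f \<le> 1" using sr s by (auto intro!: mult_le_one power_le_one)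
    have "?f * min (v * exp (- \<gamma> * real k)) 1 \<le> min (\<rho> ^ j * (v * ?s ^ r)) 1"
    proof (rule min.boundedI)
      have "?f * min (v * exp (- \<gamma> * real k)) 1 \<le> ?f * (v * exp (- \<gamma> * real k))"
        using f by (intro mult_left_mono) auto
      also have "\<dots> = (exp (- \<gamma> * real k) * exp (- \<bar>\<gamma>\<bar> * real l)) * (v * ?s ^ l)" by (simp add: mult_ac)
      also have "\<dots> \<le> \<rho> ^ j * (v * ?s ^ r)"
        using v sr exp_le by (intro mult_mono) (auto simp: \<rho>_def)
      finally show "?f * min (v * exp (- \<gamma> * real k)) 1 \<le> \<rho> ^ j * (v * ?s ^ r)" .
      show "?f * min (v * exp (- \<gamma> * real k)) 1 \<le> 1"
        by (rule mult_le_one[OF f(2)]) (use v in auto)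
    qed
    then have "\<eta>' * (?f * min (v * exp (- \<gamma> * real k)) 1) \<le> \<eta>' * min (\<rho> ^ j * (v * ?s ^ r)) 1"
      using \<eta>' by (intro mult_left_mono) auto
    also have "\<dots> \<le> 1 - u (r + j * l) z"
      using v s sr by (intro blocks[OF u _ _ start z']) (auto intro: mult_le_one)
    finally show ?thesis by (simp add: \<kappa>_def k mult_ac)
  qed
  ultimately show thesis by (rule that)
qed

end

section \<open>The variational problem\<close>

context unbounded_step_law
begin

text \<open>Joint convexity of the perspective of a convex function; it is behind both the concavity
  of \<open>growth\<close> and the convexity of \<open>cost\<close>.\<close>

lemma perspective_convex:
  assumes "s > 0" "t > 0" "0 \<le> u" "u \<le> 1"
  shows "((1 - u) * s + u * t) * rate \<mu> (((1 - u) * y + u * z) / ((1 - u) * s + u * t))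
    \<le> (1 - u) * (s * rate \<mu> (y / s)) + u * (t * rate \<mu> (z / t))"
proof -
  let ?S = "(1 - u) * s + u * t"
  have S: "?S > 0" using assms by (cases "u = 0") (auto intro: add_nonneg_pos)
  let ?b = "u * t / ?S"
  have b: "0 \<le> ?b" "1 - ?b = (1 - u) * s / ?S" using S assms by (auto simp: field_simps)
  then have "?b \<le> 1" using assms S by (simp add: field_simps)
  moreover have "((1 - u) * y + u * z) / ?S = (1 - ?b) * (y / s) + ?b * (z / t)"
    unfolding b(2) using assms S by (simp add: add_divide_distrib)
  ultimately have "rate \<mu> (((1 - u) * y + u * z) / ?S) \<le> (1 - ?b) * rate \<mu> (y / s) + ?b * rate \<mu> (z / t)"
    using convex_onD[OF convex_on_rate, of ?b "y / s" "z / t"] b(1) by simp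
  then have "?S * rate \<mu> (((1 - u) * y + u * z) / ?S) \<le> ?S * ((1 - ?b) * rate \<mu> (y / s) + ?b * rate \<mu> (z / t))"
    using S by (intro mult_left_mono) auto
  also have "\<dots> = (1 - u) * (s * rate \<mu> (y / s)) + u * (t * rate \<mu> (z / t))"
    unfolding b(2) using S by (simp add: distrib_left)
  finally show ?thesis .
qed

end

text \<open>The last bound on \<open>a\<close> says that \<open>growth 0 0\<close>, which is
  \<open>ln m - rate \<mu> x\<close>, lies below \<open>a\<close>: the level is not reached by
  typical growth from the origin.\<close>

locale level_problem = unbounded_step_law +
  fixes m a x :: real
  assumes m: "1 < m" and a: "0 < a" "a < ln m" "ln m - rate \<mu> x < a" and x: "0 < x"
begin

definition growth :: "real \<Rightarrow> real \<Rightarrow> real" where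
  "growth s y = (1 - s) * (ln m - rate \<mu> ((x - y) / (1 - s)))"

definition cost :: "real \<Rightarrow> real \<Rightarrow> real" where
  "cost s y = s * rate \<mu> (y / s) - s * ln m"

lemma ln_m: "ln m > 0" using m by simp

lemma growth_concave:
  assumes "s < 1" "t < 1" "0 \<le> u" "u \<le> 1"
  shows "(1 - u) * growth s y + u * growth t z \<le> growth ((1 - u) * s + u * t) ((1 - u) * y + u * z)"
proof -
  have 1: "1 - ((1 - u) * s + u * t) = (1 - u) * (1 - s) + u * (1 - t)"
    and 2: "x - ((1 - u) * y + u * z) = (1 - u) * (x - y) + u * (x - z)"
    by (simp_all add: algebra_simps)
  show ?thesis
    using perspective_convex[of "1 - s" "1 - t" u "x - y" "x - z"] assms
    unfolding growth_def 1 2 by (simp add: algebra_simps)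
qed

lemma cost_convex:
  assumes "s > 0" "t > 0" "0 \<le> u" "u \<le> 1"
  shows "cost ((1 - u) * s + u * t) ((1 - u) * y + u * z) \<le> (1 - u) * cost s y + u * cost t z"
  using perspective_convex[OF assms, of y z] unfolding cost_def by (simp add: algebra_simps)

text \<open>Convexity of the rate function on the broken line from 0 through \<open>y\<close> at
  time \<open>s\<close> to \<open>x\<close> at time 1: growth beyond \<open>growth 0 0\<close> has
  to be paid for. This makes the level rate positive.\<close>

lemma growth_le_cost:
  assumes "0 < s" "s < 1"
  shows "growth s y \<le> ln m - rate \<mu> x + cost s y"
proof -
  have "rate \<mu> x = rate \<mu> ((1 - s) *\<^sub>R ((x - y) / (1 - s)) + s *\<^sub>R (y / s))"
    using assms by simp
  also have "\<dots> \<le> (1 - s) * rate \<mu> ((x - y) / (1 - s)) + s * rate \<mu> (y / s)"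
    using assms by (intro convex_onD[OF convex_on_rate]) auto
  finally show ?thesis by (simp add: growth_def cost_def algebra_simps)
qed

lemma growth_nonpos_less:
  assumes "0 < s" "s < 1" "y \<le> 0"
  shows "growth s y < ln m - rate \<mu> x"
proof -
  have "rate \<mu> (y / s) = 0" using assms by (intro rate_nonpos_eq_0) (simp add: divide_nonpos_pos)
  then have "cost s y < 0" using assms ln_m by (simp add: cost_def)
  then show ?thesis using growth_le_cost[OF assms(1,2), of y] by simp
qed

lemma growth_le: "s < 1 \<Longrightarrow> growth s y \<le> (1 - s) * ln m"
  unfolding growth_def by (intro mult_left_mono) (auto simp: rate_nonneg)

lemma growth_x: "s < 1 \<Longrightarrow> growth s x = (1 - s) * ln m"
  by (simp add: growth_def rate_nonpos_eq_0)

lemma cost_mono: "0 < s \<Longrightarrow> y \<le> z \<Longrightarrow> cost s y \<le> cost s z"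
  unfolding cost_def by (auto intro!: mult_left_mono rate_mono divide_right_mono)

lemma continuous_on_growth: "continuous_on S (growth s)"
proof -
  have "continuous_on S (\<lambda>y. rate \<mu> ((x - y) / (1 - s)))"
    by (rule continuous_on_compose2[OF continuous_on_rate[of UNIV]])
       (auto intro!: continuous_intros simp: divide_inverse)
  then show ?thesis unfolding growth_def by (intro continuous_intros)
qed

text \<open>The constraint of \<open>level_rate\<close> in terms of \<open>growth\<close>; the bound
  \<open>s\<close> \<le> \<open>1 - a / ln m\<close> is implied, because growth is at most
  \<open>(1 - s) * ln m\<close>.\<close>

definition feasible :: "real \<Rightarrow> real \<Rightarrow> bool" where
  "feasible s y \<longleftrightarrow> 0 < s \<and> s < 1 \<and> 0 < y \<and> y \<le> x \<and> growth s y = a"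

lemma level_rate_eq:
  "level_rate \<mu> m a x = Inf {ereal (cost s y) | s y. feasible s y}"
proof -
  have "feasible s y \<longleftrightarrow> s \<in> {0<..1 - a / ln m} \<and> y \<in> {0<..x} \<and>
      ereal (ln m) - step_rate \<mu> ((x - y) / (1 - s)) = ereal (a / (1 - s))" for s y
  proof -
    have "s < 1" if "s \<le> 1 - a / ln m" using that a ln_m by (smt (verit) divide_pos_pos)
    moreover have "s \<le> 1 - a / ln m" if "s < 1" "growth s y = a"
      using growth_le[OF that(1), of y] that(2) ln_m by (simp add: field_simps)
    moreover have "growth s y = a \<longleftrightarrow> ln m - rate \<mu> ((x - y) / (1 - s)) = a / (1 - s)" if "s < 1"
      using that by (auto simp: growth_def field_simps)
    ultimately show ?thesis
      unfolding feasible_def step_rate_eq by auto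
  qed
  then show ?thesis
    unfolding level_rate_def by (simp add: cost_def step_rate_eq)
qed

text \<open>Lowering \<open>y\<close> lowers growth and cost, and the intermediate value theorem
  finds the height of growth exactly \<open>a\<close>. Going above \<open>x\<close> gains nothing,
  as growth is already maximal at \<open>x\<close>.\<close>

lemma feasible_below:
  assumes s: "0 < s" "s < 1" and g: "growth s y \<ge> a"
  obtains z where "feasible s z" "cost s z \<le> cost s y"
proof -
  have y: "y > 0"
    using growth_nonpos_less[OF s, of y] g a by (cases "y > 0") auto
  have "growth s 0 < a" using growth_nonpos_less[OF s, of 0] a by simp
  moreover have "growth s (min y x) \<ge> a"
  proof (cases "y \<le> x")
    case False
    have "a \<le> (1 - s) * ln m" using growth_le[OF s(2), of y] g by simp
    with False show ?thesis by (simp add: growth_x s)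
  qed (use g in \<open>simp add: min_def\<close>)
  ultimately obtain z where z: "0 \<le> z" "z \<le> min y x" "growth s z = a"
    using IVT'[of "growth s" 0 a "min y x"] y x continuous_on_growth by force
  moreover have "z \<noteq> 0" using \<open>growth s 0 < a\<close> z by auto
  ultimately have "feasible s z" using s by (auto simp: feasible_def)
  moreover have "cost s z \<le> cost s y" using s z by (intro cost_mono) auto
  ultimately show thesis by (rule that)
qed

text \<open>A Slater point: moving other points towards it buys growth at a controlled cost.\<close>

lemma reference_point:
  obtains s1 where "0 < s1" "s1 < 1" "growth s1 x > a"
proof -
  define s1 where "s1 = (1 - a / ln m) / 2"
  have "0 < 1 - a / ln m" "1 - a / ln m < 1" using a ln_m by auto
  then have "0 < s1" "s1 < 1" "s1 < 1 - a / ln m" by (auto simp: s1_def)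
  then show thesis using that[of s1] ln_m by (simp add: growth_x field_simps)
qed

text \<open>The infimum over \<open>growth = a\<close> also bounds the cost on
  \<open>growth \<ge> a\<close>, which is the form that the upper bound on the probability
  needs.\<close>

lemma level_rate_real:
  obtains J where "level_rate \<mu> m a x = ereal J" "J > 0"
    "\<And>s y. 0 < s \<Longrightarrow> s < 1 \<Longrightarrow> growth s y \<ge> a \<Longrightarrow> J \<le> cost s y"
    "\<And>\<beta>. \<beta> > J \<Longrightarrow> \<exists>s y. feasible s y \<and> cost s y < \<beta>"
proof -
  let ?L = "level_rate \<mu> m a x"
  obtain s1 where s1: "0 < s1" "s1 < 1" "growth s1 x > a" by (rule reference_point)
  obtain z1 where z1: "feasible s1 z1" by (rule feasible_below[of s1 x]) (use s1 in auto)
  have low: "ereal (rate \<mu> x - ln m + a) \<le> ?L"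
    unfolding level_rate_eq
  proof (rule Inf_greatest, safe)
    fix s y assume "feasible s y"
    then show "ereal (rate \<mu> x - ln m + a) \<le> ereal (cost s y)"
      using growth_le_cost[of s y] by (auto simp: feasible_def)
  qed
  have up: "?L \<le> ereal (cost s y)" if "feasible s y" for s y
    unfolding level_rate_eq using that by (intro Inf_lower) auto
  obtain J where J: "?L = ereal J"
    using low up[OF z1] by (cases ?L) auto
  show thesis
  proof (rule that[OF J])
    show "J > 0" using low a unfolding J by simp
    show "J \<le> cost s y" if sy: "0 < s" "s < 1" "growth s y \<ge> a" for s y
    proof -
      obtain z where z: "feasible s z" "cost s z \<le> cost s y"
        by (rule feasible_below[OF sy])
      from up[OF z(1)] z(2) show ?thesis unfolding J by simp
    qed
    show "\<exists>s y. feasible s y \<and> cost s y < \<beta>" if "\<beta> > J" for \<beta>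
    proof -
      have "?L < ereal \<beta>" using that J by simp
      then show ?thesis unfolding level_rate_eq Inf_less_iff by force
    qed
  qed
qed

text \<open>Stability of a convex programme under relaxation of its constraint: mixing with the
  reference point restores growth \<open>a\<close> at a small price.\<close>

lemma cost_lower_bound:
  assumes J: "\<And>s y. 0 < s \<Longrightarrow> s < 1 \<Longrightarrow> growth s y \<ge> a \<Longrightarrow> J \<le> cost s y" and e: "e > 0"
  obtains \<delta> where "\<delta> > 0" "\<And>s y. 0 < s \<Longrightarrow> s < 1 \<Longrightarrow> growth s y \<ge> a - \<delta> \<Longrightarrow> J - e \<le> cost s y"
proof -
  obtain s1 where s1: "0 < s1" "s1 < 1" "growth s1 x > a" by (rule reference_point)
  define g where "g = growth s1 x - a"
  define d where "d = cost s1 x - J"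
  have g: "g > 0" and d: "d \<ge> 0" using s1 J[of s1 x] by (auto simp: g_def d_def)
  define \<delta> where "\<delta> = g * e / (d + e)"
  have \<delta>: "\<delta> > 0" using g e d by (simp add: \<delta>_def)
  show thesis
  proof (rule that[OF \<delta>])
    fix s y assume s: "0 < s" "s < 1" and gr: "growth s y \<ge> a - \<delta>"
    \<comment> \<open>With this weight the mixed growth is exactly \<open>a\<close>; the choice of
      \<delta> gives \<open>u * (d + e) \<le> e\<close>.\<close>
    define u where "u = \<delta> / (g + \<delta>)"
    have u: "0 < u" "u < 1" using g \<delta> by (auto simp: u_def)
    let ?s = "(1 - u) * s + u * s1" and ?y = "(1 - u) * y + u * x"
    have "a = (1 - u) * (a - \<delta>) + u * growth s1 x"
    proof -
      have "u * (g + \<delta>) = \<delta>" using g \<delta> by (simp add: u_def)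
      then show ?thesis by (simp add: g_def algebra_simps)
    qed
    also have "\<dots> \<le> (1 - u) * growth s y + u * growth s1 x"
      using u gr by simp
    also have "\<dots> \<le> growth ?s ?y" using s s1 u by (intro growth_concave) auto
    finally have "a \<le> growth ?s ?y" .
    moreover have "0 < ?s" using s s1 u by (simp add: add_pos_pos)
    moreover have "?s < 1" using s s1 u by (intro convex_bound_lt) auto
    ultimately have "J \<le> cost ?s ?y" by (intro J)
    also have "\<dots> \<le> (1 - u) * cost s y + u * cost s1 x" using s s1 u by (intro cost_convex) auto
    finally have le: "J - u * cost s1 x \<le> (1 - u) * cost s y" by simp
    have "u * (d + e) \<le> e"
    proof -
      have "u \<le> \<delta> / g" unfolding u_def using g \<delta> by (intro divide_left_mono) auto
      then have "u * (d + e) \<le> \<delta> / g * (d + e)" using d e by (intro mult_right_mono) auto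
      also have "\<dots> = e" using g d e by (simp add: \<delta>_def)
      finally show ?thesis .
    qed
    then have "(1 - u) * (J - e) \<le> J - u * cost s1 x" by (simp add: d_def algebra_simps)
    with le have "(1 - u) * (J - e) \<le> (1 - u) * cost s y" by simp
    then show "J - e \<le> cost s y" using u by simp
  qed
qed

text \<open>A small move towards the reference point makes the growth strict and, by convexity,
  raises the cost only slightly.\<close>

lemma strictly_feasible:
  assumes "feasible s y" "cost s y < \<beta>"
  obtains s' y' where "0 < s'" "s' < 1" "0 < y'" "y' \<le> x" "growth s' y' > a" "cost s' y' < \<beta>"
proof -
  obtain s1 where s1: "0 < s1" "s1 < 1" "growth s1 x > a" by (rule reference_point)
  have s: "0 < s" "s < 1" "0 < y" "y \<le> x" "growth s y = a" using assms by (auto simp: feasible_def)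
  have "((\<lambda>u. (1 - u) * cost s y + u * cost s1 x) \<longlongrightarrow> (1 - 0) * cost s y + 0 * cost s1 x) (at_right 0)"
    by (intro tendsto_intros)
  then have "\<forall>\<^sub>F u in at_right 0. (1 - u) * cost s y + u * cost s1 x < \<beta>"
    using assms(2) by (intro order_tendstoD(2)) auto
  moreover have "\<forall>\<^sub>F u in at_right (0::real). 0 < u \<and> u < 1"
    by (auto simp: eventually_at_right_field intro!: exI[of _ 1])
  ultimately have "\<forall>\<^sub>F u in at_right 0. 0 < u \<and> u < 1 \<and> (1 - u) * cost s y + u * cost s1 x < \<beta>"
    by eventually_elim simp
  then obtain u where u: "0 < u" "u < 1" "(1 - u) * cost s y + u * cost s1 x < \<beta>"
    using eventually_happens'[OF trivial_limit_at_right_real] by blast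
  let ?s = "(1 - u) * s + u * s1" and ?y = "(1 - u) * y + u * x"
  show thesis
  proof (rule that)
    show "0 < ?s" using s s1 u by (simp add: add_pos_pos)
    show "?s < 1" using s s1 u by (intro convex_bound_lt) auto
    show "0 < ?y" using s x u by (simp add: add_pos_pos)
    show "?y \<le> x" using s u by (intro convex_bound_le) auto
    have "a = (1 - u) * a + u * a" by (simp add: algebra_simps)
    also have "\<dots> < (1 - u) * growth s y + u * growth s1 x" using s s1 u by simp
    also have "\<dots> \<le> growth ?s ?y" using s s1 u by (intro growth_concave) auto
    finally show "a < growth ?s ?y" .
    show "cost ?s ?y < \<beta>" using cost_convex[of s s1 u y x] s s1 u by simp
  qed
qed

end

section \<open>Moment bounds below a barrier\<close>

lemma count_at_empty: "count_at k {} z S = 0"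
  by (induction k arbitrary: z S) auto

context offspring_and_step_law
begin

definition exp_moment :: "real \<Rightarrow> nat \<Rightarrow> (nat \<Rightarrow> real set) \<Rightarrow> real \<Rightarrow> ennreal" where
  "exp_moment s n B z = (\<integral>\<^sup>+S. ennreal (s ^ count_paths n B z S) \<partial>tree_law p \<mu>)"

lemma power_count_paths_measurable:
  assumes "\<And>j. B j \<in> sets borel"
  shows "(\<lambda>(z, S). ennreal (s ^ count_paths n B z S)) \<in> borel_measurable (borel \<Otimes>\<^sub>M tree_law p \<mu>)"
proof -
  have "(\<lambda>w. ennreal (s ^ (nat \<lfloor>(\<lambda>(z, S). real (count_paths n B z S)) w\<rfloor>))) \<in> borel_measurable (borel \<Otimes>\<^sub>M tree_law p \<mu>)"
    by (rule measurable_compose[OF count_paths_measurable[of B n], where g = "\<lambda>r. ennreal (s ^ (nat \<lfloor>r\<rfloor>))"])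
       (use assms in measurable)
  then show ?thesis by (simp add: case_prod_unfold)
qed

lemma exp_moment_0: "exp_moment s 0 B z = ennreal (if z \<in> B 0 then s else 1)"
  by (simp add: exp_moment_def tree.emeasure_space_1[simplified])

lemma exp_moment_ge_1:
  assumes "s \<ge> 1"
  shows "1 \<le> exp_moment s n B z"
proof -
  have "(\<integral>\<^sup>+S. 1 \<partial>tree_law p \<mu>) \<le> exp_moment s n B z"
    unfolding exp_moment_def using assms by (intro nn_integral_mono) simp
  then show ?thesis by (simp add: tree.emeasure_space_1[simplified])
qed

lemma exp_moment_Suc:
  assumes "\<And>j. B j \<in> sets borel" "s \<ge> 0"
  shows "exp_moment s (Suc n) B z =
    (if z \<in> B 0 then gen_fun p (\<integral>\<^sup>+y. exp_moment s n (\<lambda>j. B (Suc j)) (z + y) \<partial>\<mu>) else 1)"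
proof (cases "z \<in> B 0")
  case True
  let ?B = "\<lambda>j. B (Suc j)"
  have "(\<lambda>w. (\<lambda>(z, S). ennreal (s ^ count_paths n ?B z S)) (z + fst w, snd w)) \<in> borel_measurable (borel \<Otimes>\<^sub>M tree_law p \<mu>)"
    by (rule measurable_compose[where f = "\<lambda>w. (z + fst w, snd w)", OF _ power_count_paths_measurable]) (use assms in measurable)
  then have G: "(\<lambda>(y, S). ennreal (s ^ count_paths n ?B (z + y) S)) \<in> borel_measurable (borel \<Otimes>\<^sub>M tree_law p \<mu>)"
    by (simp add: case_prod_unfold)
  have "exp_moment s (Suc n) B z =
      (\<integral>\<^sup>+S. (\<Prod>i<kids S. ennreal (s ^ count_paths n ?B (z + first_step S i) (subtree i S))) \<partial>tree_law p \<mu>)"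
    unfolding exp_moment_def using True assms(2) by (simp add: power_sum prod_ennreal)
  then show ?thesis
    using True branching[OF G] by (simp add: exp_moment_def)
next
  case False
  then show ?thesis by (simp add: exp_moment_def tree.emeasure_space_1[simplified])
qed

end

context supercritical_brw
begin

text \<open>A first moment bound by way of 1 - f(1 - w) \<le> m w, started from 1 \<le> exp (- t (b
  - z)) on \<open>C\<close>. Convolution with the step law only multiplies the exponential by
  \<open>mgf \<mu> t\<close>.\<close>

lemma escape_chernoff:
  assumes C: "C \<in> sets borel" "C \<subseteq> {b..}" and t: "t \<ge> 0"
  shows "ennreal (1 - count_pgf 0 k C z) \<le> ennreal (m ^ k * exp (- t * (b - z))) * mgf \<mu> t ^ k"
proof (induction k arbitrary: z)
  case 0
  show ?case
  proof (cases "z \<in> C")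
    case True
    then have "1 \<le> exp (- t * (b - z))"
      using C(2) t by (auto simp: mult_nonpos_nonneg mult_nonneg_nonpos)
    then show ?thesis using True by (simp add: count_pgf_def ennreal_leI del: exp_le_one_iff one_le_exp_iff)
  qed (simp add: count_pgf_def tree.prob_space[simplified])
next
  case (Suc k)
  note sub = pgf_subsolution_count_pgf[of 0 C, simplified, OF C(1)]
  define w where "w = (\<integral>y. 1 - count_pgf 0 k C (z + y) \<partial>\<mu>)"
  have b: "0 \<le> 1 - count_pgf 0 k C z" "1 - count_pgf 0 k C z \<le> 1" for z
    using sub by (auto simp: pgf_subsolution_def)
  have int: "integrable \<mu> (\<lambda>y. 1 - count_pgf 0 k C (z + y))"
    using integrable_sub[OF sub, of k z] by simp
  have w: "0 \<le> w" "w \<le> 1"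
    unfolding w_def
    by (rule Bochner_Integration.integral_nonneg, rule b, rule integral_le_const[OF int], rule AE_I2, rule b)
  have "count_pgf 0 (Suc k) C z = pgf p (1 - w)"
    using integrable_sub[OF sub, of k z] C
    by (simp add: count_pgf_Suc w_def prob_space[simplified])
  then have "1 - count_pgf 0 (Suc k) C z \<le> m * w"
    using one_minus_pgf_le[OF integrable_offspring mean_offspring_eq w] by simp
  then have "ennreal (1 - count_pgf 0 (Suc k) C z) \<le> ennreal m * ennreal w"
    using mean_gt_1 w by (simp add: ennreal_mult[symmetric] ennreal_leI)
  also have "ennreal w = (\<integral>\<^sup>+y. ennreal (1 - count_pgf 0 k C (z + y)) \<partial>\<mu>)"
    unfolding w_def by (rule nn_integral_eq_integral[symmetric, OF int], rule AE_I2, rule b)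
  also have "\<dots> \<le> (\<integral>\<^sup>+y. ennreal (m ^ k * exp (- t * (b - (z + y)))) * mgf \<mu> t ^ k \<partial>\<mu>)"
    by (intro nn_integral_mono Suc)
  also have "\<dots> = (\<integral>\<^sup>+y. (ennreal (m ^ k * exp (- t * (b - z))) * mgf \<mu> t ^ k) * ennreal (exp (t * y)) \<partial>\<mu>)"
  proof (intro nn_integral_cong)
    fix y
    have eq: "exp (- t * (b - (z + y))) = exp (- t * (b - z)) * exp (t * y)"
      by (simp add: exp_add[symmetric] algebra_simps)
    show "ennreal (m ^ k * exp (- t * (b - (z + y)))) * mgf \<mu> t ^ k =
       (ennreal (m ^ k * exp (- t * (b - z))) * mgf \<mu> t ^ k) * ennreal (exp (t * y))"
      unfolding eq using mean_gt_1 by (simp add: ennreal_mult mult_ac)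
  qed
  also have "\<dots> = (ennreal (m ^ k * exp (- t * (b - z))) * mgf \<mu> t ^ k) * mgf \<mu> t"
    unfolding mgf_def[of \<mu> t] by (rule nn_integral_cmult) simp
  finally have "ennreal (1 - count_pgf 0 (Suc k) C z) \<le>
      ennreal m * ((ennreal (m ^ k * exp (- t * (b - z))) * mgf \<mu> t ^ k) * mgf \<mu> t)"
    by (simp add: mult_left_mono)
  then show ?case
    using mean_gt_1 by (simp add: ennreal_mult mult_ac)
qed

lemma escape_bound:
  assumes C: "C \<in> sets borel" "C \<subseteq> {b..}" and k: "k > 0"
  shows "1 - count_pgf 0 k C z \<le> m ^ k * exp (- real k * rate \<mu> ((b - z) / k))"
  by (rule chernoff[OF k]) (use mean_gt_1 escape_chernoff[OF C] in auto)

text \<open>The two conclusions feed each other: the cap 1 + \<eta> keeps the recursion in the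
  linear regime of the generating function, so the bound for every \<open>t\<close> propagates;
  optimised over \<open>t\<close>, that bound returns the cap, because the starting point is below
  the barrier.\<close>

lemma barrier_moment:
  assumes q: "q \<ge> 0" and \<eta>: "0 < \<eta>" "\<And>w. 0 \<le> w \<Longrightarrow> w \<le> \<eta> \<Longrightarrow> gen_fun p (ennreal (1 + w)) \<le> ennreal (1 + q * w)"
    and l: "0 < l" "l \<le> \<eta>"
    and B: "\<And>j. B j \<in> sets borel" "B n \<subseteq> {c..}"
    and barrier: "\<And>k z. k < n \<Longrightarrow> z \<in> B k \<Longrightarrow>
       l * q ^ (n - k) * exp (- real (n - k) * rate \<mu> ((c - z) / real (n - k))) \<le> \<eta>"
  shows "exp_moment (1 + l) n B z \<le> ennreal (1 + \<eta>) \<and>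
    (\<forall>t\<ge>0. exp_moment (1 + l) n B z \<le> 1 + ennreal (l * q ^ n * exp (- t * (c - z))) * mgf \<mu> t ^ n)"
  using B barrier
proof (induction n arbitrary: B z)
  case 0
  show ?case
  proof (cases "z \<in> B 0")
    case True
    have "l * 1 \<le> l * exp (- t * (c - z))" if "t \<ge> 0" for t
      using True 0(2) l that by (intro mult_left_mono) (auto simp: mult_nonpos_nonneg mult_nonneg_nonpos)
    then have "ennreal l \<le> ennreal (l * exp (- t * (c - z)))" if "t \<ge> 0" for t
      using that by (intro ennreal_leI) simp
    then show ?thesis using True l by (auto simp: exp_moment_0 intro!: add_left_mono)
  qed (use \<eta> in \<open>auto simp: exp_moment_0\<close>)
next
  case (Suc n)
  let ?B = "\<lambda>j. B (Suc j)"
  show ?case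
  proof (cases "z \<in> B 0")
    case False
    \<comment> \<open>Outside the barrier the line is killed: the count is 0 and the moment is
      1.\<close>
    then show ?thesis using \<eta> Suc.prems(1) l by (simp add: exp_moment_Suc)
  next
    case True
    have IH: "exp_moment (1 + l) n ?B z \<le> ennreal (1 + \<eta>)"
      "t \<ge> 0 \<Longrightarrow> exp_moment (1 + l) n ?B z \<le> 1 + ennreal (l * q ^ n * exp (- t * (c - z))) * mgf \<mu> t ^ n" for z t
      using Suc.IH[of ?B z] Suc.prems(1,2) Suc.prems(3)[of "Suc k" for k] by auto
    let ?I = "\<integral>\<^sup>+y. exp_moment (1 + l) n ?B (z + y) \<partial>\<mu>"
    have "?I \<le> (\<integral>\<^sup>+y. ennreal (1 + \<eta>) \<partial>\<mu>)" by (intro nn_integral_mono IH)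
    then have I_le: "?I \<le> ennreal (1 + \<eta>)" by (simp add: emeasure_space_1[simplified])
    have "(\<integral>\<^sup>+y. 1 \<partial>\<mu>) \<le> ?I" using l by (intro nn_integral_mono exp_moment_ge_1) simp
    then have I_ge: "1 \<le> ?I" by (simp add: emeasure_space_1[simplified])
    obtain r where r: "?I = ennreal r" "r \<ge> 0"
      using I_le by (cases ?I) (auto simp: top_unique)
    define w where "w = r - 1"
    have w: "0 \<le> w" "w \<le> \<eta>" "?I = ennreal (1 + w)"
    proof -
      have "ennreal r \<le> ennreal (1 + \<eta>)" using I_le r(1) by simp
      then have "r \<le> 1 + \<eta>" using \<eta>(1) by (subst (asm) ennreal_le_iff) auto
      moreover have "1 \<le> r" using I_ge r by simp
      ultimately show "0 \<le> w" "w \<le> \<eta>" "?I = ennreal (1 + w)" using r by (auto simp: w_def)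
    qed
    have step: "exp_moment (1 + l) (Suc n) B z \<le> ennreal (1 + q * w)"
      using True Suc.prems(1) l w(3) \<eta>(2)[OF w(1,2)] by (simp add: exp_moment_Suc)
    have qw: "ennreal (q * w) \<le> ennreal (l * q ^ Suc n * exp (- t * (c - z))) * mgf \<mu> t ^ Suc n" if t: "t \<ge> 0" for t
    proof -
      have "?I \<le> (\<integral>\<^sup>+y. 1 + (ennreal (l * q ^ n * exp (- t * (c - z))) * mgf \<mu> t ^ n) * ennreal (exp (t * y)) \<partial>\<mu>)"
      proof (intro nn_integral_mono)
        fix y
        have eq: "exp (- t * (c - (z + y))) = exp (- t * (c - z)) * exp (t * y)"
          by (simp add: exp_add[symmetric] algebra_simps)
        show "exp_moment (1 + l) n ?B (z + y) \<le> 1 + (ennreal (l * q ^ n * exp (- t * (c - z))) * mgf \<mu> t ^ n) * ennreal (exp (t * y))"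
          using IH(2)[OF t, of "z + y"] l q unfolding eq by (simp add: ennreal_mult mult_ac)
      qed
      also have "\<dots> = 1 + (ennreal (l * q ^ n * exp (- t * (c - z))) * mgf \<mu> t ^ n) * mgf \<mu> t"
        unfolding mgf_def[of \<mu> t]
        by (subst nn_integral_add, simp, simp, subst nn_integral_cmult) (simp_all add: emeasure_space_1[simplified])
      finally have "1 + ennreal w \<le> 1 + (ennreal (l * q ^ n * exp (- t * (c - z))) * mgf \<mu> t ^ n) * mgf \<mu> t"
        using w by simp
      then have "ennreal w \<le> (ennreal (l * q ^ n * exp (- t * (c - z))) * mgf \<mu> t ^ n) * mgf \<mu> t"
        by (simp add: ennreal_add_left_cancel_le)
      then have "ennreal q * ennreal w \<le> ennreal q * ((ennreal (l * q ^ n * exp (- t * (c - z))) * mgf \<mu> t ^ n) * mgf \<mu> t)"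
        by (rule mult_left_mono) simp
      then show ?thesis using q l w(1) by (simp add: ennreal_mult mult_ac)
    qed
    have "q * w \<le> \<eta>"
    proof (cases "q = 0")
      case False
      \<comment> \<open>Here \<open>t\<close> is optimised for the excess \<open>q * w\<close> over
        1; the barrier hypothesis at time 0 then bounds the result by \<eta>.\<close>
      then have "q * w \<le> (l * q ^ Suc n) * exp (- real (Suc n) * rate \<mu> ((c - z) / real (Suc n)))"
        using q l qw by (intro chernoff) auto
      also have "\<dots> \<le> \<eta>" using Suc.prems(3)[of 0 z] True by simp
      finally show ?thesis .
    qed (use \<eta> in simp)
    then have "exp_moment (1 + l) (Suc n) B z \<le> ennreal (1 + \<eta>)"
      by (intro order.trans[OF step] ennreal_leI) simp
    moreover have "exp_moment (1 + l) (Suc n) B z \<le> 1 + ennreal (l * q ^ Suc n * exp (- t * (c - z))) * mgf \<mu> t ^ Suc n"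
      if "t \<ge> 0" for t
    proof -
      have "ennreal (1 + q * w) = 1 + ennreal (q * w)" using q w by simp
      with step have "exp_moment (1 + l) (Suc n) B z \<le> 1 + ennreal (q * w)" by simp
      also have "\<dots> \<le> 1 + ennreal (l * q ^ Suc n * exp (- t * (c - z))) * mgf \<mu> t ^ Suc n"
        by (intro add_left_mono qw that)
      finally show ?thesis .
    qed
    ultimately show ?thesis by blast
  qed
qed

end

section \<open>Bounds for the probability of a high level\<close>

lemma eventually_linear_ge:
  fixes A R :: real
  assumes "A > 0"
  shows "\<forall>\<^sub>F n in sequentially. R \<le> A * real n"
proof (rule eventually_sequentiallyI[of "nat \<lceil>R / A\<rceil>"])
  fix n assume "nat \<lceil>R / A\<rceil> \<le> n"
  then have "R / A \<le> real n" by linarith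
  then show "R \<le> A * real n" using assms by (simp add: field_simps)
qed

context supercritical_brw
begin

lemma count_pgf_0: "count_pgf s 0 C z = (if z \<in> C then s else 1)"
  by (simp add: count_pgf_def tree.prob_space[simplified])

lemma prob_count_at_ge:
  assumes "C \<in> sets borel"
  shows "tree.prob {S. K \<le> real (count_at k C z S)} = 1 - prob_below K k C z"
proof -
  have [measurable]: "(\<lambda>S. real (count_at k C z S)) \<in> borel_measurable (tree_law p \<mu>)"
    by (rule count_at_measurable_tree[OF assms])
  have set: "{S. real (count_at k C z S) < K} \<in> sets (tree_law p \<mu>)"
  proof -
    have "{S \<in> space (tree_law p \<mu>). real (count_at k C z S) < K} \<in> sets (tree_law p \<mu>)" by measurable
    then show ?thesis by simp
  qed
  have "prob_below K k C z = (\<integral>S. indicator {S. real (count_at k C z S) < K} S \<partial>tree_law p \<mu>)"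
    unfolding prob_below_def by (intro Bochner_Integration.integral_cong) (auto simp: indicator_def)
  also have "\<dots> = tree.prob {S. real (count_at k C z S) < K}" using set by simp
  finally have "1 - prob_below K k C z = tree.prob (space (tree_law p \<mu>) - {S. real (count_at k C z S) < K})"
    using tree.prob_compl[OF set] by simp
  also have "space (tree_law p \<mu>) - {S. real (count_at k C z S) < K} = {S. K \<le> real (count_at k C z S)}" by auto
  finally show ?thesis by simp
qed

text \<open>The indicator of n < K is at most exp (- l n) + l K, so the Laplace transform at scale
  \<open>l\<close> detects \<open>K\<close> particles up to an error \<open>l * K\<close>.\<close>

lemma count_pgf_ge_prob_below:
  assumes C: "C \<in> sets borel" and l: "0 \<le> l" and K: "0 \<le> K"
  shows "1 - count_pgf (exp (- l)) k C z \<le> 1 - prob_below K k C z + l * K"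
proof -
  have i1: "integrable (tree_law p \<mu>) (\<lambda>S. exp (- l) ^ count_at k C z S)"
    using l by (intro tree.integrable_const_bound[where B = 1] count_at_function_measurable_tree[OF C])
      (auto simp: power_le_one)
  have i2: "integrable (tree_law p \<mu>) (\<lambda>S. of_bool (real (count_at k C z S) < K) :: real)"
    using count_at_function_measurable_tree[OF C, of "\<lambda>n. of_bool (real n < K)"]
    by (intro tree.integrable_const_bound[where B = 1]) auto
  have "of_bool (real n < K) \<le> exp (- l) ^ n + l * K" for n
  proof (cases "real n < K")
    case True
    have "1 \<le> exp (- (l * real n)) + l * real n"
      using exp_ge_add_one_self[of "- (l * real n)"] by simp
    also have "\<dots> \<le> exp (- (l * real n)) + l * K"
      using True l by (intro add_left_mono mult_left_mono) auto
    finally show ?thesis using True by (simp add: exp_of_nat_mult[symmetric] mult.commute)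
  qed (use l K in simp)
  then have "prob_below K k C z \<le> (\<integral>S. exp (- l) ^ count_at k C z S + l * K \<partial>tree_law p \<mu>)"
    unfolding prob_below_def by (intro integral_mono i2 Bochner_Integration.integrable_add i1) auto
  also have "\<dots> = count_pgf (exp (- l)) k C z + l * K"
    unfolding count_pgf_def using i1 by (simp add: tree.prob_space[simplified])
  finally show ?thesis by simp
qed

end

locale brw_level_problem = supercritical_brw \<mu> p m + level_problem \<mu> m a x for \<mu> p m a x
begin

definition hit_prob :: "nat \<Rightarrow> real" where
  "hit_prob n = tree.prob {S. exp (a * real n) \<le> real (count_at n {x * real n..} 0 S)}"

text \<open>The phases are treated in reverse order: from every start above y n the later phase
  succeeds with probability at least \<open>\<kappa>2 / 4\<close>, and this constant is the initial
  value of the earlier phase.\<close>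

lemma hit_prob_lower:
  assumes s: "0 < s" "s < 1" and y: "0 < y" "y \<le> x" and g: "growth s y > a" and \<beta>: "cost s y < \<beta>"
  obtains \<kappa> where "\<kappa> > 0" "\<forall>\<^sub>F n in sequentially. \<kappa> * exp (- \<beta> * real n) \<le> hit_prob n"
proof -
  have \<beta>_pos: "\<beta> > 0" using growth_le_cost[OF s, of y] g \<beta> a by linarith
  have "rate \<mu> (y / s) < \<beta> / s + ln m"
    using \<beta> s by (simp add: cost_def field_simps)
  then obtain c1 where c1: "y / s < c1" "rate \<mu> c1 < \<beta> / s + ln m" by (rule rate_right)
  have "rate \<mu> ((x - y) / (1 - s)) < ln m - a / (1 - s)"
    using g s by (simp add: growth_def field_simps)
  then obtain c2 where c2: "(x - y) / (1 - s) < c2" "rate \<mu> c2 < ln m - a / (1 - s)" by (rule rate_right)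
  \<comment> \<open>Half of the growth margin: at scale l = exp (- (a + d) n) the descendants still
    number about 1 / l, while the error \<open>l * K\<close> = exp (- d n) vanishes.\<close>
  define d where "d = ((1 - s) * (ln m - rate \<mu> c2) - a) / 2"
  have d: "d > 0" using c2(2) s by (simp add: d_def field_simps)
  have c_pos: "c1 > 0" "c2 > 0"
    using c1(1) c2(1) s y by (auto intro: less_trans[of 0 "y / s"] le_less_trans[of 0 "(x - y) / (1 - s)"])
  \<comment> \<open>\<open>\<gamma>1\<close> is positive, the cost of a rare ascent;
    \<open>\<gamma>2\<close> is negative, and the later phase grows until it is of order
    one.\<close>
  define \<gamma>1 \<gamma>2 where "\<gamma>1 = \<beta> / s" and "\<gamma>2 = - ((a + d) / (1 - s))"
  have \<gamma>1: "\<gamma>1 > rate \<mu> c1 - ln m" using c1 by (simp add: \<gamma>1_def)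
  have "(a + d) / (1 - s) < ln m - rate \<mu> c2" using d s by (simp add: d_def field_simps)
  then have \<gamma>2: "\<gamma>2 > rate \<mu> c2 - ln m" by (simp add: \<gamma>2_def)
  obtain \<kappa>1 R1 where \<kappa>1: "\<kappa>1 > 0"
    "\<And>u v b k z. pgf_subsolution u \<Longrightarrow> 0 \<le> v \<Longrightarrow> v \<le> 1 \<Longrightarrow> (\<And>z. z \<ge> b \<Longrightarrow> v \<le> 1 - u 0 z) \<Longrightarrow>
       z \<ge> b - c1 * real k + R1 \<Longrightarrow> \<kappa>1 * min (v * exp (- \<gamma>1 * real k)) 1 \<le> 1 - u k z"
    using survival_lower_bound[OF c_pos(1) \<gamma>1] by metis
  obtain \<kappa>2 R2 where \<kappa>2: "\<kappa>2 > 0"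
    "\<And>u v b k z. pgf_subsolution u \<Longrightarrow> 0 \<le> v \<Longrightarrow> v \<le> 1 \<Longrightarrow> (\<And>z. z \<ge> b \<Longrightarrow> v \<le> 1 - u 0 z) \<Longrightarrow>
       z \<ge> b - c2 * real k + R2 \<Longrightarrow> \<kappa>2 * min (v * exp (- \<gamma>2 * real k)) 1 \<le> 1 - u k z"
    using survival_lower_bound[OF c_pos(2) \<gamma>2] by metis
  have "\<forall>\<^sub>F n in sequentially. R2 \<le> (c2 * (1 - s) - (x - y)) * real n"
    using c2(1) s by (intro eventually_linear_ge) (simp add: field_simps)
  moreover have "\<forall>\<^sub>F n in sequentially. c1 + R1 \<le> (c1 * s - y) * real n"
    using c1(1) s by (intro eventually_linear_ge) (simp add: field_simps)
  moreover have "\<forall>\<^sub>F n in sequentially. - ln (\<kappa>2 / 4) \<le> d * real n"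
    using d by (rule eventually_linear_ge)
  ultimately have "\<forall>\<^sub>F n in sequentially. \<kappa>1 * (\<kappa>2 / 4) * exp (- \<beta> * real n) \<le> hit_prob n"
  proof eventually_elim
    case (elim n)
    \<comment> \<open>Rounding down leaves at least (1 - s) n generations to the later phase; the
      earlier one loses at most one, which the extra \<open>c1\<close> in the position bound
      covers.\<close>
    define k1 k2 where "k1 = nat \<lfloor>s * real n\<rfloor>" and "k2 = n - k1"
    have sn: "s * real n \<le> real n" "0 \<le> s * real n" using s by (auto intro: mult_left_le_one_le)
    have k1: "real k1 \<le> s * real n" "s * real n - 1 \<le> real k1" using sn by (auto simp: k1_def)
    then have "real k1 \<le> real n" using sn by linarith
    then have k2: "n = k2 + k1" "real k2 \<ge> (1 - s) * real n"
      using k1 by (auto simp: k2_def of_nat_diff algebra_simps)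
    define l K where "l = exp (- (a + d) * real n)" and "K = exp (a * real n)"
    define C where "C = {x * real n..}"
    have C: "C \<in> sets borel" by (simp add: C_def)
    have "- (a + d) * real n \<le> 0" using a d by (intro mult_nonpos_nonneg) auto
    then have l: "0 < l" "l \<le> 1" by (auto simp: l_def)
    define v where "v = 1 - exp (- l)"
    have "exp (- l) \<le> 1 / (1 + l)"
      using exp_ge_add_one_self[of l] l by (simp add: exp_minus field_simps)
    then have "l / (1 + l) \<le> v" using l by (simp add: v_def field_simps)
    moreover have "l / 2 \<le> l / (1 + l)" using l by (intro divide_left_mono) auto
    ultimately have v: "l / 2 \<le> v" by linarith
    have phase2: "\<kappa>2 / 4 \<le> 1 - prob_below K k2 C z" if z: "z \<ge> y * real n" for z
    proof -
      have "c2 * ((1 - s) * real n) \<le> c2 * real k2" using k2 c_pos by (intro mult_left_mono) auto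
      then have "z \<ge> x * real n - c2 * real k2 + R2"
        using z elim(1) by (simp add: algebra_simps)
      then have "\<kappa>2 * min (v * exp (- \<gamma>2 * real k2)) 1 \<le> 1 - count_pgf (exp (- l)) k2 C z"
        using l C by (intro \<kappa>2(2)[of _ _ "x * real n"] pgf_subsolution_count_pgf) (auto simp: count_pgf_0 C_def v_def)
      moreover have "1 / 2 \<le> min (v * exp (- \<gamma>2 * real k2)) 1"
      proof -
        have "(a + d) / (1 - s) * ((1 - s) * real n) \<le> (a + d) / (1 - s) * real k2"
          using k2 a d s by (intro mult_left_mono) auto
        then have "exp ((a + d) * real n) \<le> exp (- \<gamma>2 * real k2)" using s by (simp add: \<gamma>2_def)
        then have "l / 2 * exp ((a + d) * real n) \<le> v * exp (- \<gamma>2 * real k2)"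
          using v l by (intro mult_mono) auto
        moreover have "l / 2 * exp ((a + d) * real n) = 1 / 2"
        proof -
          have "l * exp ((a + d) * real n) = 1"
            unfolding l_def exp_add[symmetric] by (simp add: algebra_simps)
          then show ?thesis by simp
        qed
        ultimately show ?thesis by simp
      qed
      then have "\<kappa>2 * (1 / 2) \<le> \<kappa>2 * min (v * exp (- \<gamma>2 * real k2)) 1"
        using \<kappa>2(1) by (intro mult_left_mono) auto
      moreover have "1 - count_pgf (exp (- l)) k2 C z \<le> 1 - prob_below K k2 C z + l * K"
        using l by (intro count_pgf_ge_prob_below C) (auto simp: K_def)
      moreover have "l * K \<le> \<kappa>2 / 4"
      proof -
        have "l * K = exp (- (d * real n))" by (simp add: l_def K_def exp_add[symmetric] algebra_simps)
        also have "\<dots> \<le> exp (ln (\<kappa>2 / 4))" using elim(3) by simp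
        finally show ?thesis using \<kappa>2(1) by simp
      qed
      ultimately show ?thesis by simp
    qed
    have sub: "pgf_subsolution (\<lambda>i. prob_below K (k2 + i) C)" by (rule pgf_subsolution_prob_below[OF C])
    then have \<kappa>2_le: "\<kappa>2 / 4 \<le> 1"
      using phase2[OF order.refl] unfolding pgf_subsolution_def by (metis add.right_neutral diff_ge_0_iff_ge diff_le_eq dual_order.trans le_add_same_cancel1)
    have "c1 * (s * real n - 1) \<le> c1 * real k1" using k1 c_pos by (intro mult_left_mono) auto
    then have "0 \<ge> y * real n - c1 * real k1 + R1" using elim(2) by (simp add: algebra_simps)
    then have "\<kappa>1 * min (\<kappa>2 / 4 * exp (- \<gamma>1 * real k1)) 1 \<le> 1 - prob_below K (k2 + k1) C 0"
      using phase2 \<kappa>2_le \<kappa>2(1) by (intro \<kappa>1(2)[OF sub, of _ "y * real n"]) auto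
    moreover have "\<kappa>2 / 4 * exp (- \<beta> * real n) \<le> min (\<kappa>2 / 4 * exp (- \<gamma>1 * real k1)) 1"
    proof (rule min.boundedI)
      have "\<gamma>1 * real k1 \<le> \<gamma>1 * (s * real n)"
        using k1 \<beta>_pos s by (intro mult_left_mono) (auto simp: \<gamma>1_def)
      also have "\<dots> = \<beta> * real n" using s by (simp add: \<gamma>1_def)
      finally show "\<kappa>2 / 4 * exp (- \<beta> * real n) \<le> \<kappa>2 / 4 * exp (- \<gamma>1 * real k1)"
        using \<kappa>2(1) by (intro mult_left_mono) auto
      show "\<kappa>2 / 4 * exp (- \<beta> * real n) \<le> 1"
        by (rule mult_le_one[OF \<kappa>2_le]) (use \<beta>_pos in auto)
    qed
    then have "\<kappa>1 * (\<kappa>2 / 4 * exp (- \<beta> * real n)) \<le> \<kappa>1 * min (\<kappa>2 / 4 * exp (- \<gamma>1 * real k1)) 1"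
      using \<kappa>1(1) by (intro mult_left_mono) auto
    moreover have "hit_prob n = 1 - prob_below K (k2 + k1) C 0"
      unfolding hit_prob_def using prob_count_at_ge[OF C, of K n 0] k2(1) by (simp add: K_def C_def)
    ultimately show ?case by (simp add: mult.assoc)
  qed
  then show thesis using \<kappa>1(1) \<kappa>2(1) by (intro that[of "\<kappa>1 * (\<kappa>2 / 4)"]) auto
qed

text \<open>The first moment bound sees the exit set only through its lowest point, which belongs to
  the set by closedness and has cost at least \<open>J\<close>. The condition on \<delta> keeps the
  set in [0, \<infinity>), so that the lowest point exists.\<close>

lemma prob_escape_le:
  assumes n: "k < n" and k: "0 < k" and \<delta>: "a - \<delta> > ln m - rate \<mu> x"
    and J: "\<And>s y. 0 < s \<Longrightarrow> s < 1 \<Longrightarrow> growth s y \<ge> a - \<delta> \<Longrightarrow> J \<le> cost s y"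
  defines "E \<equiv> {z. a - \<delta> \<le> growth (real k / real n) (z / real n)}"
  shows "tree.prob {S. 1 \<le> real (count_at k E 0 S)} \<le> exp (- J * real n)"
proof (cases "E = {}")
  case True
  then show ?thesis by (simp add: count_at_empty)
next
  case False
  let ?s = "real k / real n"
  have s: "0 < ?s" "?s < 1" using n k by auto
  have cont: "continuous_on UNIV (\<lambda>z. growth ?s (z / real n))"
    by (rule continuous_on_compose2[OF continuous_on_growth[of UNIV]])
       (use n in \<open>auto intro!: continuous_intros\<close>)
  have closed: "closed E"
    unfolding E_def by (intro closed_Collect_le continuous_intros cont)
  have low: "0 \<le> z" if "z \<in> E" for z
  proof (rule ccontr)
    assume "\<not> 0 \<le> z"
    then have "z / real n \<le> 0" by (simp add: divide_nonpos_nonneg)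
    then show False
      using growth_nonpos_less[OF s, of "z / real n"] that \<delta> by (simp add: E_def)
  qed
  define b where "b = Inf E"
  have bdd: "bdd_below E" using low by (auto simp: bdd_below_def)
  have b: "b \<in> E" unfolding b_def using closed_contains_Inf[OF False bdd closed] .
  have sub: "E \<subseteq> {b..}" unfolding b_def using bdd by (auto intro: cInf_lower)
  have E: "E \<in> sets borel" using closed by (rule borel_closed)
  have "prob_below 1 k E 0 = count_pgf 0 k E 0"
    unfolding prob_below_def count_pgf_def by (intro Bochner_Integration.integral_cong) (auto simp: power_0_left)
  then have "tree.prob {S. 1 \<le> real (count_at k E 0 S)} = 1 - count_pgf 0 k E 0"
    using prob_count_at_ge[OF E, of 1 k 0] by simp
  also have "\<dots> \<le> m ^ k * exp (- real k * rate \<mu> ((b - 0) / k))"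
    by (rule escape_bound[OF E sub k])
  also have "\<dots> = exp (- (real n * cost ?s (b / real n)))"
  proof -
    have "m ^ k = exp (real k * ln m)" using mean_gt_1 by (simp add: exp_of_nat_mult)
    then show ?thesis
      using n k by (simp add: cost_def exp_add[symmetric] algebra_simps)
  qed
  also have "\<dots> \<le> exp (- J * real n)"
  proof -
    have "J \<le> cost ?s (b / real n)" using b by (intro J s) (simp add: E_def)
    then have "real n * J \<le> real n * cost ?s (b / real n)" by (intro mult_left_mono) auto
    then show ?thesis by (simp add: mult.commute)
  qed
  finally show ?thesis .
qed

lemma hit_prob_upper:
  assumes \<theta>: "\<theta> > 0" "integrable (measure_pmf p) (\<lambda>k. exp (\<theta> * real k))"
    and J: "\<And>s y. 0 < s \<Longrightarrow> s < 1 \<Longrightarrow> growth s y \<ge> a \<Longrightarrow> J \<le> cost s y" and e: "e > 0"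
  shows "\<forall>\<^sub>F n in sequentially. hit_prob n \<le> exp (- (J - e) * real n)"
proof -
  obtain \<delta>0 where \<delta>0: "\<delta>0 > 0" "\<And>s y. 0 < s \<Longrightarrow> s < 1 \<Longrightarrow> growth s y \<ge> a - \<delta>0 \<Longrightarrow> J - e / 2 \<le> cost s y"
    using cost_lower_bound[OF J, of "e / 2"] e by (metis half_gt_zero)
  \<comment> \<open>The three bounds serve the relaxed cost estimate, the origin lying below the
    barrier, and a nonnegative \<open>a - \<delta> / 2\<close> in the scale
    \<open>l\<close>.\<close>
  define \<delta> where "\<delta> = min \<delta>0 (min ((a - (ln m - rate \<mu> x)) / 2) a)"
  have \<delta>: "\<delta> > 0" "\<delta> \<le> \<delta>0" "\<delta> \<le> a" "a - \<delta> > ln m - rate \<mu> x"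
  proof -
    have "\<delta> \<le> (a - (ln m - rate \<mu> x)) / 2" unfolding \<delta>_def by (rule min.coboundedI2, rule min.cobounded1)
    then show "a - \<delta> > ln m - rate \<mu> x" using a(3) by (simp add: field_simps)
  qed (use \<delta>0(1) a in \<open>auto simp: \<delta>_def\<close>)
  \<comment> \<open>Half of \<delta> is spent on linearising the generating function; the other half
    remains in \<open>l * K\<close> = \<eta> exp (\<delta> n / 2).\<close>
  define q where "q = m * exp (\<delta> / 2)"
  have q: "q > m" using mean_gt_1 \<delta> by (simp add: q_def)
  obtain \<eta> where \<eta>: "0 < \<eta>" "\<And>w. 0 \<le> w \<Longrightarrow> w \<le> \<eta> \<Longrightarrow> gen_fun p (ennreal (1 + w)) \<le> ennreal (1 + q * w)"
    using gen_fun_le[OF integrable_offspring mean_offspring_eq _ \<theta>, of "q - m"] q by auto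
  have bound: "hit_prob n \<le> real n * exp (- (J - e / 2) * real n) +
      (1 + \<eta>) * exp (- (\<eta> / (1 + \<eta>) * exp (\<delta> / 2 * real n)))" if n: "n > 0" for n
  proof -
    \<comment> \<open>Before time \<open>n\<close> the barrier is the growth level
      \<open>a - \<delta>\<close>; at time \<open>n\<close> the set is the target half line.\<close>
    define B where "B k = (if k < n then {z. growth (real k / real n) (z / real n) < a - \<delta>} else {x * real n..})" for k
    define l where "l = \<eta> * exp (- (a - \<delta> / 2) * real n)"
    define K where "K = exp (a * real n)"
    have l: "0 < l" "l \<le> \<eta>"
    proof -
      have "- (a - \<delta> / 2) * real n \<le> 0" using \<delta> by (intro mult_nonpos_nonneg) auto
      then have "\<eta> * exp (- (a - \<delta> / 2) * real n) \<le> \<eta> * 1"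
        using \<eta>(1) by (intro mult_left_mono) auto
      then show "l \<le> \<eta>" by (simp add: l_def)
    qed (use \<eta>(1) in \<open>simp add: l_def\<close>)
    have B_borel: "B k \<in> sets borel" for k
    proof -
      have "continuous_on UNIV (\<lambda>z. growth (real k / real n) (z / real n))"
        by (rule continuous_on_compose2[OF continuous_on_growth[of UNIV]])
           (use n in \<open>auto intro!: continuous_intros\<close>)
      then have "open {z. growth (real k / real n) (z / real n) < a - \<delta>}"
        by (intro open_Collect_less continuous_intros)
      then show ?thesis by (auto simp: B_def)
    qed
    \<comment> \<open>Since \<open>growth 0 0\<close> is below \<open>a - \<delta>\<close>, no
      escape is possible at time 0 and the union bound starts at \<open>k = 1\<close>.\<close>
    have "0 \<in> B 0" using n \<delta> by (simp add: B_def growth_def)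
    have "exp_moment (1 + l) n B 0 \<le> ennreal (1 + \<eta>)"
    proof (rule barrier_moment[where c = "x * real n" and q = q, THEN conjunct1])
      fix k z assume k: "k < n" and z: "z \<in> B k"
      let ?r = "rate \<mu> ((x * real n - z) / real (n - k))"
      have r_eq: "(x - z / real n) / (1 - real k / real n) = (x * real n - z) / real (n - k)"
      proof -
        have "(x - z / real n) = (x * real n - z) / real n" "1 - real k / real n = real (n - k) / real n"
          using k by (auto simp: field_simps of_nat_diff)
        then show ?thesis using n by simp
      qed
      have "real n * growth (real k / real n) (z / real n) = real (n - k) * (ln m - ?r)"
      proof -
        have "real n * (1 - real k / real n) = real (n - k)" using k by (simp add: field_simps of_nat_diff)
        then show ?thesis unfolding growth_def r_eq mult.assoc[symmetric] by simp
      qed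
      moreover have "real n * growth (real k / real n) (z / real n) \<le> real n * (a - \<delta>)"
        using z k by (intro mult_left_mono) (auto simp: B_def)
      moreover have "real (n - k) * (\<delta> / 2) \<le> real n * (\<delta> / 2)" using \<delta> by (intro mult_right_mono) auto
      ultimately have le: "real (n - k) * (ln m + \<delta> / 2) - real (n - k) * ?r \<le> (a - \<delta> / 2) * real n"
        by (simp add: algebra_simps)
      have "q ^ (n - k) = exp (real (n - k) * (ln m + \<delta> / 2))"
        using mean_gt_1 by (simp add: exp_of_nat_mult q_def exp_add)
      then have "l * q ^ (n - k) * exp (- real (n - k) * ?r) =
          \<eta> * (exp (- (a - \<delta> / 2) * real n) * exp (real (n - k) * (ln m + \<delta> / 2) - real (n - k) * ?r))"
        by (simp only: l_def exp_diff exp_minus mult_minus_left divide_inverse mult.assoc)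
      also have "exp (- (a - \<delta> / 2) * real n) * exp (real (n - k) * (ln m + \<delta> / 2) - real (n - k) * ?r) \<le> 1"
      proof -
        have "- (a - \<delta> / 2) * real n + (real (n - k) * (ln m + \<delta> / 2) - real (n - k) * ?r) \<le> 0"
          using le unfolding mult_minus_left by linarith
        then show ?thesis unfolding exp_add[symmetric] by simp
      qed
      then have "\<eta> * (exp (- (a - \<delta> / 2) * real n) * exp (real (n - k) * (ln m + \<delta> / 2) - real (n - k) * ?r)) \<le> \<eta> * 1"
        using \<eta>(1) by (intro mult_left_mono) auto
      finally show "l * q ^ (n - k) * exp (- real (n - k) * ?r) \<le> \<eta>" by simp
    qed (use \<eta> l B_borel q mean_gt_1 in \<open>auto simp: B_def\<close>)
    then have moment: "(\<integral>\<^sup>+S. ennreal ((1 + l) ^ count_paths n B 0 S) \<partial>tree_law p \<mu>) \<le> ennreal (1 + \<eta>)"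
      by (simp add: exp_moment_def)
    let ?Y = "{S. K \<le> real (count_paths n B 0 S)}"
    have [measurable]: "(\<lambda>S. real (count_paths n B 0 S)) \<in> borel_measurable (tree_law p \<mu>)"
      by (rule count_paths_measurable_tree[OF B_borel])
    have Y: "?Y \<in> sets (tree_law p \<mu>)"
    proof -
      have "{S \<in> space (tree_law p \<mu>). K \<le> real (count_paths n B 0 S)} \<in> sets (tree_law p \<mu>)" by measurable
      then show ?thesis by simp
    qed
    \<comment> \<open>Markov's inequality for the exponential moment at level \<open>K\<close>;
      \<open>powr\<close> because \<open>K\<close> need not be an integer.\<close>
    let ?A = "(1 + l) powr K"
    have "ennreal (?A * tree.prob ?Y) = (\<integral>\<^sup>+S. ennreal ?A * indicator ?Y S \<partial>tree_law p \<mu>)"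
      using Y by (simp add: nn_integral_cmult_indicator tree.emeasure_eq_measure ennreal_mult)
    also have "\<dots> \<le> (\<integral>\<^sup>+S. ennreal ((1 + l) ^ count_paths n B 0 S) \<partial>tree_law p \<mu>)"
    proof (intro nn_integral_mono)
      fix S
      have "?A \<le> (1 + l) ^ count_paths n B 0 S" if "K \<le> real (count_paths n B 0 S)"
        using that l by (simp add: powr_realpow[symmetric] powr_mono)
      then show "ennreal ?A * indicator ?Y S \<le> ennreal ((1 + l) ^ count_paths n B 0 S)"
        by (auto simp: indicator_def intro!: ennreal_leI)
    qed
    also note moment
    finally have markov: "?A * tree.prob ?Y \<le> 1 + \<eta>"
      using \<eta>(1) by (subst (asm) ennreal_le_iff) auto
    have "\<eta> / (1 + \<eta>) * exp (\<delta> / 2 * real n) \<le> K * ln (1 + l)"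
    proof -
      have "\<eta> / (1 + \<eta>) * exp (\<delta> / 2 * real n) = K * (l / (1 + \<eta>))"
      proof -
        have "exp (\<delta> / 2 * real n) = exp (a * real n) * exp (- (a - \<delta> / 2) * real n)"
          by (simp add: exp_add[symmetric] algebra_simps)
        then show ?thesis by (simp add: K_def l_def)
      qed
      also have "l / (1 + \<eta>) \<le> l / (1 + l)" using l \<eta> by (intro divide_left_mono) auto
      also have "l / (1 + l) \<le> ln (1 + l)" 
        using ln_le_minus_one[of "1 / (1 + l)"] l by (simp add: ln_div field_simps)
      finally show ?thesis by (simp add: K_def)
    qed
    then have "exp (\<eta> / (1 + \<eta>) * exp (\<delta> / 2 * real n)) \<le> ?A"
      using l by (simp add: powr_def)
    then have "exp (\<eta> / (1 + \<eta>) * exp (\<delta> / 2 * real n)) * tree.prob ?Y \<le> 1 + \<eta>"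
      using markov by (meson measure_nonneg mult_right_mono order.trans)
    then have Y_le: "tree.prob ?Y \<le> (1 + \<eta>) * exp (- (\<eta> / (1 + \<eta>) * exp (\<delta> / 2 * real n)))"
      by (simp add: exp_minus field_simps)
    let ?E = "\<lambda>k. {S. 1 \<le> real (count_at k (- B k) 0 S)}"
    have E: "?E k \<in> sets (tree_law p \<mu>)" for k
    proof -
      have [measurable]: "(\<lambda>S. real (count_at k (- B k) 0 S)) \<in> borel_measurable (tree_law p \<mu>)"
        using B_borel[of k] by (intro count_at_measurable_tree) (simp add: Compl_in_sets_lebesgue borel_comp)
      have "{S \<in> space (tree_law p \<mu>). 1 \<le> real (count_at k (- B k) 0 S)} \<in> sets (tree_law p \<mu>)" by measurable
      then show ?thesis by simp
    qed
    have "{S. K \<le> real (count_at n {x * real n..} 0 S)} \<subseteq> ?Y \<union> (\<Union>k\<in>{1..<n}. ?E k)"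
    proof (rule subsetI, rule ccontr)
      fix S assume S: "S \<in> {S. K \<le> real (count_at n {x * real n..} 0 S)}"
        and not: "S \<notin> ?Y \<union> (\<Union>k\<in>{1..<n}. ?E k)"
      have "count_at k (- B k) 0 S = 0" if "k < n" for k
        using not that \<open>0 \<in> B 0\<close> by (cases "k = 0") (auto simp: not_le)
      then have "count_at n (B n) 0 S \<le> count_paths n B 0 S" by (rule count_at_le_count_paths)
      then show False using S not by (simp add: B_def)
    qed
    then have "hit_prob n \<le> tree.prob (?Y \<union> (\<Union>k\<in>{1..<n}. ?E k))"
      unfolding hit_prob_def K_def[symmetric] using Y E
      by (intro tree.finite_measure_mono) auto
    also have "\<dots> \<le> tree.prob ?Y + tree.prob (\<Union>k\<in>{1..<n}. ?E k)"
      using Y E by (intro measure_Un_le) auto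
    also have "tree.prob (\<Union>k\<in>{1..<n}. ?E k) \<le> (\<Sum>k\<in>{1..<n}. tree.prob (?E k))"
      using E by (intro tree.finite_measure_subadditive_finite) auto
    also have "\<dots> \<le> (\<Sum>k\<in>{1..<n}. exp (- (J - e / 2) * real n))"
    proof (rule sum_mono)
      fix k assume k: "k \<in> {1..<n}"
      have "- B k = {z. a - \<delta> \<le> growth (real k / real n) (z / real n)}"
        using k by (auto simp: B_def)
      then show "tree.prob (?E k) \<le> exp (- (J - e / 2) * real n)"
        using prob_escape_le[of k n \<delta> "J - e / 2"] k \<delta> \<delta>0(2) by auto
    qed
    also have "\<dots> \<le> real n * exp (- (J - e / 2) * real n)" by simp
    finally show ?thesis using Y_le by simp
  qed
  \<comment> \<open>The spare \<open>e / 2\<close> absorbs the factor \<open>n\<close> of the union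
    bound over escape times.\<close>
  have "\<forall>\<^sub>F n in sequentially. real n * exp (- (J - e / 2) * real n) \<le> 1 / 2 * exp (- (J - e) * real n)"
  proof -
    have "(\<lambda>n. real n * exp (- (e / 2) * real n)) \<longlonglongrightarrow> 0" using e by real_asymp
    then have "\<forall>\<^sub>F n in sequentially. real n * exp (- (e / 2) * real n) < 1 / 2"
      by (rule order_tendstoD(2)) simp
    then show ?thesis
    proof eventually_elim
      case (elim n)
      have "- (J - e / 2) * real n = - (e / 2) * real n + - (J - e) * real n"
        by (simp add: algebra_simps)
      then have "real n * exp (- (J - e / 2) * real n) =
          real n * exp (- (e / 2) * real n) * exp (- (J - e) * real n)"
        by (simp only: exp_add mult.assoc)
      also have "\<dots> \<le> 1 / 2 * exp (- (J - e) * real n)"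
        using elim by (intro mult_right_mono) auto
      finally show ?case .
    qed
  qed
  moreover have "\<forall>\<^sub>F n in sequentially. (1 + \<eta>) * exp (- (\<eta> / (1 + \<eta>) * exp (\<delta> / 2 * real n))) \<le> 1 / 2 * exp (- (J - e) * real n)"
  proof -
    define c where "c = \<eta> / (1 + \<eta>)"
    have "c > 0" using \<eta>(1) by (simp add: c_def)
    have "\<delta> > 0" by (rule \<delta>)
    have "(\<lambda>n. exp (- (c * exp (\<delta> / 2 * real n)) + (J - e) * real n)) \<longlonglongrightarrow> 0"
      using \<open>c > 0\<close> \<open>\<delta> > 0\<close> by real_asymp
    then have "\<forall>\<^sub>F n in sequentially. exp (- (c * exp (\<delta> / 2 * real n)) + (J - e) * real n) < 1 / (2 * (1 + \<eta>))"
      using \<eta>(1) by (intro order_tendstoD(2)) auto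
    then show ?thesis
    proof eventually_elim
      case (elim n)
      have "(1 + \<eta>) * exp (- (c * exp (\<delta> / 2 * real n))) =
          (1 + \<eta>) * exp (- (c * exp (\<delta> / 2 * real n)) + (J - e) * real n) * exp (- (J - e) * real n)"
        by (simp add: exp_add[symmetric] algebra_simps)
      also have "\<dots> \<le> (1 + \<eta>) * (1 / (2 * (1 + \<eta>))) * exp (- (J - e) * real n)"
        using elim \<eta>(1) by (intro mult_right_mono mult_left_mono) auto
      also have "(1 + \<eta>) * (1 / (2 * (1 + \<eta>))) = 1 / 2" using \<eta>(1) by (simp add: field_simps)
      finally show ?case by (simp add: c_def)
    qed
  qed
  ultimately show ?thesis
    using eventually_gt_at_top[of 0]
  proof eventually_elim
    case (elim n)
    then show ?case using bound[of n] by simp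
  qed
qed

lemma hit_prob_limit:
  assumes \<theta>: "\<theta> > 0" "integrable (measure_pmf p) (\<lambda>k. exp (\<theta> * real k))"
  shows "\<exists>J>0. level_rate \<mu> m a x = ereal J \<and>
    (\<lambda>n. ereal (1 / real n) * elog (ennreal (hit_prob n))) \<longlonglongrightarrow> ereal (- J)"
proof -
  obtain J where J: "level_rate \<mu> m a x = ereal J" "J > 0"
    "\<And>s y. 0 < s \<Longrightarrow> s < 1 \<Longrightarrow> growth s y \<ge> a \<Longrightarrow> J \<le> cost s y"
    "\<And>\<beta>. \<beta> > J \<Longrightarrow> \<exists>s y. feasible s y \<and> cost s y < \<beta>"
    using level_rate_real by blast
  let ?L = "\<lambda>n. 1 / real n * ln (hit_prob n)"
  have lower: "\<forall>\<^sub>F n in sequentially. 0 < hit_prob n \<and> - \<beta> < ?L n" if \<beta>: "\<beta> > J" for \<beta>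
  proof -
    obtain \<beta>' where \<beta>': "J < \<beta>'" "\<beta>' < \<beta>" using dense[OF \<beta>] by blast
    obtain s0 y0 where "feasible s0 y0" "cost s0 y0 < \<beta>'" using J(4)[OF \<beta>'(1)] by blast
    then obtain s y where sy: "0 < s" "s < 1" "0 < y" "y \<le> x" "growth s y > a" "cost s y < \<beta>'"
      by (rule strictly_feasible)
    obtain \<kappa> where \<kappa>: "\<kappa> > 0" "\<forall>\<^sub>F n in sequentially. \<kappa> * exp (- \<beta>' * real n) \<le> hit_prob n"
      using hit_prob_lower[OF sy] by blast
    have "\<forall>\<^sub>F n in sequentially. - ln \<kappa> + 1 \<le> (\<beta> - \<beta>') * real n"
      using \<beta>' by (intro eventually_linear_ge) simp
    with \<kappa>(2) show ?thesis
      using eventually_gt_at_top[of 0]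
    proof eventually_elim
      case (elim n)
      have "0 < \<kappa> * exp (- \<beta>' * real n)" using \<kappa>(1) by simp
      with elim(1) have pos: "0 < hit_prob n" by simp
      have "ln \<kappa> - \<beta>' * real n = ln (\<kappa> * exp (- \<beta>' * real n))" using \<kappa>(1) by (simp add: ln_mult)
      also have "\<dots> \<le> ln (hit_prob n)" using elim(1) \<kappa>(1) pos by (subst ln_le_cancel_iff) auto
      finally have "- \<beta> * real n < ln (hit_prob n)" using elim(2) by (simp add: algebra_simps)
      then show ?case using elim(3) pos by (simp add: field_simps)
    qed
  qed
  have upper: "\<forall>\<^sub>F n in sequentially. ?L n < - \<beta>" if \<beta>: "\<beta> < J" for \<beta>
  proof -
    have "\<forall>\<^sub>F n in sequentially. hit_prob n \<le> exp (- (J - (J - \<beta>) / 2) * real n)"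
      using \<beta> by (intro hit_prob_upper[OF \<theta> J(3)]) auto
    \<comment> \<open>Positivity, supplied by the lower bound, is needed before taking logarithms,
      since \<open>ln 0 = 0\<close>.\<close>
    moreover have "\<forall>\<^sub>F n in sequentially. 0 < hit_prob n" using lower[of "J + 1"] by (auto elim: eventually_mono)
    ultimately show ?thesis
      using eventually_gt_at_top[of 0]
    proof eventually_elim
      case (elim n)
      have "ln (hit_prob n) \<le> - (J - (J - \<beta>) / 2) * real n"
        using elim(1,2) by (metis exp_gt_zero ln_exp ln_le_cancel_iff)
      also have "\<dots> < - \<beta> * real n" 
      proof (rule mult_strict_right_mono)
        show "- (J - (J - \<beta>) / 2) < - \<beta>" using \<beta> by (simp add: field_simps)
      qed (use elim(3) in simp)
      finally show ?case using elim(3) by (simp add: field_simps)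
    qed
  qed
  have "?L \<longlonglongrightarrow> - J"
  proof (rule order_tendstoI)
    show "\<forall>\<^sub>F n in sequentially. r < ?L n" if "r < - J" for r
      using lower[of "- r"] that by (auto elim: eventually_mono)
    show "\<forall>\<^sub>F n in sequentially. ?L n < r" if "r > - J" for r
      using upper[of "- r"] that by auto
  qed
  then have "(\<lambda>n. ereal (?L n)) \<longlonglongrightarrow> ereal (- J)" by simp
  then have "(\<lambda>n. ereal (1 / real n) * elog (ennreal (hit_prob n))) \<longlonglongrightarrow> ereal (- J)"
  proof (rule Lim_transform_eventually)
    show "\<forall>\<^sub>F n in sequentially. ereal (?L n) = ereal (1 / real n) * elog (ennreal (hit_prob n))"
      using lower[of "J + 1"] by (auto elim!: eventually_mono simp: elog_def)
  qed
  with J(1,2) show ?thesis by (intro exI[of _ J]) simp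
qed

end

section \<open>Transfer of the limit from the canonical tree to the given process\<close>

lemma (in branching_random_walk) emeasure_particles:
  assumes "offspring_and_step_law \<mu>"
  shows "emeasure M {\<omega> \<in> space M. K \<le> real (particles N D n {c..} \<omega>)} =
    emeasure (tree_law p \<mu>) {S. K \<le> real (count_at n {c..} 0 S)}"
proof -
  interpret step: offspring_and_step_law \<mu> p by (rule assms)
  have [measurable]: "(\<lambda>S. real (count_at n {c..} 0 S)) \<in> borel_measurable (tree_law p \<mu>)"
    by (rule step.count_at_measurable_tree) simp
  have "{S \<in> space (tree_law p \<mu>). K \<le> real (count_at n {c..} 0 S)} \<in> sets (tree_law p \<mu>)" by measurable
  then have "{S. K \<le> real (count_at n {c..} 0 S)} \<in> sets (PiM UNIV (\<lambda>_. borel))" by simp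
  then have "emeasure (tree_law p \<mu>) {S. K \<le> real (count_at n {c..} 0 S)} =
      emeasure M (tree_of N D -` {S. K \<le> real (count_at n {c..} 0 S)} \<inter> space M)"
    unfolding distr_tree_of[symmetric] by (rule emeasure_distr[OF tree_of_measurable])
  then show ?thesis
    by (simp add: particles_eq_count_at vimage_def Int_def conj_commute)
qed

theorem theorem1p1:
  fixes M :: "'a measure" and p :: "nat pmf" and \<mu> :: "real measure"
    and N :: "nat list \<Rightarrow> 'a \<Rightarrow> nat" and D :: "nat list \<times> nat \<Rightarrow> 'a \<Rightarrow> real"
    and m \<kappa> \<theta> x a :: real
  assumes brw: "branching_random_walk M p \<mu> N D"
    and m: "m = mean_offspring M N D"
    and p0: "pmf p 0 = 0"
    and mean_finite: "integrable M (\<lambda>\<omega>. real (particles N D 1 UNIV \<omega>))"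
    and mean_gt_1: "1 < m"
    and step_integrable: "integrable \<mu> (\<lambda>z. z)"
    and step_centered: "(\<integral>z. z \<partial>\<mu>) = 0"
    and step_nontrivial: "measure \<mu> {0} < 1"
    and step_exp_moment: "\<kappa> > 0" "integrable \<mu> (\<lambda>z. exp (\<kappa> * z))"
    and offspring_exp_moment: "\<theta> > 0" "integrable M (\<lambda>\<omega>. exp (\<theta> * real (particles N D 1 UNIV \<omega>)))"
    and x: "0 < x" "ereal x < step_esssup \<mu>"
    and a: "max (ereal (ln m) - step_rate \<mu> x) 0 < ereal a" "a < ln m"
    and unbounded: "step_esssup \<mu> = \<infinity>"
  shows "(\<lambda>n. ereal (1 / real n) *
            elog (emeasure M {\<omega> \<in> space M. real (particles N D n {x * real n..} \<omega>) \<ge> exp (a * real n)}))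
           \<longlonglongrightarrow> - level_rate \<mu> m a x
         \<and> - level_rate \<mu> m a x \<in> {-\<infinity><..<0}"
proof -
  interpret brw: branching_random_walk M p \<mu> N D by (rule brw)
  interpret step: prob_space \<mu> by (rule brw.prob_space_step)
  have sets: "sets \<mu> = sets borel" by (rule brw.sets_step_law_eq)
  have N_meas: "N [] \<in> measurable M (count_space UNIV)" by (rule brw.N_measurable)
  \<comment> \<open>The first generation has \<open>N []\<close> particles, so the moment
    assumptions on it are moment assumptions on \<open>p\<close>.\<close>
  have integrable_N: "integrable (measure_pmf p) f \<longleftrightarrow> integrable M (\<lambda>\<omega>. f (N [] \<omega>))" for f :: "nat \<Rightarrow> real"
    using integrable_distr_eq[OF N_meas, of f] by (simp add: brw.offspring_law)
  have mean_p: "(\<integral>k. real k \<partial>measure_pmf p) = m"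
    using integral_distr[OF N_meas, of real] by (simp add: brw.offspring_law m mean_offspring_def particles_1 del: One_nat_def)
  have unbounded_above: "measure \<mu> {y<..} > 0" for y
  proof -
    have "ereal y < Sup {ereal x | x. measure \<mu> {x<..} > 0}"
      using unbounded by (simp add: step_esssup_def)
    then obtain z where z: "y < z" "measure \<mu> {z<..} > 0"
      unfolding less_Sup_iff by auto
    have "measure \<mu> {z<..} \<le> measure \<mu> {y<..}"
      using z sets by (intro step.finite_measure_mono) auto
    with z show ?thesis by simp
  qed
  interpret unbounded_step_law \<mu>
    by unfold_locales (use sets step_integrable step_centered unbounded_above in auto)
  have "ln m - rate \<mu> x < a" "0 < a"
    using a(1) unfolding step_rate_eq by (auto simp: max_def zero_ereal_def split: if_splits)
  then interpret brw_level_problem \<mu> p m a x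
    by unfold_locales
      (use p0 mean_finite mean_p mean_gt_1 x(1) a(2) in \<open>auto simp: integrable_N particles_1 simp del: One_nat_def\<close>)
  have "integrable (measure_pmf p) (\<lambda>k. exp (\<theta> * real k))"
    using offspring_exp_moment(2) by (simp add: integrable_N particles_1 del: One_nat_def)
  with offspring_exp_moment(1) obtain J where J: "J > 0" "level_rate \<mu> m a x = ereal J"
    "(\<lambda>n. ereal (1 / real n) * elog (ennreal (hit_prob n))) \<longlonglongrightarrow> ereal (- J)"
    using hit_prob_limit by blast
  have "offspring_and_step_law \<mu>" by unfold_locales
  then have "emeasure M {\<omega> \<in> space M. real (particles N D n {x * real n..} \<omega>) \<ge> exp (a * real n)} = ennreal (hit_prob n)" for n
    by (simp add: brw.emeasure_particles hit_prob_def tree.emeasure_eq_measure)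
  then show ?thesis using J by simp
qed

end
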